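(* Let $\bar u$ be a nonconstant $T$-periodic stationary solution of $u_t+f(u)_x=(B(u)u_x)_x$, with associated rest point $u_-$, periodic Evans function $D$, transversality coefficient $\gamma$, mass derivative $\partial\bar u_m/\partial u_-$, coefficient $\Delta=\det(\partial \bar u_m/\partial u_-)$ and stability index $\Gamma$ as defined in the context. Assume: (i) $f,B\in C^2$; (ii) $\operatorname{Re}\sigma(B(\bar u(x)))>0$ for all $x$; (iii) $df(u_-)$ is invertible; (iv) $\gamma\neq 0$. Then $$\Gamma=\operatorname{sgn}\big(\gamma\,\Delta\,\det df(u_-)\big).$$ In particular, $\operatorname{sgn}\big(\gamma\,\Delta\,\det df(u_-)\big)\ge 0$ is necessary for weak spectral stability of $\bar u$.
   Context: Setting. Consider $u_t+f(u)_x=(B(u)u_x)_x$, $x\in\mathbb R$, $u,f(u)\in\mathbb R^n$, $B(u)\in\mathbb R^{n\times n}$. Periodic traveling waves $\bar u(x-st)$ are taken, in their rest frame (replacing $f(u)$ by $f(u)-su$), to have speed $s=0$. Thus $\bar u(x)$ is a nonconstant $T$-periodic solution of $B(u)u'=f(u)-f(u_-)$ with $\bar u(0)=\bar u(T)=u_0$, where $u_-\in\mathbb R^n$ is a rest point of this ODE. Coordinates in $\mathbb R^n$ are chosen so that $\bar u'(0)=e_1$, the first standard basis vector. Linearized operator: $Lv=(Bv_x)_x-(Av)_x$, where $B=B(\bar u(x))$ and $A(x)v=df(\bar u(x))v-(dB(\bar u(x))v)\bar u'(x)$ are $T$-periodic. Weak spectral stability of $\bar u$ means $\sigma(L)\subset\{\operatorname{Re}\lambda\le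 0\}$, $L$ acting on $L^p(\mathbb R)$. Evans function: the eigenvalue equation $(Bw')'=(Aw)'+\lambda w$ is written as $W'=\mathbb A(\lambda,x)W$, $W=(w,w')^t$, $\mathbb A=\begin{pmatrix}0&I\\ B^{-1}(\lambda I+A')&B^{-1}(A-B')\end{pmatrix}$. Let $\Psi'=\mathbb A\Psi$, $\Psi(0,\lambda)=I$, $M(\lambda)=\Psi(T,\lambda)$, and $D(k,\lambda)=\det(M(\lambda)-e^{ikT}I)$ for $k\in\mathbb R$, $\lambda\in\mathbb C$. Variations: for parameters $(u_-,u_0,s)$ near the base values (with $s=0$), let $\bar u^{(u_-,u_0,s)}(x)$ solve $B(u)u'=f(u)-f(u_-)-s(u-u_-)$, $u(0)=u_0$. At the base values put $w_j=(\partial\bar u/\partial u_0)e_j$, $w_{n+j}=(\partial\bar u/\partial u_-)e_j$ ($1\le j\le n$), $\tilde z_1=-\partial\bar u/\partial s$. Write $[g]=g(T)-g(0)$. The transversality coefficient is $\gamma=\det([\tilde z_1],[w_2],\dots,[w_n])$. Mass derivative: if $\gamma\ne0$, then by the Implicit Function Theorem, near the base point the parameters for which $\bar u^{(u_-,u_0,s)}(T)=u_0$ form an $(n+1)$-dimensional surface parametrized by $(u_-,u_0^1)$, $u_0^1=u_0\cdot e_1$. On it define $\bar u_m=\int_0^T\bar u^{(u_-,u_0,s)}(y)\,dy$ (independent of $u_0^1$), and let $\partial\bar u_m/\partial u_-$ be its $n\times n$ derivative at the base point with $u_0^1$ fixed. Equivalently its $j$-th column is $\int_0^T\tilde w_{n+j}$,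 where $\tilde w_{n+j}$ is the unique element of $w_{n+j}+\operatorname{Span}(\tilde z_1,w_2,\dots,w_n)$ with $[\tilde w_{n+j}]=0$. Put $\Delta=\det(\partial\bar u_m/\partial u_-)$. Stability index: $\Gamma=\operatorname{sgn}\big[(\partial/\partial\lambda)^{n+1}D(0,0)\cdot D(0,+\infty)\big]$, where $D(0,+\infty)$ stands for $\lim\operatorname{sgn}D(0,\lambda)$ as $\lambda\to+\infty$ along the real axis (this limit exists). *)

theory Defs
  imports "HOL-Analysis.Analysis" "HOL-Probability.Essential_Supremum"
begin

definition C2_map :: "('a::real_normed_vector \<Rightarrow> 'b::real_normed_vector) \<Rightarrow> bool" where
  "C2_map F \<longleftrightarrow>
    (\<exists>(F' :: 'a \<Rightarrow> 'a \<Rightarrow>\<^sub>L 'b) (F'' :: 'a \<Rightarrow> 'a \<Rightarrow>\<^sub>L ('a \<Rightarrow>\<^sub>L 'b)).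
      (\<forall>x. (F has_derivative blinfun_apply (F' x)) (at x)) \<and>
      (\<forall>x. (F' has_derivative blinfun_apply (F'' x)) (at x)) \<and>
      continuous_on UNIV F'')"

abbreviation cmat :: "real^'n^'m \<Rightarrow> complex^'n^'m" where
  "cmat M \<equiv> map_matrix complex_of_real M"

definition mat_spectrum :: "real^'n^'n::finite \<Rightarrow> complex set" where
  "mat_spectrum M = {\<mu>. \<exists>v::complex^'n. v \<noteq> 0 \<and> cmat M *v v = \<mu> *s v}"


section \<open>The profile and the linearized operator\<close>

definition stationary_profile ::
    "(real^'n \<Rightarrow> real^'n) \<Rightarrow> (real^'n \<Rightarrow> real^'n^'n) \<Rightarrow> real^'n \<Rightarrow> (real \<Rightarrow> real^'n::finite) \<Rightarrow> bool" where
  "stationary_profile f B um ubar \<longleftrightarrow>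
    (\<forall>x. ubar differentiable (at x) \<and>
         B (ubar x) *v vector_derivative ubar (at x) = f (ubar x) - f um)"

definition Bcoef :: "(real^'n \<Rightarrow> real^'n^'n) \<Rightarrow> (real \<Rightarrow> real^'n) \<Rightarrow> real \<Rightarrow> real^'n^'n::finite" where
  "Bcoef B ubar x = B (ubar x)"

definition Acoef ::
    "(real^'n \<Rightarrow> real^'n) \<Rightarrow> (real^'n \<Rightarrow> real^'n^'n) \<Rightarrow> (real \<Rightarrow> real^'n) \<Rightarrow> real \<Rightarrow> real^'n^'n::finite" where
  "Acoef f B ubar x =
    matrix (\<lambda>v. frechet_derivative f (at (ubar x)) v
              - frechet_derivative B (at (ubar x)) v *v vector_derivative ubar (at x))"


section \<open>Spectrum of \<open>Lv = (B v')' - (A v)'\<close> on \<open>L\<^sup>p\<close>, for p in [1, \<infinity>]\<close>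

definition Lp :: "ennreal \<Rightarrow> (real \<Rightarrow> 'a::euclidean_space) \<Rightarrow> bool" where
  "Lp p v \<longleftrightarrow> v \<in> borel_measurable lborel \<and>
    (if p = \<infinity> then esssup lborel (\<lambda>x. ennreal (norm (v x))) < \<infinity>
     else integrable lborel (\<lambda>x. norm (v x) powr enn2real p))"

definition Lp_norm :: "ennreal \<Rightarrow> (real \<Rightarrow> 'a::euclidean_space) \<Rightarrow> real" where
  "Lp_norm p v =
    (if p = \<infinity> then enn2real (esssup lborel (\<lambda>x. ennreal (norm (v x))))
     else (LINT x|lborel. norm (v x) powr enn2real p) powr (1 / enn2real p))"

text \<open>\<open>v\<close> is locally absolutely continuous with almost-everywhere derivative \<open>w\<close>. Sobolev functions
  of one variable are represented below by their unique continuous representative, so equality of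
  elements of the domain of \<open>L\<close> is equality of functions; \<open>w\<close> matters only up to null sets.\<close>

definition ac_deriv :: "(real \<Rightarrow> 'a::euclidean_space) \<Rightarrow> (real \<Rightarrow> 'a) \<Rightarrow> bool" where
  "ac_deriv v w \<longleftrightarrow>
    (\<forall>a b. a \<le> b \<longrightarrow> set_integrable lborel {a..b} w \<and> (LINT x:{a..b}|lborel. w x) = v b - v a)"

text \<open>The graph of \<open>L\<close> on \<open>L\<^sup>p\<close> with domain \<open>W\<^sup>2\<^sup>,\<^sup>p\<close>: here \<open>v1 = v'\<close>, \<open>v2 = v''\<close>, \<open>g = L v\<close>.\<close>

definition L_graph ::
    "(real \<Rightarrow> real^'n^'n) \<Rightarrow> (real \<Rightarrow> real^'n^'n) \<Rightarrow> ennreal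
      \<Rightarrow> (real \<Rightarrow> complex^'n::finite) \<Rightarrow> (real \<Rightarrow> complex^'n) \<Rightarrow> bool" where
  "L_graph Bx Ax p v g \<longleftrightarrow> Lp p g \<and>
    (\<exists>v1 v2. Lp p v \<and> Lp p v1 \<and> Lp p v2 \<and> ac_deriv v v1 \<and> ac_deriv v1 v2 \<and>
      ac_deriv (\<lambda>x. cmat (Bx x) *v v1 x - cmat (Ax x) *v v x) g)"

text \<open>\<open>l\<close> is in the resolvent set iff \<open>L - l\<close> is a bijection from its domain onto \<open>L\<^sup>p\<close> with bounded
  inverse; \<open>(L - l) v = h\<close> is written as \<open>L v = h + l v\<close>.\<close>

definition L_resolvent_set ::
    "(real \<Rightarrow> real^'n^'n::finite) \<Rightarrow> (real \<Rightarrow> real^'n^'n) \<Rightarrow> ennreal \<Rightarrow> complex set" where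
  "L_resolvent_set Bx Ax p = {l.
    (\<forall>h. Lp p h \<longrightarrow> (\<exists>!v. L_graph Bx Ax p v (\<lambda>x. h x + l *s v x))) \<and>
    (\<exists>C. \<forall>h v. Lp p h \<and> L_graph Bx Ax p v (\<lambda>x. h x + l *s v x)
               \<longrightarrow> Lp_norm p v \<le> C * Lp_norm p h)}"

definition L_spectrum ::
    "(real \<Rightarrow> real^'n^'n::finite) \<Rightarrow> (real \<Rightarrow> real^'n^'n) \<Rightarrow> ennreal \<Rightarrow> complex set" where
  "L_spectrum Bx Ax p = - L_resolvent_set Bx Ax p"

definition weakly_spectrally_stable ::
    "(real^'n \<Rightarrow> real^'n) \<Rightarrow> (real^'n \<Rightarrow> real^'n^'n) \<Rightarrow> (real \<Rightarrow> real^'n::finite) \<Rightarrow> ennreal \<Rightarrow> bool" where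
  "weakly_spectrally_stable f B ubar p \<longleftrightarrow>
    L_spectrum (Bcoef B ubar) (Acoef f B ubar) p \<subseteq> {l. Re l \<le> 0}"


section \<open>The periodic Evans function\<close>

definition block_mat ::
    "'a^'n^'n \<Rightarrow> 'a^'n^'n \<Rightarrow> 'a^'n^'n \<Rightarrow> 'a^'n^'n \<Rightarrow> 'a^('n + 'n)^('n + 'n::finite)" where
  "block_mat P Q R S = (\<chi> i j. case i of
      Inl a \<Rightarrow> (case j of Inl b \<Rightarrow> P $ a $ b | Inr b \<Rightarrow> Q $ a $ b)
    | Inr a \<Rightarrow> (case j of Inl b \<Rightarrow> R $ a $ b | Inr b \<Rightarrow> S $ a $ b))"

definition evans_coef ::
    "(real \<Rightarrow> real^'n^'n) \<Rightarrow> (real \<Rightarrow> real^'n^'n) \<Rightarrow> complex \<Rightarrow> real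
      \<Rightarrow> complex^('n + 'n)^('n + 'n::finite)" where
  "evans_coef Bx Ax l x =
    block_mat 0 (mat 1)
      (cmat (matrix_inv (Bx x)) ** (mat l + cmat (vector_derivative Ax (at x))))
      (cmat (matrix_inv (Bx x) ** (Ax x - vector_derivative Bx (at x))))"

definition fundamental_solution ::
    "(real \<Rightarrow> complex^'m^'m) \<Rightarrow> real \<Rightarrow> complex^'m^'m::finite" where
  "fundamental_solution AA =
    (THE \<Psi>. \<Psi> 0 = mat 1 \<and> (\<forall>x. (\<Psi> has_vector_derivative AA x ** \<Psi> x) (at x)))"

definition evans ::
    "(real^'n \<Rightarrow> real^'n) \<Rightarrow> (real^'n \<Rightarrow> real^'n^'n) \<Rightarrow> (real \<Rightarrow> real^'n::finite) \<Rightarrow> real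
      \<Rightarrow> real \<Rightarrow> complex \<Rightarrow> complex" where
  "evans f B ubar T k l =
    det (fundamental_solution (evans_coef (Bcoef B ubar) (Acoef f B ubar) l) T
         - mat (exp (\<i> * of_real (k * T))))"

text \<open>The argument of \<open>sgn\<close> is a real number, regarded as an element of \<open>complex\<close> because \<open>evans\<close>
  is complex-valued.\<close>

definition stability_index ::
    "(real^'n \<Rightarrow> real^'n) \<Rightarrow> (real^'n \<Rightarrow> real^'n^'n) \<Rightarrow> (real \<Rightarrow> real^'n::finite) \<Rightarrow> real \<Rightarrow> complex" where
  "stability_index f B ubar T =
    sgn ((deriv ^^ (CARD('n) + 1)) (\<lambda>l. evans f B ubar T 0 l) 0
         * Lim at_top (\<lambda>t::real. sgn (evans f B ubar T 0 (of_real t))))"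


section \<open>Variations of the profile\<close>

text \<open>Solutions are considered on one period only. Near the base parameters the solution on
  \<open>{0..T}\<close> exists and is unique, so that the choice below only fixes irrelevant values.\<close>

definition profile_solves ::
    "(real^'n \<Rightarrow> real^'n) \<Rightarrow> (real^'n \<Rightarrow> real^'n^'n) \<Rightarrow> real \<Rightarrow> real^'n \<Rightarrow> real^'n \<Rightarrow> real
      \<Rightarrow> (real \<Rightarrow> real^'n::finite) \<Rightarrow> bool" where
  "profile_solves f B T um u0 s u \<longleftrightarrow> u 0 = u0 \<and>
    (\<forall>x\<in>{0..T}. \<exists>u'. (u has_vector_derivative u') (at x within {0..T}) \<and>
       B (u x) *v u' = f (u x) - f um - s *\<^sub>R (u x - um))"

definition profile ::
    "(real^'n \<Rightarrow> real^'n) \<Rightarrow> (real^'n \<Rightarrow> real^'n^'n) \<Rightarrow> real \<Rightarrow> real^'n \<Rightarrow> real^'n \<Rightarrow> real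
      \<Rightarrow> real \<Rightarrow> real^'n::finite" where
  "profile f B T um u0 s = (SOME u. profile_solves f B T um u0 s u)"

definition var_u0 ::
    "(real^'n \<Rightarrow> real^'n) \<Rightarrow> (real^'n \<Rightarrow> real^'n^'n) \<Rightarrow> real \<Rightarrow> real^'n \<Rightarrow> real^'n \<Rightarrow> 'n
      \<Rightarrow> real \<Rightarrow> real^'n::finite" where
  "var_u0 f B T um u0 j x =
    frechet_derivative (\<lambda>v. profile f B T um v 0 x) (at u0) (axis j 1)"

definition var_speed ::
    "(real^'n \<Rightarrow> real^'n) \<Rightarrow> (real^'n \<Rightarrow> real^'n^'n) \<Rightarrow> real \<Rightarrow> real^'n \<Rightarrow> real^'n
      \<Rightarrow> real \<Rightarrow> real^'n::finite" where
  "var_speed f B T um u0 x = - vector_derivative (\<lambda>s. profile f B T um u0 s x) (at 0)"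

text \<open>The index \<open>i1\<close> plays the role of the first coordinate: \<open>axis i1 1\<close> is the basis vector
  \<open>e\<^sub>1\<close>. The determinant has the speed variation in column \<open>i1\<close> and the variation with respect to
  the \<open>j\<close>-th component of \<open>u\<^sub>0\<close> in every other column \<open>j\<close>; rows and columns carry the same index
  type, so its value does not depend on how the remaining indices are enumerated.\<close>

definition transversality ::
    "(real^'n \<Rightarrow> real^'n) \<Rightarrow> (real^'n \<Rightarrow> real^'n^'n) \<Rightarrow> real \<Rightarrow> 'n \<Rightarrow> real^'n \<Rightarrow> real^'n::finite \<Rightarrow> real" where
  "transversality f B T i1 um u0 =
    det (\<chi> i j. (if j = i1 then var_speed f B T um u0 T - var_speed f B T um u0 0
                 else var_u0 f B T um u0 j T - var_u0 f B T um u0 j 0) $ i)"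

text \<open>Parametrization \<open>(u\<^sub>-, a) \<mapsto> (u\<^sub>0, s)\<close>, with \<open>a = u\<^sub>0 \<bullet> e\<^sub>1\<close>, of the surface of periodic
  profiles near the base point. By the implicit function theorem, when the transversality
  coefficient is nonzero such a map exists, and any two of them agree near the base point.\<close>

definition periodic_chart ::
    "(real^'n \<Rightarrow> real^'n) \<Rightarrow> (real^'n \<Rightarrow> real^'n^'n) \<Rightarrow> real \<Rightarrow> 'n \<Rightarrow> real^'n \<Rightarrow> real^'n
      \<Rightarrow> ((real^'n) \<times> real \<Rightarrow> (real^'n::finite) \<times> real) \<Rightarrow> bool" where
  "periodic_chart f B T i1 um u0 G \<longleftrightarrow>
    G (um, u0 $ i1) = (u0, 0) \<and> isCont G (um, u0 $ i1) \<and>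
    (\<forall>\<^sub>F q in nhds (um, u0 $ i1).
       fst (G q) $ i1 = snd q \<and>
       (\<exists>u. profile_solves f B T (fst q) (fst (G q)) (snd (G q)) u) \<and>
       profile f B T (fst q) (fst (G q)) (snd (G q)) T = fst (G q))"

definition mass_map ::
    "(real^'n \<Rightarrow> real^'n) \<Rightarrow> (real^'n \<Rightarrow> real^'n^'n) \<Rightarrow> real \<Rightarrow> 'n \<Rightarrow> real^'n \<Rightarrow> real^'n
      \<Rightarrow> (real^'n) \<times> real \<Rightarrow> real^'n::finite" where
  "mass_map f B T i1 um u0 q =
    (let G = (SOME G. periodic_chart f B T i1 um u0 G)
     in integral {0..T} (profile f B T (fst q) (fst (G q)) (snd (G q))))"

definition mass_derivative ::
    "(real^'n \<Rightarrow> real^'n) \<Rightarrow> (real^'n \<Rightarrow> real^'n^'n) \<Rightarrow> real \<Rightarrow> 'n \<Rightarrow> real^'n \<Rightarrow> real^'n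
      \<Rightarrow> real^'n^'n::finite" where
  "mass_derivative f B T i1 um u0 =
    jacobian (\<lambda>v. mass_map f B T i1 um u0 (v, u0 $ i1)) (at um)"

end

theory Submission
  imports Defs "HOL-Complex_Analysis.Complex_Analysis" "HOL-Computational_Algebra.Fundamental_Theorem_Algebra"
begin

text \<open>
  In the variables \<open>(w, y)\<close> with \<open>y = B w' - A w\<close> the eigenvalue equation reads
  \<open>w' = B\<^sup>-\<^sup>1 (A w + y)\<close>, \<open>y' = l w\<close>, so that the lower half of \<open>M(l) - 1\<close> is
  \<open>l\<close> times the integral over a period of the upper half of the fundamental solution. Hence
  \<open>D(0, l) = l\<^sup>n H(l)\<close>, and \<open>H(0) = 0\<close> because the column of \<open>ubar'\<close> vanishes;
  replacing that column by its \<open>l\<close>-derivative gives \<open>H'(0)\<close>. The columns are the variations of the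
  profile, and a Schur complement turns \<open>\<gamma> \<Delta>\<close> into \<open>(-1)\<^sup>n H'(0) det df(um)\<close>.
  For large real \<open>l\<close> a homotopy to \<open>w'' = l w\<close> shows that \<open>D(0, l)\<close> has sign \<open>(-1)\<^sup>n\<close>; a
  Lyapunov matrix field for \<open>B\<close> excludes periodic solutions along it. If the two signs disagree,
  \<open>D(0, \<cdot>)\<close> has a positive zero, and slowly varying cutoffs of the periodic mode put that zero
  into the spectrum on every \<open>L\<^sup>p\<close>.
\<close>

section \<open>Gronwall estimates and global existence\<close>

text \<open>Eliminating the periodicity constraint explains the index identity. Linearised, it reads
  \<open>GG *v c = V T *v (Fm *v k)\<close>, where k varies the rest point and c collects the speed
  and the remaining initial data; the mass then varies by \<open>GI *v c - VI *v (Fm *v k)\<close>.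
  So the mass derivative is a Schur complement built from the four blocks whose determinant is
  H'(0), up to right multiplication by diag(1, -F) with F = df(u_-). The further factor det F in the
  index completes a square, and the remaining (-1)^n is the sign of D(0,l) at infinity. Two
  obstacles shape the rest. The profile equation determines u' only where B(u) is invertible, which
  is assumed on the orbit alone, and profiles and charts are fixed by choice operators. Hence the
  flow in the variables (u, u_-, s) is truncated to a tube and differentiated at the base orbit
  only, and the periodic family is continued by Brouwer's theorem. Moreover the symmetric part of B
  may be indefinite; the spectral condition supplies a matrix S with S B + B^T S = 1 instead, and
  the terms caused by its dependence on x are absorbed by large l.\<close>

lemma gronwall_norm_square:
  fixes w :: "real \<Rightarrow> 'a::real_inner"
  assumes ab: "a \<le> b" and K: "0 \<le> K" and c: "0 \<le> c"
    and der: "\<And>x. x \<in> {a..b} \<Longrightarrow> (w has_vector_derivative w' x) (at x within {a..b})"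
    and bd: "\<And>x. x \<in> {a..b} \<Longrightarrow> norm (w' x) \<le> K * norm (w x) + c"
  shows "(norm (w b))\<^sup>2 \<le> exp ((2*K+1)*(b-a)) * ((norm (w a))\<^sup>2 + c\<^sup>2 * (b-a))"
proof -
  \<comment> \<open>By Young's inequality the derivative of the squared norm is at most 2K+1 times
    the squared norm plus c^2. The weight and the subtracted linear term turn this into
    \<open>g' x \<le> 0\<close>. The square is used because the norm is not differentiable at
    0.\<close>
  define g where "g x = exp (-(2*K+1)*(x-a)) * (w x \<bullet> w x) - c\<^sup>2 * (x-a)" for x
  define g' where "g' x = exp (-(2*K+1)*(x-a)) * (2 * (w x \<bullet> w' x) - (2*K+1) * (w x \<bullet> w x)) - c\<^sup>2" for x
  have g: "(g has_real_derivative g' x) (at x within {a..b})" if "x \<in> {a..b}" for x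
  proof -
    have "((\<lambda>x. w x \<bullet> w x) has_real_derivative 2 * (w x \<bullet> w' x)) (at x within {a..b})"
      using has_derivative_inner[OF der[OF that, unfolded has_vector_derivative_def] der[OF that, unfolded has_vector_derivative_def]]
      unfolding has_field_derivative_def
      by (rule has_derivative_eq_rhs) (auto simp: fun_eq_iff inner_commute algebra_simps)
    then show ?thesis
      unfolding g_def g'_def
      by (auto intro!: derivative_eq_intros simp: algebra_simps)
  qed
  have g'_le: "g' x \<le> 0" if x: "x \<in> {a..b}" for x
  proof -
    have "w x \<bullet> w' x \<le> norm (w x) * (K * norm (w x) + c)"
      using norm_cauchy_schwarz[of "w x" "w' x"] mult_left_mono[OF bd[OF x], of "norm (w x)"] by simp
    moreover have "2 * (norm (w x) * c) \<le> (norm (w x))\<^sup>2 + c\<^sup>2"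
      using sum_squares_ge_zero[of "norm (w x) - c" 0] by (simp add: power2_eq_square algebra_simps)
    ultimately have "2 * (w x \<bullet> w' x) - (2*K+1) * (w x \<bullet> w x) \<le> c\<^sup>2"
      by (simp add: dot_square_norm power2_eq_square algebra_simps)
    then have "exp (-(2*K+1)*(x-a)) * (2 * (w x \<bullet> w' x) - (2*K+1) * (w x \<bullet> w x)) \<le> exp (-(2*K+1)*(x-a)) * c\<^sup>2"
      by simp
    also have "\<dots> \<le> 1 * c\<^sup>2"
      using x K by (intro mult_right_mono) (auto simp: mult_nonpos_nonneg)
    finally show ?thesis by (simp add: g'_def)
  qed
  have "g b \<le> g a"
  proof -
    have "\<exists>x\<in>{a..b}. g b - g a = (\<lambda>h. g' x * h) (b - a)"
      using mvt_very_simple[OF ab, of g "\<lambda>x h. g' x * h"] g ab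
      by (auto simp: has_field_derivative_def)
    then obtain x where "x \<in> {a..b}" "g b - g a = g' x * (b - a)" by auto
    moreover have "g' x * (b-a) \<le> 0"
      using g'_le[OF \<open>x \<in> {a..b}\<close>] ab by (simp add: mult_nonpos_nonneg)
    ultimately show ?thesis by simp
  qed
  then have "exp (-(2*K+1)*(b-a)) * (norm (w b))\<^sup>2 \<le> (norm (w a))\<^sup>2 + c\<^sup>2 * (b-a)"
    by (simp add: g_def dot_square_norm)
  then have "exp ((2*K+1)*(b-a)) * (exp (-(2*K+1)*(b-a)) * (norm (w b))\<^sup>2)
      \<le> exp ((2*K+1)*(b-a)) * ((norm (w a))\<^sup>2 + c\<^sup>2 * (b-a))"
    by simp
  moreover have "exp ((2*K+1)*(b-a)) * exp (-(2*K+1)*(b-a)) = 1"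
    by (simp only: exp_add[symmetric] mult_minus_left add.right_inverse exp_zero)
  ultimately show ?thesis
    by (simp only: mult.assoc[symmetric] mult_1_left)
qed

text \<open>One constant for the exponential growth and for the length of the interval. Being at
  least 1 it is bounded by its own square, so it survives the passage from squared norms to
  norms.\<close>

definition gronwall_const :: "real \<Rightarrow> real \<Rightarrow> real" where
  "gronwall_const K l = exp ((2*K+1)*l) * (1 + l)"

lemma gronwall_const_ge_1: "0 \<le> K \<Longrightarrow> 0 \<le> l \<Longrightarrow> 1 \<le> gronwall_const K l"
  unfolding gronwall_const_def
  by (rule order_trans[OF _ mult_mono[of 1 _ 1]]) auto

lemma gronwall:
  fixes w :: "real \<Rightarrow> 'a::real_inner"
  assumes K: "0 \<le> K" and c: "0 \<le> c"
    and der: "\<And>x. x \<in> {a..b} \<Longrightarrow> (w has_vector_derivative w' x) (at x within {a..b})"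
    and bd: "\<And>x. x \<in> {a..b} \<Longrightarrow> norm (w' x) \<le> K * norm (w x) + c"
    and x: "x \<in> {a..b}"
  shows "norm (w x) \<le> gronwall_const K (b-a) * (norm (w a) + c)"
proof -
  let ?C = "gronwall_const K (b-a)"
  have ab: "a \<le> b" using x by auto
  have "(norm (w x))\<^sup>2 \<le> exp ((2*K+1)*(x-a)) * ((norm (w a))\<^sup>2 + c\<^sup>2 * (x-a))"
  proof (rule gronwall_norm_square[where w'=w'])
    fix y assume "y \<in> {a..x}"
    then have "y \<in> {a..b}" using x by auto
    then show "(w has_vector_derivative w' y) (at y within {a..x})"
      using has_vector_derivative_within_subset[OF der[of y], of "{a..x}"] x by auto
    show "norm (w' y) \<le> K * norm (w y) + c" using bd \<open>y \<in> {a..b}\<close> by auto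
  qed (use x K c in auto)
  also have "\<dots> \<le> exp ((2*K+1)*(b-a)) * ((norm (w a))\<^sup>2 + c\<^sup>2 * (b-a))"
    using x K c by (intro mult_mono) (auto intro!: mult_left_mono)
  also have "\<dots> \<le> exp ((2*K+1)*(b-a)) * ((1 + (b-a)) * (norm (w a) + c)\<^sup>2)"
  proof -
    have "(norm (w a))\<^sup>2 + c\<^sup>2 * (b-a) \<le> (1 + (b-a)) * ((norm (w a))\<^sup>2 + c\<^sup>2)"
    proof -
      have "(1 + (b-a)) * ((norm (w a))\<^sup>2 + c\<^sup>2)
          = (norm (w a))\<^sup>2 + c\<^sup>2 * (b-a) + ((b-a) * (norm (w a))\<^sup>2 + c\<^sup>2)"
        by (simp add: algebra_simps)
      moreover have "0 \<le> (b-a) * (norm (w a))\<^sup>2 + c\<^sup>2" using ab by simp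
      ultimately show ?thesis by linarith
    qed
    also have "\<dots> \<le> (1 + (b-a)) * (norm (w a) + c)\<^sup>2"
      using ab c by (intro mult_left_mono) (auto simp: power2_eq_square algebra_simps)
    finally show ?thesis by simp
  qed
  also have "\<dots> = ?C * (norm (w a) + c)\<^sup>2" by (simp add: gronwall_const_def)
  also have "\<dots> \<le> (?C * (norm (w a) + c))\<^sup>2"
  proof -
    have "?C \<le> ?C\<^sup>2" using gronwall_const_ge_1[OF K, of "b-a"] ab
      by (simp add: power2_eq_square)
    then show ?thesis by (simp add: power_mult_distrib mult_right_mono)
  qed
  finally show ?thesis
    using gronwall_const_ge_1[OF K, of "b-a"] ab c by (simp add: power2_le_iff_abs_le abs_mult)
qed

lemma continuous_primitive_exists:
  fixes g :: "real \<Rightarrow> 'a::banach"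
  assumes g: "continuous_on UNIV g"
  shows "\<exists>G. G 0 = 0 \<and> (\<forall>x. (G has_vector_derivative g x) (at x))"
proof -
  \<comment> \<open>An integral over \<open>{a..b}\<close> with b < a is 0, so at most one of the
    two terms is nonzero and their difference is the oriented integral from 0 to x.\<close>
  define G where "G x = integral {0..x} g - integral {x..0} g" for x
  have "(G has_vector_derivative g x) (at x)" for x
  proof -
  define R where "R = \<bar>x\<bar> + 1"
  have int: "g integrable_on {a..b}" for a b
    using g by (auto intro!: integrable_continuous_real intro: continuous_on_subset)
  have eq: "G y = integral {-R..y} g - integral {-R..0} g" if "y \<in> {-R<..<R}" for y
  proof (cases "0 \<le> y")
    case True
    then show ?thesis
      using Henstock_Kurzweil_Integration.integral_combine[of "-R" 0 y g] int that
      by (cases "y = 0") (auto simp: G_def R_def algebra_simps)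
  next
    case False
    then show ?thesis
      using Henstock_Kurzweil_Integration.integral_combine[of "-R" y 0 g] int that
      by (auto simp: G_def R_def algebra_simps)
  qed
  have x: "x \<in> {-R<..<R}" by (auto simp: R_def)
  have "((\<lambda>y. integral {-R..y} g) has_vector_derivative g x) (at x within {-R..R})"
    using g x by (intro integral_has_vector_derivative) (auto intro: continuous_on_subset)
  then have "((\<lambda>y. integral {-R..y} g - integral {-R..0} g) has_vector_derivative g x) (at x)"
    using x at_within_interior[of x "{-R..R}"]
    by (auto intro!: derivative_eq_intros)
  then show "(G has_vector_derivative g x) (at x)"
    by (rule has_vector_derivative_transform_within_open[where S="{-R<..<R}"]) (use x eq in auto)
  qed
  moreover have "G 0 = 0" by (simp add: G_def)
  ultimately show ?thesis by blast
qed

lemma has_vector_derivative_reflect: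
  fixes G :: "real \<Rightarrow> 'a::real_normed_vector"
  assumes "(G has_vector_derivative g') (at (- t))"
  shows "((\<lambda>t. G (- t)) has_vector_derivative - g') (at t)"
proof -
  have "(uminus has_vector_derivative -1) (at t)" for t :: real
    by (auto intro!: derivative_eq_intros)
  from vector_diff_chain_at[OF this assms] show ?thesis by (simp add: o_def)
qed

text \<open>Integrating the weight exp(L |x|) gains a factor 1/L, and this gain makes Picard's
  operator contract once L is large compared with the Lipschitz constant. Negative x follow by
  reflection.\<close>

lemma primitive_exp_bound:
  fixes G :: "real \<Rightarrow> 'a::banach"
  assumes G0: "G 0 = 0" and der: "\<And>x. (G has_vector_derivative g x) (at x)"
    and L: "L > 0" and bd: "\<And>t. norm (g t) \<le> M * exp (L * \<bar>t\<bar>)"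
  shows "norm (G x) \<le> M / L * exp (L * \<bar>x\<bar>)"
proof -
  have M: "0 \<le> M" using bd[of 0] norm_ge_zero[of "g 0"] by (simp del: norm_ge_zero)
  have pos: "norm (H x) \<le> M / L * exp (L * x)"
    if H0: "H 0 = 0" and dH: "\<And>x. (H has_vector_derivative h x) (at x)"
      and bdh: "\<And>t. t \<ge> 0 \<Longrightarrow> norm (h t) \<le> M * exp (L * t)" and x: "x \<ge> 0"
    for H h :: "real \<Rightarrow> 'a" and x
  proof (cases "x = 0")
    case True then show ?thesis using M L H0 by simp
  next
    case False
    have "norm (H x - H 0) \<le> M / L * exp (L * x) - M / L * exp (L * 0)"
    proof (rule differentiable_bound_general[where f'=h and \<phi>'="\<lambda>t. M * exp (L * t)"])
      show "continuous_on {0..x} H"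
        using dH by (meson continuous_at_imp_continuous_on has_vector_derivative_continuous)
      show "continuous_on {0..x} (\<lambda>t. M / L * exp (L * t))" by (intro continuous_intros)
      show "((\<lambda>t. M / L * exp (L * t)) has_vector_derivative M * exp (L * t)) (at t)" for t
        using L by (auto intro!: derivative_eq_intros simp: has_real_derivative_iff_has_vector_derivative[symmetric])
    qed (use False x dH bdh in auto)
    moreover have "0 \<le> M / L" using M L by simp
    ultimately show ?thesis using H0 by simp
  qed
  show ?thesis
  proof (cases "x \<ge> 0")
    case True
    then show ?thesis using pos[OF G0 der _ True] bd by (metis abs_of_nonneg)
  next
    case False
    have d: "((\<lambda>t. G (- t)) has_vector_derivative - g (- t)) (at t)" for t
      by (rule has_vector_derivative_reflect[OF der])
    have "norm (G (- (-x))) \<le> M / L * exp (L * (-x))"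
      by (rule pos[where h="\<lambda>t. - g (-t)"])
        (use G0 d bd[of "- t" for t] False in auto, metis abs_minus_cancel abs_of_nonneg norm_minus_cancel)
    then show ?thesis using False by simp
  qed
qed

text \<open>Picard's operator, conjugated by the weight \<open>exp (L * \<bar>x\<bar>)\<close>, is a contraction of the space
  of bounded continuous functions on the whole line.\<close>

theorem global_ode_exists:
  fixes F :: "real \<Rightarrow> 'a::banach \<Rightarrow> 'a"
  assumes cont: "continuous_on UNIV (\<lambda>p. F (fst p) (snd p))"
    and lip: "\<And>x v w. norm (F x v - F x w) \<le> K * norm (v - w)"
    and bdd: "\<And>x. norm (F x 0) \<le> C"
  shows "\<exists>u. u 0 = u0 \<and> (\<forall>x. (u has_vector_derivative F x (u x)) (at x))"
proof -
  \<comment> \<open>Twice a Lipschitz constant: the gain 1/L then leaves the contraction factor 1/2.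
    The added 1 keeps L positive.\<close>
  define L where "L = 2 * (\<bar>K\<bar> + 1)"
  have L: "L > 0" by (simp add: L_def add_nonneg_pos)
  have lip': "norm (F x v - F x w) \<le> L / 2 * norm (v - w)" for x v w
    by (rule order_trans[OF lip mult_right_mono]) (auto simp: L_def)
  have C: "0 \<le> C" using bdd[of 0] norm_ge_zero order_trans by blast
  define g where "g v t = F t (exp (L * \<bar>t\<bar>) *\<^sub>R apply_bcontfun v t)" for v t
  have g_cont: "continuous_on UNIV (g v)" for v
  proof -
    have "continuous_on UNIV ((\<lambda>p. F (fst p) (snd p)) \<circ> (\<lambda>t. (t, exp (L * \<bar>t\<bar>) *\<^sub>R apply_bcontfun v t)))"
      using continuous_on_apply_bcontfun[of UNIV v]
      by (intro continuous_on_compose continuous_intros continuous_on_subset[OF cont])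
         (auto intro: continuous_on_subset)
    then show ?thesis by (simp add: o_def g_def)
  qed
  define G where "G v = (SOME G. G 0 = 0 \<and> (\<forall>x. (G has_vector_derivative g v x) (at x)))" for v
  have G: "G v 0 = 0" "(G v has_vector_derivative g v x) (at x)" for v x
    using someI_ex[OF continuous_primitive_exists[OF g_cont[of v]]] by (auto simp: G_def)
  have g_bd: "norm (g v t) \<le> (C + L / 2 * norm v) * exp (L * \<bar>t\<bar>)" for v t
  proof -
    have "norm (g v t) \<le> norm (F t 0) + norm (g v t - F t 0)"
      by (metis add.commute diff_add_cancel norm_triangle_ineq)
    also have "\<dots> \<le> C + L / 2 * norm (exp (L * \<bar>t\<bar>) *\<^sub>R apply_bcontfun v t)"
      using bdd[of t] lip'[of t "exp (L * \<bar>t\<bar>) *\<^sub>R apply_bcontfun v t" 0] by (simp add: g_def)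
    also have "\<dots> \<le> C * exp (L * \<bar>t\<bar>) + L / 2 * (exp (L * \<bar>t\<bar>) * norm v)"
      using C L norm_bounded[of v t]
      by (intro add_mono mult_left_mono) (auto simp: mult_le_cancel_left1)
    finally show ?thesis by (simp add: algebra_simps)
  qed
  have G_bd: "norm (G v x) \<le> (C + L / 2 * norm v) / L * exp (L * \<bar>x\<bar>)" for v x
    by (rule primitive_exp_bound[OF G L g_bd])
  have G_cont: "continuous_on UNIV (G v)" for v
    using G(2) by (meson continuous_at_imp_continuous_on has_vector_derivative_continuous)
  define p where "p v x = exp (- L * \<bar>x\<bar>) *\<^sub>R (u0 + G v x)" for v x
  have p_bc: "p v \<in> bcontfun" for v
  proof (rule bcontfun_normI)
    show "continuous_on UNIV (p v)"
      unfolding p_def by (intro continuous_intros G_cont)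
    show "norm (p v x) \<le> norm u0 + (C + L / 2 * norm v) / L" for x
    proof -
      have "norm (p v x) = exp (- L * \<bar>x\<bar>) * norm (u0 + G v x)" by (simp add: p_def)
      also have "\<dots> \<le> exp (- L * \<bar>x\<bar>) * (norm u0 + (C + L / 2 * norm v) / L * exp (L * \<bar>x\<bar>))"
        by (intro mult_left_mono order_trans[OF norm_triangle_ineq] add_mono G_bd) auto
      also have "\<dots> = exp (- L * \<bar>x\<bar>) * norm u0 + (C + L / 2 * norm v) / L"
        by (simp add: algebra_simps exp_minus)
      also have "\<dots> \<le> norm u0 + (C + L / 2 * norm v) / L"
        using L mult_right_mono[of "exp (- L * \<bar>x\<bar>)" 1 "norm u0"] by simp
      finally show ?thesis .
    qed
  qed
  define P where "P v = Bcontfun (p v)" for v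
  have P: "apply_bcontfun (P v) x = p v x" for v x
    by (simp add: P_def Bcontfun_inverse[OF p_bc])
  have contr: "dist (P v) (P w) \<le> 1 / 2 * dist v w" for v w
  proof (rule dist_bound)
    fix x
    have "norm (G v x - G w x) \<le> (L / 2 * dist v w) / L * exp (L * \<bar>x\<bar>)"
    proof (rule primitive_exp_bound[where g="\<lambda>t. g v t - g w t"])
      show "norm (g v t - g w t) \<le> L / 2 * dist v w * exp (L * \<bar>t\<bar>)" for t
      proof -
        have "norm (g v t - g w t) \<le> L / 2 * norm (exp (L * \<bar>t\<bar>) *\<^sub>R (apply_bcontfun v t - apply_bcontfun w t))"
          using lip'[of t "exp (L * \<bar>t\<bar>) *\<^sub>R apply_bcontfun v t" "exp (L * \<bar>t\<bar>) *\<^sub>R apply_bcontfun w t"]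
          by (simp add: g_def scaleR_diff_right)
        also have "\<dots> \<le> L / 2 * (exp (L * \<bar>t\<bar>) * dist v w)"
          using L dist_bounded[of v t w] by (intro mult_left_mono) (auto simp: dist_norm)
        finally show ?thesis by (simp add: algebra_simps)
      qed
    qed (use G L in \<open>auto intro!: derivative_intros\<close>)
    then have "exp (- L * \<bar>x\<bar>) * norm (G v x - G w x) \<le> exp (- L * \<bar>x\<bar>) * ((L / 2 * dist v w) / L * exp (L * \<bar>x\<bar>))"
      by (intro mult_left_mono) auto
    also have "\<dots> = 1 / 2 * dist v w" using L by (simp add: exp_minus)
    also have "exp (- L * \<bar>x\<bar>) * norm (G v x - G w x) = dist (p v x) (p w x)"
      by (simp add: p_def dist_norm flip: scaleR_diff_right)
    finally show "dist (apply_bcontfun (P v) x) (apply_bcontfun (P w) x) \<le> 1 / 2 * dist v w"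
      by (simp add: P)
  qed
  then obtain v where v: "P v = v"
    using banach_fix_type[of "1/2" P] by auto
  have "exp (L * \<bar>t\<bar>) *\<^sub>R apply_bcontfun v t = u0 + G v t" for t
    using P[of v t, unfolded v] by (simp add: p_def exp_minus)
  then have "g v t = F t (u0 + G v t)" for t by (simp add: g_def)
  then have "((\<lambda>x. u0 + G v x) has_vector_derivative F x (u0 + G v x)) (at x)" for x
    using G(2)[of v x] by (auto intro!: derivative_eq_intros)
  then show ?thesis using G(1)[of v] by (intro exI[of _ "\<lambda>x. u0 + G v x"]) auto
qed

lemma ode_zero_uniqueness:
  fixes w :: "real \<Rightarrow> 'a::real_inner"
  assumes w0: "w 0 = 0" and der: "\<And>x. (w has_vector_derivative w' x) (at x)"
    and bd: "\<And>x. norm (w' x) \<le> K * norm (w x)"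
  shows "w x = 0"
proof -
  have pos: "v x = 0" if v0: "v 0 = 0" and dv: "\<And>x. (v has_vector_derivative v' x) (at x)"
    and bv: "\<And>x. norm (v' x) \<le> K * norm (v x)" and x: "x \<ge> 0" for v v' :: "real \<Rightarrow> 'a" and x
  proof -
    have "norm (v x) \<le> gronwall_const \<bar>K\<bar> (x - 0) * (norm (v 0) + 0)"
    proof (rule gronwall[where w'=v'])
      show "norm (v' y) \<le> \<bar>K\<bar> * norm (v y) + 0" for y
        using order_trans[OF bv[of y] mult_right_mono[of K "\<bar>K\<bar>" "norm (v y)"]] by auto
      show "(v has_vector_derivative v' y) (at y within {0..x})" for y
        using dv has_vector_derivative_at_within by blast
    qed (use x in auto)
    then show ?thesis using v0 by simp
  qed
  have d: "((\<lambda>t. w (- t)) has_vector_derivative - w' (- t)) (at t)" for t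
    by (rule has_vector_derivative_reflect[OF der])
  show ?thesis
  proof (cases "x \<ge> 0")
    case True then show ?thesis using pos[OF w0 der bd] by blast
  next
    case False
    then have "w (- (-x)) = 0"
      using pos[of "\<lambda>t. w (- t)" "\<lambda>t. - w' (- t)" "-x"] w0 d bd by auto
    then show ?thesis by simp
  qed
qed

section \<open>The flow near a given orbit of a C1 field\<close>

text \<open>The field is known to be C1 only on \<Omega>, which need not be the whole space. A tube
  of radius r about the compact orbit lies inside it, and all estimates are made there.\<close>

locale c1_orbit =
  fixes X :: "'a::euclidean_space \<Rightarrow> 'a" and X' :: "'a \<Rightarrow> 'a \<Rightarrow>\<^sub>L 'a"
    and \<Omega> :: "'a set" and T :: real and ub :: "real \<Rightarrow> 'a" and r :: real
  assumes X_deriv: "u \<in> \<Omega> \<Longrightarrow> (X has_derivative blinfun_apply (X' u)) (at u)"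
    and X'_cont: "continuous_on \<Omega> X'"
    and T_pos: "0 < T"
    and orbit: "x \<in> {0..T} \<Longrightarrow> (ub has_vector_derivative X (ub x)) (at x within {0..T})"
    and r_pos: "0 < r"
    and tube_sub: "x \<in> {0..T} \<Longrightarrow> cball (ub x) r \<subseteq> \<Omega>"
begin

text \<open>Freezes time outside \<open>{0..T}\<close>, so that the existence theorem on the whole
  line applies.\<close>

definition clip :: "real \<Rightarrow> real" where "clip x = max 0 (min T x)"

lemma clip_in: "clip x \<in> {0..T}" and clip_id: "x \<in> {0..T} \<Longrightarrow> clip x = x"
  using T_pos by (auto simp: clip_def)

lemma clip_cont: "continuous_on S clip"
  unfolding clip_def by (intro continuous_intros)

lemma ub_cont: "continuous_on {0..T} ub"
  using orbit has_vector_derivative_continuous continuous_on_eq_continuous_within by blast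

lemma ub_clip_cont: "continuous_on S (\<lambda>x. ub (clip x))"
  using continuous_on_compose2[OF ub_cont clip_cont, of S] clip_in by (metis image_subsetI)

definition tube :: "'a set" where "tube = {x + y |x y. x \<in> ub ` {0..T} \<and> y \<in> cball 0 r}"

lemma compact_tube: "compact tube"
  unfolding tube_def by (rule compact_sums[OF compact_continuous_image[OF ub_cont] compact_cball]) simp

lemma cball_sub_tube: "x \<in> {0..T} \<Longrightarrow> cball (ub x) r \<subseteq> tube"
proof
  fix z assume "x \<in> {0..T}" "z \<in> cball (ub x) r"
  then have "z = ub x + (z - ub x)" "z - ub x \<in> cball 0 r"
    by (auto simp: dist_norm norm_minus_commute)
  then show "z \<in> tube" unfolding tube_def using \<open>x \<in> {0..T}\<close> by blast
qed

lemma tube_dom: "tube \<subseteq> \<Omega>"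
proof
  fix z assume "z \<in> tube"
  then obtain x y where "x \<in> {0..T}" "y \<in> cball 0 r" "z = ub x + y" by (auto simp: tube_def)
  then have "z \<in> cball (ub x) r" by (auto simp: dist_norm)
  then show "z \<in> \<Omega>" using tube_sub \<open>x \<in> {0..T}\<close> by blast
qed

lemma X_cont_tube: "continuous_on tube X"
  using X_deriv tube_dom
  by (meson continuous_at_imp_continuous_on has_derivative_continuous subsetD)

lemma lip_exists: "\<exists>K. 0 \<le> K \<and> (\<forall>z\<in>tube. norm (X' z) \<le> K)"
proof -
  have "compact (X' ` tube)"
    using compact_tube continuous_on_subset[OF X'_cont tube_dom] by (intro compact_continuous_image)
  then obtain K where "\<forall>z\<in>X' ` tube. norm z \<le> K"
    using compact_imp_bounded bounded_iff by metis
  then show ?thesis by (intro exI[of _ "\<bar>K\<bar>"]) force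
qed

definition lip :: real where "lip = (SOME K. 0 \<le> K \<and> (\<forall>z\<in>tube. norm (X' z) \<le> K))"

lemma lip_nonneg: "0 \<le> lip" and lip_bound: "z \<in> tube \<Longrightarrow> norm (X' z) \<le> lip"
  using someI_ex[OF lip_exists] by (auto simp: lip_def)

text \<open>The point v is replaced by the nearest point of the ball about the current orbit point.
  Projection onto a convex set is 1-Lipschitz, and the mean value theorem is applied inside that
  ball rather than in the tube, which need not be convex; so the truncated field is globally
  Lipschitz with constant \<open>lip\<close>.\<close>

definition trunc :: "real \<Rightarrow> 'a \<Rightarrow> 'a" where
  "trunc x v = X (ub (clip x) + closest_point (cball 0 r) (v - ub (clip x)))"

lemma trunc_eq: "x \<in> {0..T} \<Longrightarrow> dist v (ub x) \<le> r \<Longrightarrow> trunc x v = X v"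
  using closest_point_self[of "v - ub x" "cball 0 r"]
  by (simp add: trunc_def clip_id dist_norm norm_minus_commute del: atLeastAtMost_iff)

lemma proj_in: "ub (clip x) + closest_point (cball 0 r) v \<in> cball (ub (clip x)) r"
  using closest_point_in_set[of "cball 0 r" v] r_pos by (auto simp: dist_norm)

lemma proj_in_tube: "ub (clip x) + closest_point (cball 0 r) v \<in> tube"
  using proj_in cball_sub_tube[OF clip_in] by blast

lemma trunc_lip: "norm (trunc x v - trunc x w) \<le> lip * norm (v - w)"
proof -
  let ?p = "\<lambda>v. ub (clip x) + closest_point (cball 0 r) (v - ub (clip x))"
  have "norm (X (?p v) - X (?p w)) \<le> lip * norm (?p v - ?p w)"
  proof (rule differentiable_bound[where S="cball (ub (clip x)) r"])
    fix z assume "z \<in> cball (ub (clip x)) r"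
    then have z: "z \<in> tube" using cball_sub_tube[OF clip_in] by blast
    show "(X has_derivative blinfun_apply (X' z)) (at z within cball (ub (clip x)) r)"
      using X_deriv z tube_dom has_derivative_at_withinI by blast
    show "onorm (blinfun_apply (X' z)) \<le> lip"
      using lip_bound[OF z] by (simp add: norm_blinfun.rep_eq)
  qed (use proj_in in auto)
  also have "\<dots> \<le> lip * norm (v - w)"
    using closest_point_lipschitz[of "cball 0 r" "v - ub (clip x)" "w - ub (clip x)"] r_pos lip_nonneg
    by (intro mult_left_mono) (auto simp: dist_norm)
  finally show ?thesis by (simp add: trunc_def)
qed

lemma trunc_cont: "continuous_on UNIV (\<lambda>p. trunc (fst p) (snd p))"
proof -
  have "continuous_on UNIV (\<lambda>p::real \<times> 'a. closest_point (cball 0 r) (snd p - ub (clip (fst p))))"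
    using r_pos
    by (intro continuous_on_compose2[OF continuous_on_closest_point[of "cball 0 r" UNIV]] continuous_intros
        continuous_on_compose2[OF ub_clip_cont[of UNIV]]) auto
  then show ?thesis
    unfolding trunc_def
    by (intro continuous_on_compose2[OF X_cont_tube] continuous_intros
        continuous_on_compose2[OF ub_clip_cont[of UNIV]]) (use proj_in_tube in auto)
qed

lemma trunc_bounded: "\<exists>C. \<forall>x. norm (trunc x 0) \<le> C"
proof -
  have "compact (X ` tube)" using compact_tube X_cont_tube by (intro compact_continuous_image)
  then obtain K where "\<forall>z\<in>X ` tube. norm z \<le> K"
    using compact_imp_bounded bounded_iff by metis
  then show ?thesis unfolding trunc_def using proj_in_tube by blast
qed

definition flow :: "'a \<Rightarrow> real \<Rightarrow> 'a" where
  "flow a = (SOME u. u 0 = a \<and> (\<forall>x. (u has_vector_derivative trunc x (u x)) (at x)))"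

lemma flow_0: "flow a 0 = a"
  and flow_deriv: "(flow a has_vector_derivative trunc x (flow a x)) (at x within S)"
proof -
  obtain C where C: "\<And>x. norm (trunc x 0) \<le> C" using trunc_bounded by blast
  have "flow a 0 = a \<and> (\<forall>x. (flow a has_vector_derivative trunc x (flow a x)) (at x))"
    unfolding flow_def by (rule someI_ex[OF global_ode_exists[OF trunc_cont trunc_lip C]])
  then show "flow a 0 = a" "(flow a has_vector_derivative trunc x (flow a x)) (at x within S)"
    using has_vector_derivative_at_within by blast+
qed

definition gw :: real where "gw = gronwall_const lip T"

lemma gw_ge_1: "1 \<le> gw"
  unfolding gw_def using gronwall_const_ge_1 lip_nonneg T_pos by simp

lemma flow_lip:
  assumes "x \<in> {0..T}"
  shows "norm (flow a x - flow b x) \<le> gw * norm (a - b)"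
proof -
  have "norm (flow a x - flow b x) \<le> gronwall_const lip (T - 0) * (norm (flow a 0 - flow b 0) + 0)"
    by (rule gronwall[where w'="\<lambda>x. trunc x (flow a x) - trunc x (flow b x)"])
      (use lip_nonneg trunc_lip assms in \<open>auto intro!: derivative_intros flow_deriv\<close>)
  then show ?thesis by (simp add: gw_def flow_0)
qed

text \<open>The end point S is free because the lemma is applied up to a possible exit time from the
  tube.\<close>

lemma trunc_solution_unique:
  assumes u0: "u 0 = a" and S: "S \<le> T"
    and der: "\<And>x. x \<in> {0..S} \<Longrightarrow> (u has_vector_derivative trunc x (u x)) (at x within {0..S})"
    and x: "x \<in> {0..S}"
  shows "u x = flow a x"
proof -
  have "norm (u x - flow a x) \<le> gronwall_const lip (S - 0) * (norm (u 0 - flow a 0) + 0)"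
    by (rule gronwall[where w'="\<lambda>x. trunc x (u x) - trunc x (flow a x)"])
      (use lip_nonneg trunc_lip x der in \<open>auto intro!: derivative_intros flow_deriv\<close>)
  then show ?thesis by (simp add: u0 flow_0)
qed

lemma flow_base: "x \<in> {0..T} \<Longrightarrow> flow (ub 0) x = ub x"
  using trunc_solution_unique[of ub "ub 0" T x] orbit trunc_eq r_pos by simp

text \<open>Distances grow by at most the factor \<open>gw\<close> over a period, so trajectories
  that start within r / \<open>gw\<close> of the orbit stay in the tube, where truncation changes
  nothing.\<close>

definition rad :: real where "rad = r / gw"

lemma rad_pos: "0 < rad" and rad_le: "rad \<le> r"
  using gw_ge_1 r_pos by (auto simp: rad_def divide_le_eq mult_le_cancel_left1)

lemma flow_near:
  assumes "dist a (ub 0) < rad" "x \<in> {0..T}"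
  shows "dist (flow a x) (ub x) < r"
proof -
  have "dist (flow a x) (ub x) \<le> gw * dist a (ub 0)"
    using flow_lip[OF assms(2), of a "ub 0"] flow_base[OF assms(2)] by (simp add: dist_norm)
  also have "\<dots> < gw * rad" using assms gw_ge_1 by (intro mult_strict_left_mono) auto
  also have "\<dots> = r" using gw_ge_1 by (simp add: rad_def)
  finally show ?thesis .
qed

lemma flow_in_dom: "dist a (ub 0) < rad \<Longrightarrow> x \<in> {0..T} \<Longrightarrow> flow a x \<in> \<Omega>"
  using flow_near[of a x] tube_sub[of x] by (auto simp: dist_commute subset_iff)

lemma flow_solves:
  assumes "dist a (ub 0) < rad" "x \<in> {0..T}"
  shows "(flow a has_vector_derivative X (flow a x)) (at x within S)"
  using flow_deriv[of a x S] trunc_eq[of x "flow a x"] flow_near[OF assms] assms by simp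

text \<open>A solution may only be assumed to obey the equation where the field is defined; it cannot
  leave the tube because it coincides with the flow up to the first exit time.\<close>

lemma solution_unique:
  assumes a: "dist a (ub 0) < rad" and u0: "u 0 = a"
    and der: "\<And>x. x \<in> {0..T} \<Longrightarrow> \<exists>d. (u has_vector_derivative d) (at x within {0..T}) \<and> (u x \<in> \<Omega> \<longrightarrow> d = X (u x))"
    and x: "x \<in> {0..T}"
  shows "u x = flow a x"
proof -
  have u_cont: "continuous_on {0..T} u"
    using der has_vector_derivative_continuous continuous_on_eq_continuous_within by blast
  define h where "h x = dist (u x) (ub x)" for x
  have h_cont: "continuous_on {0..T} h"
    unfolding h_def by (intro continuous_intros u_cont ub_cont)
  have h0: "h 0 < r" using a u0 rad_le by (simp add: h_def)
  have agree: "u y = flow a y" if S: "S \<in> {0..T}" and le: "\<And>y. y \<in> {0..S} \<Longrightarrow> h y \<le> r" and y: "y \<in> {0..S}" for S y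
  proof (rule trunc_solution_unique[where u=u and S=S])
    fix z assume z: "z \<in> {0..S}"
    then have zT: "z \<in> {0..T}" using S by auto
    have "u z \<in> \<Omega>" using le[OF z] tube_sub[OF zT] by (auto simp: h_def dist_commute)
    then have "(u has_vector_derivative X (u z)) (at z within {0..T})" using der[OF zT] by auto
    then have "(u has_vector_derivative X (u z)) (at z within {0..S})"
      by (rule has_vector_derivative_within_subset) (use S in auto)
    then show "(u has_vector_derivative trunc z (u z)) (at z within {0..S})"
      using trunc_eq[OF zT, of "u z"] le[OF z] by (simp add: h_def)
  qed (use S u0 y in auto)
  have "h y < r" if "y \<in> {0..T}" for y
  proof (rule ccontr)
    assume "\<not> h y < r"
    define Z where "Z = {z \<in> {0..T}. h z = r}"
    have ivt: "\<exists>z\<in>Z. z \<le> y" if "y \<in> {0..T}" "r \<le> h y" for y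
    proof -
      have "\<exists>z\<ge>0. z \<le> y \<and> h z = r"
        by (rule IVT') (use h0 that continuous_on_subset[OF h_cont] in auto)
      then show ?thesis using that by (auto simp: Z_def)
    qed
    then have ne: "Z \<noteq> {}" using \<open>\<not> h y < r\<close> \<open>y \<in> {0..T}\<close> by force
    have Z_eq: "Z = {0..T} \<inter> h -` {r}" by (auto simp: Z_def)
    have "closed Z" unfolding Z_eq
      by (rule continuous_closed_preimage[OF h_cont]) auto
    moreover have "bdd_below Z" unfolding Z_def by (rule bdd_belowI[of _ 0]) auto
    ultimately have m: "Inf Z \<in> Z" using closed_contains_Inf ne by blast
    have le: "h z \<le> r" if "z \<in> {0..Inf Z}" for z
    proof (rule ccontr)
      assume "\<not> h z \<le> r"
      moreover have "z \<in> {0..T}" using that m by (auto simp: Z_def)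
      ultimately obtain z' where "z' \<in> Z" "z' \<le> z" using ivt[of z] by force
      moreover have "Inf Z \<le> z'" using \<open>z' \<in> Z\<close> \<open>bdd_below Z\<close> by (rule cInf_lower)
      ultimately have "z = Inf Z" using that by auto
      then show False using m \<open>\<not> h z \<le> r\<close> by (auto simp: Z_def)
    qed
    have mT: "Inf Z \<in> {0..T}" "h (Inf Z) = r" using m by (auto simp: Z_def)
    have "u (Inf Z) = flow a (Inf Z)"
      by (rule agree[OF mT(1) le]) (use mT in auto)
    then have "h (Inf Z) < r" using flow_near[OF a mT(1)] by (simp add: h_def)
    then show False using mT by simp
  qed
  then show ?thesis using agree[of T x] x T_pos by (auto simp: less_imp_le)
qed

text \<open>The solution with initial value h of the variational equation along the base orbit. It
  is the derivative of the flow at \<open>ub 0\<close> in direction h.\<close>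

definition linflow :: "'a \<Rightarrow> real \<Rightarrow> 'a" where
  "linflow h = (SOME y. y 0 = h \<and> (\<forall>x. (y has_vector_derivative X' (ub (clip x)) (y x)) (at x)))"

lemma X'_bound: "norm (X' (ub (clip x)) v) \<le> lip * norm v"
proof -
  have "ub (clip x) \<in> tube" using cball_sub_tube[OF clip_in, of x] r_pos by (auto simp: subset_iff)
  then show ?thesis
    using norm_blinfun[of "X' (ub (clip x))" v] lip_bound mult_right_mono[of _ lip "norm v"]
    by (meson norm_ge_zero order_trans)
qed

lemma centre_in_dom: "ub (clip x) \<in> \<Omega>"
  using tube_sub[OF clip_in, of x] r_pos by (auto simp: subset_iff)

lemma linflow_0: "linflow h 0 = h"
  and linflow_deriv: "(linflow h has_vector_derivative X' (ub (clip x)) (linflow h x)) (at x within S)"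
proof -
  have c: "continuous_on UNIV (\<lambda>p. X' (ub (clip (fst p))) (snd p))"
    by (intro continuous_intros continuous_on_compose2[OF X'_cont] continuous_on_compose2[OF ub_clip_cont[of UNIV]])
      (use centre_in_dom in auto)
  have "linflow h 0 = h \<and> (\<forall>x. (linflow h has_vector_derivative X' (ub (clip x)) (linflow h x)) (at x))"
    unfolding linflow_def
    by (rule someI_ex[OF global_ode_exists[OF c, where K=lip and C=0]])
      (use X'_bound in \<open>auto simp flip: blinfun.diff_right\<close>)
  then show "linflow h 0 = h" "(linflow h has_vector_derivative X' (ub (clip x)) (linflow h x)) (at x within S)"
    using has_vector_derivative_at_within by blast+
qed

lemma linflow_unique:
  assumes "y 0 = h" and der: "\<And>x. x \<in> {0..T} \<Longrightarrow> (y has_vector_derivative X' (ub x) (y x)) (at x within {0..T})"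
    and x: "x \<in> {0..T}"
  shows "y x = linflow h x"
proof -
  have "norm (y x - linflow h x) \<le> gronwall_const lip (T - 0) * (norm (y 0 - linflow h 0) + 0)"
  proof (rule gronwall[where w'="\<lambda>x. X' (ub (clip x)) (y x - linflow h x)"])
    fix z assume z: "z \<in> {0..T}"
    show "((\<lambda>x. y x - linflow h x) has_vector_derivative X' (ub (clip z)) (y z - linflow h z)) (at z within {0..T})"
      using has_vector_derivative_diff[OF der[OF z] linflow_deriv[of h z]] clip_id[OF z]
      by (simp add: blinfun.diff_right)
  qed (use lip_nonneg X'_bound x in auto)
  then show ?thesis by (simp add: assms linflow_0)
qed

lemma linear_linflow:
  assumes x: "x \<in> {0..T}"
  shows "linear (\<lambda>h. linflow h x)"
proof (rule linearI)
  show "linflow (h + k) x = linflow h x + linflow k x" for h k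
    by (rule linflow_unique[symmetric, OF _ _ x])
      (auto simp: linflow_0 blinfun.add_right clip_id intro!: derivative_eq_intros
        has_vector_derivative_eq_rhs[OF linflow_deriv])
  show "linflow (c *\<^sub>R h) x = c *\<^sub>R linflow h x" for c h
    by (rule linflow_unique[symmetric, OF _ _ x])
      (auto simp: linflow_0 blinfun.scaleR_right clip_id
        intro!: has_vector_derivative_eq_rhs[OF bounded_linear.has_vector_derivative[OF bounded_linear_scaleR_right linflow_deriv]])
qed

text \<open>X' is uniformly continuous on the compact tube; this makes the remainder in the
  definition of the derivative uniform along the orbit.\<close>

lemma uniform_linearization:
  assumes \<eta>: "\<eta> > 0"
  shows "\<exists>\<delta>>0. \<delta> \<le> r \<and> (\<forall>x\<in>{0..T}. \<forall>v. dist v (ub x) < \<delta> \<longrightarrow>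
      norm (X v - X (ub x) - X' (ub x) (v - ub x)) \<le> \<eta> * norm (v - ub x))"
proof -
  have "uniformly_continuous_on tube X'"
    using compact_uniformly_continuous[OF continuous_on_subset[OF X'_cont tube_dom] compact_tube] .
  then obtain d where d: "d > 0" "\<And>z z'. z \<in> tube \<Longrightarrow> z' \<in> tube \<Longrightarrow> dist z' z < d \<Longrightarrow> dist (X' z') (X' z) < \<eta>"
    using \<eta> unfolding uniformly_continuous_on_def by meson
  define \<delta> where "\<delta> = min d r"
  show ?thesis
  proof (intro exI[of _ \<delta>] conjI ballI allI impI)
    fix x v assume x: "x \<in> {0..T}" and v: "dist v (ub x) < \<delta>"
    have sub: "ball (ub x) \<delta> \<subseteq> tube" "ub x \<in> tube" using d r_pos cball_sub_tube[OF x] by (auto simp: \<delta>_def subset_iff)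
    have "norm (X v - X (ub x) - X' (ub x) (v - ub x)) \<le> norm (v - ub x) * \<eta>"
    proof (rule differentiable_bound_linearization[where S="ball (ub x) \<delta>" and f'="\<lambda>z. X' z"])
      show "ub x + t *\<^sub>R (v - ub x) \<in> ball (ub x) \<delta>" if "t \<in> {0..1}" for t
      proof -
        have "norm (t *\<^sub>R (v - ub x)) \<le> norm (v - ub x)"
          using that by (auto simp: mult_left_le_one_le)
        then show ?thesis using v by (simp add: dist_norm)
      qed
      show "(X has_derivative blinfun_apply (X' z)) (at z within ball (ub x) \<delta>)" if "z \<in> ball (ub x) \<delta>" for z
        using that sub tube_dom X_deriv has_derivative_at_withinI by blast
      show "onorm (blinfun_apply (X' z) - blinfun_apply (X' (ub x))) \<le> \<eta>" if "z \<in> ball (ub x) \<delta>" for z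
      proof -
        have "dist (X' z) (X' (ub x)) < \<eta>"
          by (rule d(2)) (use that sub \<delta>_def in \<open>auto simp: dist_commute\<close>)
        then show ?thesis by (simp add: dist_norm norm_blinfun.rep_eq minus_blinfun.rep_eq fun_diff_def)
      qed
      show "ub x \<in> ball (ub x) \<delta>" using d r_pos by (simp add: \<delta>_def)
    qed
    then show "norm (X v - X (ub x) - X' (ub x) (v - ub x)) \<le> \<eta> * norm (v - ub x)" by (simp add: mult.commute)
  qed (use d r_pos in \<open>auto simp: \<delta>_def\<close>)
qed

text \<open>The error of the linear approximation solves a linear inequality whose source is the
  linearization remainder of X, and Gronwall's estimate bounds it. Uniformity in x is what later
  allows integration over the period.\<close>

lemma flow_uniform_derivative:
  assumes e: "e > 0"
  shows "\<exists>d>0. \<forall>a. norm (a - ub 0) < d \<longrightarrow>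
    (\<forall>x\<in>{0..T}. norm (flow a x - ub x - linflow (a - ub 0) x) \<le> e * norm (a - ub 0))"
proof -
  \<comment> \<open>One factor \<open>gw\<close> comes from the growth of the difference of two
    trajectories, the other from Gronwall's estimate for the error itself.\<close>
  define \<eta> where "\<eta> = e / gw\<^sup>2"
  have \<eta>: "\<eta> > 0" using e gw_ge_1 by (simp add: \<eta>_def)
  obtain \<delta> where \<delta>: "\<delta> > 0" "\<delta> \<le> r" "\<And>x v. x \<in> {0..T} \<Longrightarrow> dist v (ub x) < \<delta> \<Longrightarrow>
      norm (X v - X (ub x) - X' (ub x) (v - ub x)) \<le> \<eta> * norm (v - ub x)"
    using uniform_linearization[OF \<eta>] by blast
  show ?thesis
  proof (intro exI[of _ "\<delta> / gw"] conjI allI impI ballI)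
    show "0 < \<delta> / gw" using \<delta> gw_ge_1 by simp
    fix a x assume a: "norm (a - ub 0) < \<delta> / gw" and x: "x \<in> {0..T}"
    have gwa: "gw * norm (a - ub 0) < \<delta>" using a gw_ge_1 by (simp add: less_divide_eq mult.commute)
    have near: "norm (flow a y - ub y) \<le> gw * norm (a - ub 0)" if "y \<in> {0..T}" for y
      using flow_lip[OF that, of a "ub 0"] flow_base[OF that] by simp
    have solve: "trunc y (flow a y) = X (flow a y)" if "y \<in> {0..T}" for y
      using trunc_eq[OF that, of "flow a y"] near[OF that] gwa \<delta> by (simp add: dist_norm)
    let ?e = "\<lambda>y. flow a y - ub y - linflow (a - ub 0) y"
    have "norm (?e x) \<le> gronwall_const lip (T - 0) * (norm (?e 0) + \<eta> * (gw * norm (a - ub 0)))"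
    proof (rule gronwall[where w'="\<lambda>y. X (flow a y) - X (ub y) - X' (ub y) (linflow (a - ub 0) y)"])
      fix y assume y: "y \<in> {0..T}"
      show "(?e has_vector_derivative X (flow a y) - X (ub y) - X' (ub y) (linflow (a - ub 0) y)) (at y within {0..T})"
        using has_vector_derivative_diff[OF has_vector_derivative_diff[OF flow_deriv[of a y] orbit[OF y]] linflow_deriv[of "a - ub 0" y]]
          solve[OF y] clip_id[OF y] by simp
      have "X (flow a y) - X (ub y) - X' (ub y) (linflow (a - ub 0) y)
        = (X (flow a y) - X (ub y) - X' (ub y) (flow a y - ub y)) + X' (ub (clip y)) (?e y)"
        by (simp add: blinfun.diff_right clip_id[OF y])
      also have "norm \<dots> \<le> \<eta> * norm (flow a y - ub y) + lip * norm (?e y)"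
        using \<delta>(3)[OF y, of "flow a y"] near[OF y] gwa X'_bound[of y "?e y"]
        by (intro norm_triangle_le add_mono) (auto simp: dist_norm)
      also have "\<dots> \<le> \<eta> * (gw * norm (a - ub 0)) + lip * norm (?e y)"
        using near[OF y] \<eta> by simp
      finally show "norm (X (flow a y) - X (ub y) - X' (ub y) (linflow (a - ub 0) y))
        \<le> lip * norm (?e y) + \<eta> * (gw * norm (a - ub 0))" by simp
    qed (use lip_nonneg \<eta> gw_ge_1 x in auto)
    also have "\<dots> = e * norm (a - ub 0)"
      using gw_ge_1 by (simp add: flow_0 linflow_0 \<eta>_def power2_eq_square flip: gw_def)
    finally show "norm (?e x) \<le> e * norm (a - ub 0)" .
  qed
qed

lemma flow_has_derivative:
  assumes x: "x \<in> {0..T}"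
  shows "((\<lambda>a. flow a x) has_derivative (\<lambda>h. linflow h x)) (at (ub 0))"
  unfolding has_derivative_at_alt
proof (intro conjI allI impI)
  show "bounded_linear (\<lambda>h. linflow h x)"
    using linear_linflow[OF x] linear_conv_bounded_linear by blast
  fix e :: real assume "0 < e"
  then obtain d where "d > 0" "\<And>a. norm (a - ub 0) < d \<Longrightarrow>
      norm (flow a x - ub x - linflow (a - ub 0) x) \<le> e * norm (a - ub 0)"
    using flow_uniform_derivative[of e] x by metis
  then show "\<exists>d>0. \<forall>y. norm (y - ub 0) < d \<longrightarrow> norm (flow y x - flow (ub 0) x - linflow (y - ub 0) x) \<le> e * norm (y - ub 0)"
    unfolding flow_base[OF x] by (intro exI[of _ d]) auto
qed

lemma flow_integrable: "flow a integrable_on {0..T}" and linflow_integrable: "linflow a integrable_on {0..T}"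
proof -
  have "continuous_on {0..T} (flow a)"
    by (rule continuous_on_vector_derivative[OF flow_deriv])
  moreover have "continuous_on {0..T} (linflow a)"
    by (rule continuous_on_vector_derivative[OF linflow_deriv])
  ultimately
  show "flow a integrable_on {0..T}" "linflow a integrable_on {0..T}" by (auto intro: integrable_continuous_real)
qed

text \<open>The pointwise estimate with e/T in place of e is uniform in x, so its integral over a
  period of length T yields the estimate with e.\<close>

lemma integral_flow_has_derivative:
  "((\<lambda>a. integral {0..T} (flow a)) has_derivative (\<lambda>h. integral {0..T} (linflow h))) (at (ub 0))"
  unfolding has_derivative_at_alt
proof (intro conjI allI impI)
  have "linear (\<lambda>h. integral {0..T} (linflow h))"
  proof (rule linearI)
    fix h k
    have "integral {0..T} (linflow (h + k)) = integral {0..T} (\<lambda>x. linflow h x + linflow k x)"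
      by (rule integral_cong) (rule linear_add[OF linear_linflow])
    then show "integral {0..T} (linflow (h + k)) = integral {0..T} (linflow h) + integral {0..T} (linflow k)"
      using Henstock_Kurzweil_Integration.integral_add[OF linflow_integrable linflow_integrable, of h k] by simp
  next
    fix c h
    have "integral {0..T} (linflow (c *\<^sub>R h)) = integral {0..T} (\<lambda>x. c *\<^sub>R linflow h x)"
      by (rule integral_cong) (rule linear_scale[OF linear_linflow])
    then show "integral {0..T} (linflow (c *\<^sub>R h)) = c *\<^sub>R integral {0..T} (linflow h)"
      by simp
  qed
  then show "bounded_linear (\<lambda>h. integral {0..T} (linflow h))"
    using linear_conv_bounded_linear by blast
  fix e :: real assume e: "0 < e"
  then have "0 < e / T" using T_pos by simp
  from flow_uniform_derivative[OF this] obtain d where d: "d > 0"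
    "\<And>a x. norm (a - ub 0) < d \<Longrightarrow> x \<in> {0..T} \<Longrightarrow> norm (flow a x - ub x - linflow (a - ub 0) x) \<le> e / T * norm (a - ub 0)"
    by blast
  show "\<exists>d>0. \<forall>y. norm (y - ub 0) < d \<longrightarrow> norm (integral {0..T} (flow y) - integral {0..T} (flow (ub 0)) - integral {0..T} (linflow (y - ub 0))) \<le> e * norm (y - ub 0)"
  proof (intro exI[of _ d] conjI allI impI)
    fix a assume a: "norm (a - ub 0) < d"
    have "norm (integral {0..T} (\<lambda>x. flow a x - flow (ub 0) x - linflow (a - ub 0) x)) \<le> integral {0..T} (\<lambda>x. e / T * norm (a - ub 0))"
      by (rule integral_norm_bound_integral)
        (use d(2)[OF a] flow_base in \<open>auto intro!: integrable_diff flow_integrable linflow_integrable\<close>)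
    then show "norm (integral {0..T} (flow a) - integral {0..T} (flow (ub 0)) - integral {0..T} (linflow (a - ub 0))) \<le> e * norm (a - ub 0)"
      using T_pos by (simp add: Henstock_Kurzweil_Integration.integral_diff flow_integrable linflow_integrable integrable_diff)
  qed (use d in auto)
qed

end

section \<open>Linear systems and their parameter dependence\<close>

no_notation fps_nth (infixl "$" 75)

lemma bounded_bilinear_matrix_matrix_mult:
  "bounded_bilinear ((**) :: 'a::{real_normed_field,euclidean_space}^'n::finite^'m::finite \<Rightarrow> 'a^'p::finite^'n \<Rightarrow> 'a^'p^'m)"
  unfolding bilinear_conv_bounded_bilinear[symmetric] bilinear_def
  by (auto intro!: linearI simp: matrix_matrix_mult_def vec_eq_iff sum.distrib algebra_simps scaleR_sum_right)

lemma bounded_bilinear_matrix_vector_mult':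
  "bounded_bilinear ((*v) :: 'a::{real_normed_field,euclidean_space}^'n::finite^'m::finite \<Rightarrow> 'a^'n \<Rightarrow> 'a^'m)"
  unfolding bilinear_conv_bounded_bilinear[symmetric] bilinear_def
  by (auto intro!: linearI simp: matrix_vector_mult_def vec_eq_iff sum.distrib algebra_simps scaleR_sum_right)

lemmas has_vector_derivative_matrix_mult =
  bounded_bilinear.has_vector_derivative[OF bounded_bilinear_matrix_matrix_mult]
lemmas has_vector_derivative_matrix_vector_mult =
  bounded_bilinear.has_vector_derivative[OF bounded_bilinear_matrix_vector_mult']
lemmas continuous_on_matrix_mult =
  bounded_bilinear.continuous_on[OF bounded_bilinear_matrix_matrix_mult]
lemmas continuous_on_matrix_vector_mult =
  bounded_bilinear.continuous_on[OF bounded_bilinear_matrix_vector_mult']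

lemma mat_mult_nth: "(mat l ** M) $ i $ j = l * M $ i $ j"
  for M :: "'a::comm_ring_1^'n^'m::finite"
  by (simp add: matrix_matrix_mult_def mat_def if_distrib[of "\<lambda>x. x * y" for y] cong: if_cong)

lemma norm_mat_mult: "norm (mat l ** M) = norm l * norm M"
  for M :: "'a::{real_normed_field,euclidean_space}^'n::finite^'m::finite"
proof -
  have "norm ((mat l ** M) $ i) = norm l * norm (M $ i)" for i
    by (simp add: norm_vec_def mat_mult_nth norm_mult L2_set_right_distrib)
  then show ?thesis
    by (simp add: norm_vec_def[of "mat l ** M"] norm_vec_def[of M] L2_set_right_distrib)
qed

text \<open>What global existence and uniqueness require of the coefficient of a linear system.
  Continuous periodic coefficients qualify.\<close>

definition regular_coef :: "(real \<Rightarrow> 'a::real_normed_vector) \<Rightarrow> bool" where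
  "regular_coef A \<longleftrightarrow> continuous_on UNIV A \<and> bounded (range A)"

lemma regular_coef_periodic:
  fixes A :: "real \<Rightarrow> 'a::real_normed_vector"
  assumes "continuous_on UNIV A" "T > 0" and per: "\<And>x. A (x + T) = A x"
  shows "regular_coef A"
proof -
  have nat: "A (x + real n * T) = A x" for x n
    by (induction n) (auto simp: algebra_simps per[symmetric, of "x + _"] per simp flip: add.assoc)
  have int: "A (x + of_int k * T) = A x" for x k
  proof (cases "k \<ge> 0")
    case True
    then show ?thesis using nat[of x "nat k"] by simp
  next
    case False
    then show ?thesis using nat[of "x + of_int k * T" "nat (- k)"] by simp
  qed
  have "range A \<subseteq> A ` {0..T}"
  proof clarify
    fix x
    define k where "k = \<lfloor>x / T\<rfloor>"
    have "x - of_int k * T \<in> {0..T}"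
    proof -
      have "of_int k \<le> x / T" "x / T \<le> of_int k + 1" unfolding k_def by linarith+
      then show ?thesis using \<open>T > 0\<close> by (auto simp: field_simps)
    qed
    moreover have "A x = A (x - of_int k * T)" using int[of "x - of_int k * T" k] by simp
    ultimately show "A x \<in> A ` {0..T}" by blast
  qed
  moreover have "bounded (A ` {0..T})"
    using assms(1) by (intro compact_imp_bounded compact_continuous_image continuous_on_subset[OF assms(1)]) auto
  ultimately show ?thesis using assms(1) bounded_subset unfolding regular_coef_def by blast
qed

lemma regular_coef_bilinear:
  assumes "bounded_bilinear h" "regular_coef A" "regular_coef B"
  shows "regular_coef (\<lambda>x. h (A x) (B x))"
proof -
  obtain K where K: "\<And>a b. norm (h a b) \<le> norm a * norm b * K" "0 \<le> K"
    using bounded_bilinear.nonneg_bounded[OF assms(1)] by blast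
  obtain a b where ab: "\<And>x. norm (A x) \<le> a" "\<And>x. norm (B x) \<le> b"
    using assms unfolding regular_coef_def bounded_iff by auto
  have "norm (h (A x) (B x)) \<le> a * b * K" for x
  proof -
    have "0 \<le> a" using ab(1)[of x] norm_ge_zero order_trans by blast
    then show ?thesis
      by (intro order_trans[OF K(1)] mult_right_mono mult_mono ab K) auto
  qed
  then show ?thesis
    using assms bounded_bilinear.continuous_on[OF assms(1)] unfolding regular_coef_def bounded_iff by blast
qed

lemma regular_coef_add:
  assumes "regular_coef A" "regular_coef B"
  shows "regular_coef (\<lambda>x. A x + B x)"
  using assms continuous_on_add[of UNIV A B] bounded_plus_comp[of A UNIV B]
  unfolding regular_coef_def by auto

lemma regular_coef_const: "regular_coef (\<lambda>x. c)"
  unfolding regular_coef_def by auto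

text \<open>The description used in \<open>fundamental_solution\<close>, but over the reals as well:
  for real l the determinant is then a real function of l, to which the intermediate value theorem
  applies.\<close>

definition fund_sol :: "(real \<Rightarrow> 'a::{real_normed_field,euclidean_space}^'m^'m) \<Rightarrow> real \<Rightarrow> 'a^'m^'m::finite" where
  "fund_sol A = (THE \<Psi>. \<Psi> 0 = mat 1 \<and> (\<forall>x. (\<Psi> has_vector_derivative A x ** \<Psi> x) (at x)))"

lemma regular_coef_norm_le:
  assumes "regular_coef A" obtains C where "0 \<le> C" "\<And>x. norm (A x) \<le> C"
proof -
  obtain C where "\<And>x. norm (A x) \<le> C"
    using assms unfolding regular_coef_def bounded_iff by auto
  then show ?thesis using that[of "\<bar>C\<bar>"] by (meson abs_ge_self abs_ge_zero order_trans)
qed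

lemma regular_mult_bound:
  fixes A :: "real \<Rightarrow> 'a::{real_normed_field,euclidean_space}^'n::finite^'m::finite"
  assumes "regular_coef A"
  obtains K where "0 \<le> K" "\<And>x (Y::'a^'p::finite^'n). norm (A x ** Y) \<le> K * norm Y"
proof -
  obtain C where C: "0 \<le> C" "\<And>x. norm (A x) \<le> C" using regular_coef_norm_le[OF assms] by blast
  obtain K where K: "\<And>(a::'a^'n^'m) (b::'a^'p^'n). norm (a ** b) \<le> norm a * norm b * K" "0 \<le> K"
    using bounded_bilinear.nonneg_bounded[OF bounded_bilinear_matrix_matrix_mult] by blast
  have "norm (A x ** Y) \<le> (C * K) * norm Y" for x and Y :: "'a^'p^'n"
  proof -
    have "norm (A x ** Y) \<le> C * norm Y * K"
      by (intro order_trans[OF K(1)] mult_right_mono C K) auto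
    then show ?thesis by (simp add: algebra_simps)
  qed
  then show ?thesis using that[of "C * K"] C K by auto
qed

lemma regular_vec_bound:
  fixes A :: "real \<Rightarrow> 'a::{real_normed_field,euclidean_space}^'n::finite^'m::finite"
  assumes "regular_coef A"
  obtains K where "0 \<le> K" "\<And>x Y. norm (A x *v Y) \<le> K * norm Y"
proof -
  obtain C where C: "0 \<le> C" "\<And>x. norm (A x) \<le> C" using regular_coef_norm_le[OF assms] by blast
  obtain K where K: "\<And>(a::'a^'n^'m) (b::'a^'n). norm (a *v b) \<le> norm a * norm b * K" "0 \<le> K"
    using bounded_bilinear.nonneg_bounded[OF bounded_bilinear_matrix_vector_mult'] by blast
  have "norm (A x *v Y) \<le> (C * K) * norm Y" for x and Y :: "'a^'n"
  proof -
    have "norm (A x *v Y) \<le> C * norm Y * K"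
      by (intro order_trans[OF K(1)] mult_right_mono C K) auto
    then show ?thesis by (simp add: algebra_simps)
  qed
  then show ?thesis using that[of "C * K"] C K by auto
qed

lemma matrix_sub_ldistrib': "A ** (B - C) = A ** B - A ** C"
  for A :: "'a::{real_normed_field,euclidean_space}^'n::finite^'m::finite" and B C :: "'a^'p::finite^'n"
  by (rule bounded_bilinear.diff_right[OF bounded_bilinear_matrix_matrix_mult])

lemma matrix_sub_rdistrib': "(B - C) ** A = B ** A - C ** A"
  for B C :: "'a::{real_normed_field,euclidean_space}^'n::finite^'m::finite" and A :: "'a^'p::finite^'n"
  by (rule bounded_bilinear.diff_left[OF bounded_bilinear_matrix_matrix_mult])

lemma matrix_ode_unique:
  fixes A :: "real \<Rightarrow> 'a::{real_normed_field,euclidean_space}^'m::finite^'m" and Y Z :: "real \<Rightarrow> 'a^'p::finite^'m"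
  assumes A: "regular_coef A" and "Y 0 = Z 0"
    and Y: "\<And>x. (Y has_vector_derivative A x ** Y x) (at x)"
    and Z: "\<And>x. (Z has_vector_derivative A x ** Z x) (at x)"
  shows "Y x = Z x"
proof -
  obtain K where K: "\<And>x (Y::'a^'p^'m). norm (A x ** Y) \<le> K * norm Y"
    using regular_mult_bound[OF A] by metis
  have "(\<lambda>x. Y x - Z x) x = 0"
    by (rule ode_zero_uniqueness[where w'="\<lambda>x. A x ** (Y x - Z x)" and K=K])
      (use assms(2) K has_vector_derivative_diff[OF Y Z] in \<open>auto simp: matrix_sub_ldistrib'\<close>,
       simp add: K flip: matrix_sub_ldistrib')
  then show ?thesis by simp
qed

lemma vector_ode_unique:
  fixes A :: "real \<Rightarrow> 'a::{real_normed_field,euclidean_space}^'m::finite^'m" and y z :: "real \<Rightarrow> 'a^'m"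
  assumes A: "regular_coef A" and "y 0 = z 0"
    and y: "\<And>x. (y has_vector_derivative A x *v y x) (at x)"
    and z: "\<And>x. (z has_vector_derivative A x *v z x) (at x)"
  shows "y x = z x"
proof -
  obtain K where K: "\<And>x Y. norm (A x *v Y) \<le> K * norm Y"
    using regular_vec_bound[OF A] by metis
  have "(\<lambda>x. y x - z x) x = 0"
    by (rule ode_zero_uniqueness[where w'="\<lambda>x. A x *v (y x - z x)" and K=K])
      (use assms(2) K has_vector_derivative_diff[OF y z] in
        \<open>auto simp: bounded_bilinear.diff_right[OF bounded_bilinear_matrix_vector_mult']\<close>,
       simp add: K flip: bounded_bilinear.diff_right[OF bounded_bilinear_matrix_vector_mult'])
  then show ?thesis by simp
qed

lemma fund_sol_ex1:
  fixes A :: "real \<Rightarrow> 'a::{real_normed_field,euclidean_space}^'m::finite^'m"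
  assumes A: "regular_coef A"
  shows "\<exists>!\<Psi>. \<Psi> 0 = mat 1 \<and> (\<forall>x. (\<Psi> has_vector_derivative A x ** \<Psi> x) (at x))"
proof (rule ex_ex1I)
  obtain K where K: "0 \<le> K" "\<And>x (Y::'a^'m^'m). norm (A x ** Y) \<le> K * norm Y"
    using regular_mult_bound[OF A] by metis
  have "continuous_on UNIV A" using A by (simp add: regular_coef_def)
  then have "continuous_on UNIV (\<lambda>p::real \<times> ('a^'m^'m). A (fst p) ** snd p)"
    by (intro continuous_on_matrix_mult continuous_intros continuous_on_compose2[of UNIV A _ fst]) auto
  then show "\<exists>\<Psi>. \<Psi> 0 = mat 1 \<and> (\<forall>x. (\<Psi> has_vector_derivative A x ** \<Psi> x) (at x))"
    by (rule global_ode_exists[where K=K and C=0])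
      (use K in \<open>auto simp flip: matrix_sub_ldistrib'\<close>)
  show "\<Psi> = \<Theta>" if "\<Psi> 0 = mat 1 \<and> (\<forall>x. (\<Psi> has_vector_derivative A x ** \<Psi> x) (at x))"
      "\<Theta> 0 = mat 1 \<and> (\<forall>x. (\<Theta> has_vector_derivative A x ** \<Theta> x) (at x))" for \<Psi> \<Theta>
  proof
    show "\<Psi> x = \<Theta> x" for x
      by (rule matrix_ode_unique[OF A, of \<Psi> \<Theta>]) (use that in simp_all)
  qed
qed

context
  fixes A :: "real \<Rightarrow> 'a::{real_normed_field,euclidean_space}^'m::finite^'m"
  assumes A: "regular_coef A"
begin

lemma fund_sol_0: "fund_sol A 0 = mat 1"
  and fund_sol_deriv: "(fund_sol A has_vector_derivative A x ** fund_sol A x) (at x within S)"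
  using theI'[OF fund_sol_ex1[OF A]] has_vector_derivative_at_within unfolding fund_sol_def by blast+

lemma fund_sol_unique:
  assumes "\<Psi> 0 = mat 1" "\<And>x. (\<Psi> has_vector_derivative A x ** \<Psi> x) (at x)"
  shows "\<Psi> = fund_sol A"
proof
  show "\<Psi> x = fund_sol A x" for x
    by (rule matrix_ode_unique[OF A, of \<Psi> "fund_sol A"]) (simp_all add: assms fund_sol_0 fund_sol_deriv)
qed

lemma fund_sol_matrix:
  fixes Y :: "real \<Rightarrow> 'a^'p::finite^'m"
  assumes "\<And>x. (Y has_vector_derivative A x ** Y x) (at x)"
  shows "Y x = fund_sol A x ** Y 0"
  by (rule matrix_ode_unique[OF A _ assms])
    (auto simp: fund_sol_0 matrix_mul_assoc intro!: has_vector_derivative_eq_rhs[OF has_vector_derivative_matrix_mult[OF fund_sol_deriv has_vector_derivative_const]])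

lemma fund_sol_vec_deriv:
  "((\<lambda>x. fund_sol A x *v v) has_vector_derivative A x *v (fund_sol A x *v v)) (at x within S)"
  by (auto simp: matrix_vector_mul_assoc intro!: has_vector_derivative_eq_rhs[OF has_vector_derivative_matrix_vector_mult[OF fund_sol_deriv has_vector_derivative_const]])

lemma fund_sol_vector:
  assumes "\<And>x. (y has_vector_derivative A x *v y x) (at x)"
  shows "y x = fund_sol A x *v y 0"
  by (rule vector_ode_unique[OF A _ assms fund_sol_vec_deriv]) (simp add: fund_sol_0)

lemma fund_sol_cont: "continuous_on S (fund_sol A)"
  by (rule continuous_on_vector_derivative[OF fund_sol_deriv])

end

text \<open>Three applications of Gronwall's estimate: \<Phi>(l+h) is bounded, the difference
  \<Phi>(l+h) - \<Phi>(l) is of order h, and the remainder is of order h^2 because its source is h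
  A1 times that difference. Scalars act through the matrix \<open>mat h\<close>, since
  \<open>scaleR\<close> only covers real factors.\<close>

lemma fund_sol_expansion:
  fixes A0 A1 :: "real \<Rightarrow> 'a::{real_normed_field,euclidean_space}^'m::finite^'m"
  assumes A0: "regular_coef A0" and A1: "regular_coef A1" and T: "T \<ge> 0"
  defines "\<Phi> \<equiv> \<lambda>l. fund_sol (\<lambda>x. A0 x + mat l ** A1 x)"
  shows "\<exists>Z C. Z 0 = 0 \<and> (\<forall>x. (Z has_vector_derivative (A0 x + mat l ** A1 x) ** Z x + A1 x ** \<Phi> l x) (at x))
    \<and> (\<forall>h. norm h \<le> 1 \<longrightarrow> (\<forall>x\<in>{0..T}. norm (\<Phi> (l + h) x - \<Phi> l x - mat h ** Z x) \<le> C * (norm h)\<^sup>2))"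
proof -
  have reg1: "regular_coef (\<lambda>x. mat l ** A1 x)" for l
    by (rule regular_coef_bilinear[OF bounded_bilinear_matrix_matrix_mult regular_coef_const A1])
  have reg: "regular_coef (\<lambda>x. A0 x + mat l ** A1 x)" for l
    by (rule regular_coef_add[OF A0 reg1])
  let ?A = "\<lambda>x. A0 x + mat l ** A1 x"
  obtain K where K: "0 \<le> K" "\<And>x (Y::'a^'m^'m). norm (?A x ** Y) \<le> K * norm Y"
    using regular_mult_bound[OF reg] by metis
  obtain L where L: "0 \<le> L" "\<And>x (Y::'a^'m^'m). norm (A1 x ** Y) \<le> L * norm Y"
    using regular_mult_bound[OF A1] by metis
  obtain Z where Z: "Z 0 = 0" "\<And>x. (Z has_vector_derivative ?A x ** Z x + A1 x ** \<Phi> l x) (at x)"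
  proof -
    \<comment> \<open>Z has the source A1 \<Phi>. Solved jointly, the pair (\<Phi>, Z) obeys a
      homogeneous linear system, which vanishes at the zero vector.\<close>
    let ?F = "\<lambda>x (p :: ('a^'m^'m) \<times> ('a^'m^'m)). (?A x ** fst p, ?A x ** snd p + A1 x ** fst p)"
    have "\<exists>u. u 0 = (mat 1, 0) \<and> (\<forall>x. (u has_vector_derivative ?F x (u x)) (at x))"
    proof (rule global_ode_exists[where K="2 * K + L" and C=0])
      have c: "continuous_on UNIV (\<lambda>p::real \<times> (('a^'m^'m) \<times> ('a^'m^'m)). ?A (fst p))"
        "continuous_on UNIV (\<lambda>p::real \<times> (('a^'m^'m) \<times> ('a^'m^'m)). A1 (fst p))"
        by (rule continuous_on_compose2[of UNIV ?A _ fst], use reg[of l] in \<open>auto simp: regular_coef_def intro: continuous_intros\<close>)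
          (rule continuous_on_compose2[of UNIV A1 _ fst], use A1 in \<open>auto simp: regular_coef_def intro: continuous_intros\<close>)
      show "continuous_on UNIV (\<lambda>p::real \<times> (('a^'m^'m) \<times> ('a^'m^'m)). ?F (fst p) (snd p))"
        by (intro continuous_on_matrix_mult[OF c(1)] continuous_on_matrix_mult[OF c(2)] continuous_intros)
      show "norm (?F x v - ?F x w) \<le> (2 * K + L) * norm (v - w)" for x v w
      proof -
        have "?F x v - ?F x w = (?A x ** fst (v - w), ?A x ** snd (v - w) + A1 x ** fst (v - w))"
          by (simp add: matrix_sub_ldistrib' algebra_simps)
        then have "norm (?F x v - ?F x w) \<le> norm (?A x ** fst (v - w)) + norm (?A x ** snd (v - w) + A1 x ** fst (v - w))"
          by (simp only: norm_Pair_le)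
        also have "\<dots> \<le> K * norm (fst (v - w)) + (K * norm (snd (v - w)) + L * norm (fst (v - w)))"
          by (intro add_mono order_trans[OF norm_triangle_ineq]) (simp_all only: K(2) L(2))
        also have "\<dots> \<le> K * norm (v - w) + (K * norm (v - w) + L * norm (v - w))"
          using K(1) L(1) norm_fst_le[of "fst (v - w)" "snd (v - w)"] norm_snd_le[of "snd (v - w)" "fst (v - w)"]
          by (intro add_mono mult_left_mono) (simp_all only: prod.collapse)
        finally show ?thesis by (simp add: algebra_simps)
      qed
    qed (simp add: zero_prod_def)
    then obtain u where u: "u 0 = (mat 1, 0)" "\<And>x. (u has_vector_derivative ?F x (u x)) (at x)" by blast
    have u1: "((\<lambda>x. fst (u x)) has_vector_derivative ?A x ** fst (u x)) (at x)" for x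
      using bounded_linear.has_vector_derivative[OF bounded_linear_fst u(2)[of x]] by simp
    have u2: "((\<lambda>x. snd (u x)) has_vector_derivative ?A x ** snd (u x) + A1 x ** fst (u x)) (at x)" for x
      using bounded_linear.has_vector_derivative[OF bounded_linear_snd u(2)[of x]] by simp
    have "(\<lambda>x. fst (u x)) = \<Phi> l" unfolding \<Phi>_def
      by (rule fund_sol_unique[OF reg _ u1]) (simp add: u)
    then have "fst (u x) = \<Phi> l x" for x by metis
    with u2 u show ?thesis by (intro that[of "\<lambda>x. snd (u x)"]) auto
  qed
  define G where "G = gronwall_const (K + L) T"
  have G: "0 \<le> G" using gronwall_const_ge_1[of "K + L" T] K L T by (simp add: G_def)
  have split: "(A0 x + mat (l + h) ** A1 x) ** Y = ?A x ** Y + mat h ** (A1 x ** Y)" for h x and Y :: "'a^'m^'m"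
  proof -
    have "mat (l + h) ** A1 x = mat l ** A1 x + mat h ** A1 x"
      by (simp add: vec_eq_iff mat_mult_nth algebra_simps)
    then show ?thesis by (simp add: bounded_bilinear.add_left[OF bounded_bilinear_matrix_matrix_mult] matrix_mul_assoc add.assoc)
  qed
  have D\<Phi>: "(\<Phi> (l + h) has_vector_derivative ?A x ** \<Phi> (l + h) x + mat h ** (A1 x ** \<Phi> (l + h) x)) (at x within S)" for h x S
    using fund_sol_deriv[OF reg[of "l + h"], of x S] unfolding split \<Phi>_def .
  have D\<Phi>0: "(\<Phi> l has_vector_derivative ?A x ** \<Phi> l x) (at x within S)" for x S
    using fund_sol_deriv[OF reg[of l], of x S] unfolding \<Phi>_def .
  define N where "N = norm (mat 1 :: 'a^'m^'m)"
  have N: "0 \<le> N" by (simp add: N_def)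
  have bound: "norm (\<Phi> (l + h) x) \<le> G * N" if h: "norm h \<le> 1" and x: "x \<in> {0..T}" for h x
  proof -
    have "norm (\<Phi> (l + h) x) \<le> gronwall_const (K + L) (T - 0) * (norm (\<Phi> (l + h) 0) + 0)"
    proof (rule gronwall[OF _ _ D\<Phi>])
      fix y
      have "norm (?A y ** \<Phi> (l + h) y + mat h ** (A1 y ** \<Phi> (l + h) y))
          \<le> K * norm (\<Phi> (l + h) y) + norm h * (L * norm (\<Phi> (l + h) y))"
        by (intro norm_triangle_le add_mono K) (auto simp: norm_mat_mult intro!: mult_left_mono L)
      also have "\<dots> \<le> K * norm (\<Phi> (l + h) y) + 1 * (L * norm (\<Phi> (l + h) y))"
        using h L by (intro add_mono mult_right_mono) auto
      finally show "norm (?A y ** \<Phi> (l + h) y + mat h ** (A1 y ** \<Phi> (l + h) y)) \<le> (K + L) * norm (\<Phi> (l + h) y) + 0"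
        by (simp add: algebra_simps)
    qed (use K L x in auto)
    then show ?thesis by (simp add: G_def N_def \<Phi>_def fund_sol_0[OF reg])
  qed
  have first: "norm (\<Phi> (l + h) x - \<Phi> l x) \<le> G * (norm h * (L * (G * N)))" if h: "norm h \<le> 1" and x: "x \<in> {0..T}" for h x
  proof -
    have "norm (\<Phi> (l + h) x - \<Phi> l x) \<le> gronwall_const (K + L) (T - 0) * (norm (\<Phi> (l + h) 0 - \<Phi> l 0) + norm h * (L * (G * N)))"
    proof (rule gronwall[OF _ _ has_vector_derivative_diff[OF D\<Phi> D\<Phi>0]])
      fix y assume y: "y \<in> {0..T}"
      have "norm (?A y ** \<Phi> (l + h) y + mat h ** (A1 y ** \<Phi> (l + h) y) - ?A y ** \<Phi> l y)
        = norm (?A y ** (\<Phi> (l + h) y - \<Phi> l y) + mat h ** (A1 y ** \<Phi> (l + h) y))"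
        by (simp add: matrix_sub_ldistrib' algebra_simps)
      also have "\<dots> \<le> K * norm (\<Phi> (l + h) y - \<Phi> l y) + norm h * (L * (G * N))"
        using L(1) by (intro norm_triangle_le add_mono K)
          (auto simp: norm_mat_mult intro!: mult_left_mono order_trans[OF L(2)] bound[OF h y])
      also have "\<dots> \<le> (K + L) * norm (\<Phi> (l + h) y - \<Phi> l y) + norm h * (L * (G * N))"
        using L(1) G N by (intro add_mono mult_right_mono) auto
      finally show "norm (?A y ** \<Phi> (l + h) y + mat h ** (A1 y ** \<Phi> (l + h) y) - ?A y ** \<Phi> l y)
        \<le> (K + L) * norm (\<Phi> (l + h) y - \<Phi> l y) + norm h * (L * (G * N))" .
    qed (use K L x G N in auto)
    then show ?thesis by (simp add: G_def \<Phi>_def fund_sol_0[OF reg])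
  qed
  have "norm (\<Phi> (l + h) x - \<Phi> l x - mat h ** Z x) \<le> (G * (L * (G * (L * (G * N))))) * (norm h)\<^sup>2"
    if h: "norm h \<le> 1" and x: "x \<in> {0..T}" for h x
  proof -
    let ?e = "\<lambda>x. \<Phi> (l + h) x - \<Phi> l x - mat h ** Z x"
    let ?e' = "\<lambda>y. (?A y ** \<Phi> (l + h) y + mat h ** (A1 y ** \<Phi> (l + h) y)) - ?A y ** \<Phi> l y - mat h ** (?A y ** Z y + A1 y ** \<Phi> l y)"
    let ?c = "norm h * (L * (G * (norm h * (L * (G * N)))))"
    have "norm (?e x) \<le> gronwall_const (K + L) (T - 0) * (norm (?e 0) + ?c)"
    proof (rule gronwall[where w'="?e'"])
      fix y assume y: "y \<in> {0..T}"
      show "(?e has_vector_derivative ?e' y) (at y within {0..T})"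
        using has_vector_derivative_matrix_mult[OF has_vector_derivative_const[of "mat h"] has_vector_derivative_at_within[OF Z(2)]]
        by (intro has_vector_derivative_diff D\<Phi> D\<Phi>0) auto
      have comm: "mat h ** (?A y ** Z y) = ?A y ** (mat h ** Z y)"
        by (simp add: vec_eq_iff mat_mult_nth matrix_matrix_mult_def[of "?A y"] sum_distrib_left mult.left_commute)
      have "?e' y = ?A y ** ?e y + mat h ** (A1 y ** (\<Phi> (l + h) y - \<Phi> l y))"
        by (simp add: matrix_sub_ldistrib' comm matrix_add_ldistrib algebra_simps)
      also have "norm \<dots> \<le> K * norm (?e y) + ?c"
        using L(1) by (intro norm_triangle_le add_mono K)
          (auto simp: norm_mat_mult intro!: mult_left_mono order_trans[OF L(2)] first[OF h y])
      also have "\<dots> \<le> (K + L) * norm (?e y) + ?c"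
        using L(1) G N by (intro add_mono mult_right_mono) auto
      finally show "norm (?e' y) \<le> (K + L) * norm (?e y) + ?c" .
    qed (use K L x G N in auto)
    then show ?thesis by (simp add: G_def \<Phi>_def fund_sol_0[OF reg] Z power2_eq_square algebra_simps)
  qed
  then show ?thesis using Z by blast
qed

lemma has_field_derivative_quadratic_bound:
  fixes f :: "'a::real_normed_field \<Rightarrow> 'a"
  assumes "\<And>h. norm h \<le> 1 \<Longrightarrow> norm (f (l + h) - f l - h * z) \<le> C * (norm h)\<^sup>2"
  shows "(f has_field_derivative z) (at l)"
  unfolding DERIV_def LIM_def
proof (intro allI impI)
  fix e :: real assume e: "0 < e"
  define d where "d = min 1 (e / (\<bar>C\<bar> + 1))"
  have d: "0 < d" using e by (simp add: d_def)
  have "norm ((f (l + h) - f l) / h - z) < e" if h: "h \<noteq> 0" "norm h < d" for h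
  proof -
    have "norm ((f (l + h) - f l) / h - z) = norm (f (l + h) - f l - h * z) / norm h"
      using h by (simp add: norm_divide[symmetric] diff_divide_distrib)
    also have "\<dots> \<le> C * norm h"
      using assms[of h] h by (simp add: d_def divide_le_eq power2_eq_square mult.assoc)
    also have "\<dots> \<le> (\<bar>C\<bar> + 1) * norm h" by (intro mult_right_mono) auto
    also have "\<dots> < (\<bar>C\<bar> + 1) * (e / (\<bar>C\<bar> + 1))" using h by (intro mult_strict_left_mono) (auto simp: d_def)
    finally show ?thesis by (simp add: add_nonneg_eq_0_iff)
  qed
  then show "\<exists>d>0. \<forall>h. h \<noteq> 0 \<and> dist h 0 < d \<longrightarrow> dist ((f (l + h) - f l) / h) z < e"
    using d by (intro exI[of _ d]) (auto simp: dist_norm)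
qed

text \<open>End values and integrals over the period are both needed, because the reduced Evans
  matrix \<open>Hmat\<close> has entries of both kinds. The statement serves the complex spectral
  parameter and the real homotopy parameter alike.\<close>

lemma fund_sol_parameter_derivative:
  fixes A0 A1 :: "real \<Rightarrow> 'a::{real_normed_field,euclidean_space}^'m::finite^'m"
  assumes A0: "regular_coef A0" and A1: "regular_coef A1" and T: "T \<ge> 0"
  defines "\<Phi> \<equiv> \<lambda>l. fund_sol (\<lambda>x. A0 x + mat l ** A1 x)"
  obtains Z where "Z 0 = 0" "\<And>x. (Z has_vector_derivative (A0 x + mat l ** A1 x) ** Z x + A1 x ** \<Phi> l x) (at x)"
    "\<And>i j. ((\<lambda>l. \<Phi> l T $ i $ j) has_field_derivative Z T $ i $ j) (at l)"
    "\<And>i j. ((\<lambda>l. integral {0..T} (\<lambda>x. \<Phi> l x $ i $ j)) has_field_derivative integral {0..T} (\<lambda>x. Z x $ i $ j)) (at l)"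
proof -
  obtain Z C where Z: "Z 0 = 0" "\<And>x. (Z has_vector_derivative (A0 x + mat l ** A1 x) ** Z x + A1 x ** \<Phi> l x) (at x)"
    and C: "\<And>h x. norm h \<le> 1 \<Longrightarrow> x \<in> {0..T} \<Longrightarrow> norm (\<Phi> (l + h) x - \<Phi> l x - mat h ** Z x) \<le> C * (norm h)\<^sup>2"
    using fund_sol_expansion[OF A0 A1 T, of l] unfolding \<Phi>_def by blast
  have entry: "norm (\<Phi> (l + h) x $ i $ j - \<Phi> l x $ i $ j - h * Z x $ i $ j) \<le> C * (norm h)\<^sup>2"
    if "norm h \<le> 1" "x \<in> {0..T}" for h x i j
  proof -
    have "norm ((\<Phi> (l + h) x - \<Phi> l x - mat h ** Z x) $ i $ j) \<le> C * (norm h)\<^sup>2"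
      by (rule order_trans[OF Finite_Cartesian_Product.norm_nth_le order_trans[OF Finite_Cartesian_Product.norm_nth_le C[OF that]]])
    then show ?thesis by (simp add: mat_mult_nth)
  qed
  have reg: "regular_coef (\<lambda>x. A0 x + mat l ** A1 x)" for l
    by (intro regular_coef_add A0 regular_coef_bilinear[OF bounded_bilinear_matrix_matrix_mult regular_coef_const A1])
  have int: "(\<lambda>x. \<Phi> l x $ i $ j) integrable_on {0..T}" for l i j
    unfolding \<Phi>_def by (intro integrable_continuous_real continuous_intros fund_sol_cont[OF reg])
  have intZ: "(\<lambda>x. Z x $ i $ j) integrable_on {0..T}" for i j
    by (intro integrable_continuous_real continuous_intros continuous_on_vector_derivative[OF has_vector_derivative_at_within[OF Z(2)]])
  have "norm (integral {0..T} (\<lambda>x. \<Phi> (l + h) x $ i $ j) - integral {0..T} (\<lambda>x. \<Phi> l x $ i $ j) - h * integral {0..T} (\<lambda>x. Z x $ i $ j))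
      \<le> (C * T) * (norm h)\<^sup>2" if h: "norm h \<le> 1" for h i j
  proof -
    have "norm (integral {0..T} (\<lambda>x. \<Phi> (l + h) x $ i $ j - \<Phi> l x $ i $ j - h * Z x $ i $ j)) \<le> integral {0..T} (\<lambda>x. C * (norm h)\<^sup>2)"
      by (rule integral_norm_bound_integral)
        (use entry[OF h] in \<open>auto intro!: integrable_diff int intZ integrable_on_mult_right\<close>)
    also have "\<dots> = (C * T) * (norm h)\<^sup>2" using T by simp
    finally show ?thesis
      by (simp add: Henstock_Kurzweil_Integration.integral_diff int intZ integrable_diff integrable_on_mult_right)
  qed
  then show ?thesis
    using entry[of _ T] T by (intro that[OF Z] has_field_derivative_quadratic_bound[where C=C] has_field_derivative_quadratic_bound[where C="C*T"]) auto
qed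

lemma det_field_differentiable:
  fixes M :: "'a::real_normed_field \<Rightarrow> 'a^'n^'n::finite"
  assumes "\<And>i j. (\<lambda>l. M l $ i $ j) field_differentiable (at l)"
  shows "(\<lambda>l. det (M l)) field_differentiable (at l)"
proof -
  have prod: "(\<lambda>l. \<Prod>i\<in>S. M l $ i $ p i) field_differentiable (at l)" if "finite S" for S p
    using that by (induction S) (auto intro!: field_differentiable_mult assms)
  show ?thesis unfolding det_def
    by (intro field_differentiable_sum field_differentiable_mult prod) auto
qed

lemma tendsto_det:
  fixes M :: "'b \<Rightarrow> 'a::real_normed_field^'n^'n::finite"
  assumes "\<And>i j. ((\<lambda>l. M l $ i $ j) \<longlongrightarrow> N $ i $ j) F"
  shows "((\<lambda>l. det (M l)) \<longlongrightarrow> det N) F"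
  unfolding det_def by (intro tendsto_intros assms)

section \<open>Block determinants\<close>

lemma block_mat_nth [simp]:
  "block_mat P Q R S $ Inl a $ Inl b = P $ a $ b" "block_mat P Q R S $ Inl a $ Inr c = Q $ a $ c"
  "block_mat P Q R S $ Inr d $ Inl b = R $ d $ b" "block_mat P Q R S $ Inr d $ Inr c = S $ d $ c"
  by (simp_all add: block_mat_def)

lemma sum_UNIV_sum: "(\<Sum>k\<in>(UNIV :: ('n::finite + 'm::finite) set). g k) = (\<Sum>a\<in>UNIV. g (Inl a)) + (\<Sum>b\<in>UNIV. g (Inr b))"
  for g :: "'n::finite + 'm::finite \<Rightarrow> 'a::comm_monoid_add"
  by (simp add: UNIV_Plus_UNIV[symmetric] sum.Plus del: UNIV_Plus_UNIV)

lemma prod_UNIV_sum: "(\<Prod>k\<in>(UNIV :: ('n::finite + 'm::finite) set). g k) = (\<Prod>a\<in>UNIV. g (Inl a)) * (\<Prod>b\<in>UNIV. g (Inr b))"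
  for g :: "'n::finite + 'm::finite \<Rightarrow> 'a::comm_monoid_mult"
  by (simp add: UNIV_Plus_UNIV[symmetric] prod.Plus del: UNIV_Plus_UNIV)

lemma block_mat_eqI:
  fixes M N :: "'a^('n::finite+'n)^('n+'n)"
  assumes "\<And>a b. M $ Inl a $ Inl b = N $ Inl a $ Inl b" "\<And>a b. M $ Inl a $ Inr b = N $ Inl a $ Inr b"
    "\<And>a b. M $ Inr a $ Inl b = N $ Inr a $ Inl b" "\<And>a b. M $ Inr a $ Inr b = N $ Inr a $ Inr b"
  shows "M = N"
  unfolding vec_eq_iff
proof (intro allI)
  fix i j show "M $ i $ j = N $ i $ j"
    using assms by (cases i; cases j) auto
qed

lemma block_mat_mult:
  "block_mat P Q R S ** block_mat P' Q' R' S' =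
    block_mat (P ** P' + Q ** R') (P ** Q' + Q ** S') (R ** P' + S ** R') (R ** Q' + S ** S')"
  for P Q R S P' Q' R' S' :: "'a::semiring_1^'n^'n::finite"
  by (rule block_mat_eqI) (simp_all add: matrix_matrix_mult_def sum_UNIV_sum)

lemma block_mat_1: "block_mat (mat 1) 0 0 (mat 1) = mat 1"
  by (rule block_mat_eqI) (simp_all add: mat_def)

lemma det_mat: "det (mat c :: 'a::comm_ring_1^'n^'n::finite) = c ^ CARD('n)"
  by (simp add: det_diagonal mat_def)

text \<open>A permutation that moves some \<open>Inr\<close> index picks an off-diagonal entry of
  the identity block or an entry of a zero block, so its product vanishes. The surviving ones are
  the images under \<open>Inl\<close> of the permutations of the index type of P, with the same
  signs.\<close>

lemma det_block_Inl:
  fixes P :: "'a::comm_ring_1^'n^'n::finite"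
  shows "det (block_mat P 0 0 (mat 1)) = det P"
proof -
  let ?M = "block_mat P 0 0 (mat 1)"
  let ?L = "range Inl :: ('n + 'n) set"
  let ?m = "map_permutation (UNIV :: 'n set) (Inl :: 'n \<Rightarrow> 'n + 'n)"
  have fixR: "p (Inr b) = Inr b" if "p permutes ?L" for p b
    using that by (auto simp: permutes_def)
  have "det ?M = (\<Sum>p | p permutes ?L. of_int (sign p) * (\<Prod>i\<in>UNIV. ?M $ i $ p i))"
    unfolding det_def
  proof (rule sum.mono_neutral_right)
    show "{p. p permutes ?L} \<subseteq> {p. p permutes UNIV}" using permutes_subset by blast
    show "\<forall>p\<in>{p. p permutes UNIV} - {p. p permutes ?L}. of_int (sign p) * (\<Prod>i\<in>UNIV. ?M $ i $ p i) = 0"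
    proof
      fix p :: "'n + 'n \<Rightarrow> 'n + 'n" assume p: "p \<in> {p. p permutes UNIV} - {p. p permutes ?L}"
      have "\<exists>b. p (Inr b) \<noteq> Inr b"
      proof (rule ccontr)
        assume "\<not> ?thesis"
        then have "p x = x" if "x \<notin> ?L" for x using that by (cases x) auto
        then show False using p permutes_superset[of p UNIV ?L] by auto
      qed
      then obtain b where b: "p (Inr b) \<noteq> Inr b" by blast
      have "?M $ Inr b $ p (Inr b) = 0"
        using b by (cases "p (Inr b)") (auto simp: mat_def)
      then have "(\<Prod>i\<in>UNIV. ?M $ i $ p i) = 0" by (intro prod_zero) auto
      then show "of_int (sign p) * (\<Prod>i\<in>UNIV. ?M $ i $ p i) = 0" by simp
    qed
  qed simp
  also have "\<dots> = (\<Sum>p | p permutes (UNIV :: 'n set). of_int (sign (?m p)) * (\<Prod>i\<in>UNIV. ?M $ i $ ?m p i))"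
  proof (rule sum.reindex_bij_betw[symmetric], rule bij_betw_byWitness[where f'="map_permutation ?L projl"])
    have bL: "bij_betw Inl (UNIV :: 'n set) ?L" by (simp add: bij_betw_def)
    have bR: "bij_betw projl ?L (UNIV :: 'n set)" by (auto simp: bij_betw_def inj_on_def image_image)
    show "?m ` {p. p permutes UNIV} \<subseteq> {p. p permutes ?L}"
      using map_permutation_permutes[OF bL] by auto
    show "map_permutation ?L projl ` {p. p permutes ?L} \<subseteq> {p. p permutes (UNIV :: 'n set)}"
      using map_permutation_permutes[OF bR] by auto
    show "\<forall>p\<in>{p. p permutes UNIV}. map_permutation ?L projl (?m p) = p"
      using map_permutation_compose_inv[OF bL, of _ projl] by auto
    show "\<forall>p\<in>{p. p permutes ?L}. ?m (map_permutation ?L projl p) = p"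
      using map_permutation_compose_inv[OF bR, of _ Inl] by (metis f_inv_into_f imageE mem_Collect_eq sum.sel(1))
  qed
  also have "\<dots> = det P"
    unfolding det_def
  proof (rule sum.cong)
    fix p :: "'n \<Rightarrow> 'n" assume p: "p \<in> {p. p permutes UNIV}"
    then have mp: "?m p permutes ?L" by (auto intro!: map_permutation_permutes simp: bij_betw_def)
    have "?m p (Inl a) = Inl (p a)" for a by (simp add: map_permutation_apply)
    then have "(\<Prod>i\<in>UNIV. ?M $ i $ ?m p i) = (\<Prod>i\<in>UNIV. P $ i $ p i)"
      by (simp add: prod_UNIV_sum fixR[OF mp] mat_def)
    then show "of_int (sign (?m p)) * (\<Prod>i\<in>UNIV. ?M $ i $ ?m p i) = of_int (sign p) * (\<Prod>i\<in>UNIV. P $ i $ p i)"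
      using p by (simp add: sign_map_permutation)
  qed simp
  finally show ?thesis .
qed

text \<open>Exchanging the two copies of the index type, in the rows and in the columns, reduces
  this to \<open>det_block_Inl\<close>; the sign of the exchange enters twice and cancels.\<close>

lemma det_block_Inr:
  fixes S :: "'a::comm_ring_1^'n^'n::finite"
  shows "det (block_mat (mat 1) 0 0 S) = det S"
proof -
  define s :: "'n + 'n \<Rightarrow> 'n + 'n" where "s = case_sum Inr Inl"
  have s: "s permutes UNIV"
    by (rule bij_imp_permutes) (auto simp: s_def intro!: o_bij[of s] simp: fun_eq_iff split: sum.splits)
  have "det (block_mat (mat 1) 0 0 S) = det (\<chi> i j. block_mat S 0 0 (mat 1) $ s i $ s j)"
    by (rule arg_cong[where f=det], rule block_mat_eqI) (simp_all add: s_def)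
  also have "\<dots> = det (block_mat S 0 0 (mat 1))"
  proof -
    have "det (\<chi> i j. block_mat S 0 0 (mat 1) $ s i $ s j)
       = of_int (sign s) * det (\<chi> i j. block_mat S 0 0 (mat 1) $ i $ s j)"
      using det_permute_rows[OF s, of "\<chi> i j. block_mat S 0 0 (mat 1) $ i $ s j"] by simp
    also have "det (\<chi> i j. block_mat S 0 0 (mat 1) $ i $ s j) = of_int (sign s) * det (block_mat S 0 0 (mat 1))"
      by (rule det_permute_columns[OF s])
    finally show ?thesis
      by (simp add: mult.assoc[symmetric] sign_idempotent flip: of_int_mult)
  qed
  finally show ?thesis by (simp add: det_block_Inl)
qed

text \<open>Conjugation by diag(1, 2) doubles R, which amounts to squaring the unit lower matrix.
  Its determinant therefore equals its own square, and it is nonzero because -R gives the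
  inverse.\<close>

lemma det_block_unit_lower:
  fixes R :: "real^'n^'n::finite"
  shows "det (block_mat (mat 1) 0 R (mat 1)) = 1"
proof -
  let ?L = "\<lambda>R :: real^'n^'n. block_mat (mat 1) 0 R (mat 1)" and ?D = "block_mat (mat 1) 0 0 (mat 2) :: real^('n+'n)^('n+'n)"
  have "?D ** ?L R = (?L R ** ?L R) ** ?D"
  proof -
    have "mat 2 ** R = R + R" by (simp add: vec_eq_iff mat_mult_nth)
    then show ?thesis by (simp add: block_mat_mult)
  qed
  then have "det ?D * det (?L R) = det (?L R) * det (?L R) * det ?D"
    using arg_cong[of _ _ det] by (simp only: det_mul[symmetric])
  moreover have "det ?D \<noteq> 0" by (simp add: det_block_Inr det_mat)
  moreover have "?L R ** ?L (- R) = mat 1" by (simp add: block_mat_mult block_mat_1)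
  then have "det (?L R) * det (?L (- R)) = 1" by (simp only: det_mul[symmetric] det_I)
  then have "det (?L R) \<noteq> 0" by auto
  ultimately show ?thesis by simp
qed

lemma det_block_lower:
  fixes P R S :: "real^'n^'n::finite"
  shows "det (block_mat P 0 R S) = det P * det S"
proof -
  have "block_mat P 0 R S = block_mat P 0 0 (mat 1) ** (block_mat (mat 1) 0 R (mat 1) ** block_mat (mat 1) 0 0 S)"
    by (simp add: block_mat_mult)
  then show ?thesis by (simp add: det_mul det_block_Inl det_block_Inr det_block_unit_lower)
qed

lemma det_block_upper:
  fixes P Q S :: "real^'n^'n::finite"
  shows "det (block_mat P Q 0 S) = det P * det S"
proof -
  have "transpose (block_mat P Q 0 S) = block_mat (transpose P) 0 (transpose Q) (transpose S)"
    by (rule block_mat_eqI) (simp_all add: transpose_def)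
  then show ?thesis by (metis det_transpose det_block_lower)
qed

lemma matrix_inv_cancel:
  fixes A :: "'a::semiring_1^'n^'n::finite"
  assumes "invertible A"
  shows "A ** matrix_inv A = mat 1" and "matrix_inv A ** A = mat 1"
  using someI_ex[OF assms[unfolded invertible_def]] unfolding matrix_inv_def by auto

text \<open>Block elimination: a unit lower factor on the left removes R and leaves the Schur
  complement in the corner.\<close>

lemma det_block_schur:
  fixes P Q R S :: "real^'n^'n::finite"
  assumes "invertible P"
  shows "det (block_mat P Q R S) = det P * det (S - R ** matrix_inv P ** Q)"
proof -
  have "block_mat (mat 1) 0 (- (R ** matrix_inv P)) (mat 1) ** block_mat P Q R S
      = block_mat P Q 0 (S - R ** matrix_inv P ** Q)"
  proof -
    have "- (R ** matrix_inv P) ** P = - R"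
      using matrix_inv_cancel(2)[OF assms]
      by (simp add: bounded_bilinear.minus_left[OF bounded_bilinear_matrix_matrix_mult] matrix_mul_assoc[symmetric])
    then show ?thesis
      by (simp add: block_mat_mult bounded_bilinear.minus_left[OF bounded_bilinear_matrix_matrix_mult])
  qed
  then show ?thesis
    by (metis det_block_unit_lower det_block_upper det_mul mult_1)
qed

lemma det_cmat: "det (cmat M) = complex_of_real (det M)"
  by (simp add: det_def map_matrix_def)

lemma cmat_mult: "cmat (M ** N) = cmat M ** cmat N"
  by (simp add: map_matrix_def matrix_matrix_mult_def vec_eq_iff)

lemma transpose_cmat: "transpose (cmat M) = cmat (transpose M)"
  by (simp add: transpose_def map_matrix_def)

section \<open>Linear equations depending on a parameter\<close>

lemma has_derivative_zero_if_quadratic: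
  fixes f :: "'a::real_normed_vector \<Rightarrow> 'b::real_normed_vector"
  assumes "\<forall>\<^sub>F y in nhds x. norm (f y) \<le> C * (norm (y - x))\<^sup>2"
  shows "(f has_derivative (\<lambda>_. 0)) (at x)"
  unfolding has_derivative_at_alt
proof (intro conjI allI impI)
  obtain d where d: "d > 0" "\<And>y. dist y x < d \<Longrightarrow> norm (f y) \<le> C * (norm (y - x))\<^sup>2"
    using assms unfolding eventually_nhds_metric by blast
  have fx: "f x = 0" using d(2)[of x] d(1) by simp
  fix e :: real assume e: "0 < e"
  show "\<exists>d>0. \<forall>y. norm (y - x) < d \<longrightarrow> norm (f y - f x - 0) \<le> e * norm (y - x)"
  proof (intro exI[of _ "min d (e / (\<bar>C\<bar> + 1))"] conjI allI impI)
    fix y assume y: "norm (y - x) < min d (e / (\<bar>C\<bar> + 1))"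
    have "norm (f y) \<le> C * (norm (y - x))\<^sup>2" using d(2)[of y] y by (simp add: dist_norm)
    also have "\<dots> \<le> ((\<bar>C\<bar> + 1) * norm (y - x)) * norm (y - x)"
      by (simp add: power2_eq_square mult.assoc mult_right_mono)
    also have "\<dots> \<le> e * norm (y - x)"
      using y by (intro mult_right_mono) (auto simp: pos_less_divide_eq mult.commute)
    finally show "norm (f y - f x - 0) \<le> e * norm (y - x)" by (simp add: fx)
  qed (use d e in auto)
qed simp

text \<open>A solution S of a linear equation with coefficient M inherits regularity from M at a
  point where the operator is injective, the unknown being finite-dimensional. With matrix
  multiplication for h this yields the derivative of the inverse, with the Lyapunov operator the
  smoothness of its solution.\<close>

locale linear_solution =
  fixes h :: "'c::real_normed_vector \<Rightarrow> 'e::euclidean_space \<Rightarrow> 'e"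
    and M :: "'a::real_normed_vector \<Rightarrow> 'c" and b S :: "'a \<Rightarrow> 'e" and x :: 'a
  assumes h: "bounded_bilinear h"
    and inj: "\<And>v. h (M x) v = 0 \<Longrightarrow> v = 0"
    and eq: "\<forall>\<^sub>F y in nhds x. h (M y) (S y) = b y"
begin

lemma left_inverse:
  obtains g where "bounded_linear g" "\<And>v. g (h (M x) v) = v"
proof -
  have bl: "bounded_linear (h (M x))" by (rule bounded_bilinear.bounded_linear_right[OF h])
  have "inj (h (M x))"
  proof (rule injI)
    fix u v assume "h (M x) u = h (M x) v"
    then have "h (M x) (u - v) = 0" by (simp add: bounded_bilinear.diff_right[OF h])
    then show "u = v" using inj by force
  qed
  then obtain g where "linear g" "g \<circ> h (M x) = id"
    using linear_injective_left_inverse bounded_linear.linear[OF bl] by blast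
  then show ?thesis using that linear_conv_bounded_linear by (metis comp_apply id_apply)
qed

lemma diff_eq:
  assumes g: "bounded_linear g" "\<And>v. g (h (M x) v) = v"
  shows "\<forall>\<^sub>F y in nhds x. S y - S x = g (b y - b x) - g (h (M y - M x) (S y))"
  using eq
proof eventually_elim
  case (elim y)
  have "h (M x) (S x) = b x" using eventually_nhds_x_imp_x[OF eq] .
  then have "h (M x) (S y - S x) = (b y - b x) - h (M y - M x) (S y)"
    using elim by (simp add: bounded_bilinear.diff_right[OF h] bounded_bilinear.diff_left[OF h])
  then show ?case by (metis g(2) bounded_linear.linear[OF g(1)] linear_diff)
qed

lemma estimate:
  assumes M: "isCont M x"
  obtains C where "0 < C" "\<forall>\<^sub>F y in nhds x. norm (S y - S x) \<le> C * (norm (b y - b x) + norm (M y - M x))"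
proof -
  obtain g where g: "bounded_linear g" "\<And>v. g (h (M x) v) = v" using left_inverse by blast
  obtain G where G: "G > 0" "\<And>v. norm (g v) \<le> norm v * G"
    using bounded_linear.pos_bounded[OF g(1)] by blast
  obtain K where K: "K > 0" "\<And>m v. norm (h m v) \<le> norm m * norm v * K"
    using bounded_bilinear.pos_bounded[OF h] by blast
  \<comment> \<open>With this \<epsilon> the term in which \<open>S y - S x\<close> reappears on the
    right is at most half of the left side and is absorbed.\<close>
  define \<epsilon> where "\<epsilon> = 1 / (2 * K * G)"
  have \<epsilon>: "\<epsilon> > 0" using G K by (simp add: \<epsilon>_def)
  have "\<forall>\<^sub>F y in nhds x. dist (M y) (M x) < \<epsilon>"
    using M \<epsilon> unfolding isCont_def tendsto_iff eventually_at_filter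
    by (auto elim!: allE[of _ \<epsilon>] eventually_mono)
  then have "\<forall>\<^sub>F y in nhds x. norm (S y - S x) \<le> 2 * G * (norm (b y - b x) + norm (M y - M x) * norm (S x) * K)"
    using diff_eq[OF g]
  proof eventually_elim
    case (elim y)
    have "norm (S y - S x) \<le> norm (b y - b x) * G + norm (h (M y - M x) (S y)) * G"
      using arg_cong[OF elim(2), of norm] norm_triangle_ineq4[of "g (b y - b x)" "g (h (M y - M x) (S y))"] G(2)[of "b y - b x"] G(2)[of "h (M y - M x) (S y)"] by linarith
    also have "norm (h (M y - M x) (S y)) \<le> norm (M y - M x) * (norm (S x) + norm (S y - S x)) * K"
      by (rule order_trans[OF K(2)])
        (use K(1) norm_triangle_ineq[of "S x" "S y - S x"] in \<open>auto intro!: mult_right_mono mult_left_mono\<close>)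
    also have "\<dots> = norm (M y - M x) * norm (S x) * K + norm (M y - M x) * norm (S y - S x) * K"
      by (simp add: algebra_simps)
    also have "\<dots> \<le> norm (M y - M x) * norm (S x) * K + \<epsilon> * norm (S y - S x) * K"
      using elim(1) K(1) by (intro add_left_mono mult_right_mono) (auto simp: dist_norm)
    finally have fin: "norm (S y - S x) \<le> norm (b y - b x) * G + (norm (M y - M x) * norm (S x) * K + \<epsilon> * norm (S y - S x) * K) * G"
      using G(1) by (simp add: mult_right_mono)
    have "\<epsilon> * norm (S y - S x) * K * G = norm (S y - S x) / 2"
      using K G by (simp add: \<epsilon>_def)
    then have "(norm (M y - M x) * norm (S x) * K + \<epsilon> * norm (S y - S x) * K) * G
        = norm (M y - M x) * norm (S x) * K * G + norm (S y - S x) / 2"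
      by (simp only: distrib_right)
    moreover have "2 * G * (norm (b y - b x) + norm (M y - M x) * norm (S x) * K)
        = 2 * (norm (b y - b x) * G) + 2 * (norm (M y - M x) * norm (S x) * K * G)"
      by (simp add: algebra_simps)
    ultimately show ?case using fin by linarith
  qed
  then have "\<forall>\<^sub>F y in nhds x. norm (S y - S x) \<le> (2 * G * (1 + norm (S x) * K)) * (norm (b y - b x) + norm (M y - M x))"
  proof eventually_elim
    case (elim y)
    have "norm (b y - b x) + norm (M y - M x) * norm (S x) * K
        \<le> (1 + norm (S x) * K) * (norm (b y - b x) + norm (M y - M x))"
      using K(1) by (simp add: algebra_simps)
    from order_trans[OF elim mult_left_mono[OF this, of "2 * G"]] G show ?case by (simp only: mult.assoc)
  qed
  moreover have "0 < 2 * G * (1 + norm (S x) * K)" using G K by (simp add: add_pos_nonneg)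
  ultimately show ?thesis using that by blast
qed

lemma isCont_solution:
  assumes M: "isCont M x" and b: "isCont b x"
  shows "isCont S x"
proof -
  obtain C where C: "\<forall>\<^sub>F y in nhds x. norm (S y - S x) \<le> C * (norm (b y - b x) + norm (M y - M x))"
    using estimate[OF M] by blast
  have "((\<lambda>y. C * (norm (b y - b x) + norm (M y - M x))) \<longlongrightarrow> C * (norm (b x - b x) + norm (M x - M x))) (at x)"
    using M b by (intro tendsto_intros) (auto simp: isCont_def)
  then have "((\<lambda>y. S y - S x) \<longlongrightarrow> 0) (at x)"
    by (intro Lim_null_comparison[OF filter_leD[OF at_within_le_nhds C]]) simp
  then show ?thesis unfolding isCont_def using LIM_zero_iff by blast
qed

text \<open>In \<open>diff_eq\<close> the factor \<open>S y\<close> is split as \<open>S x\<close>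
  plus the increment. The first part is differentiable; the second is of second order, because
  \<open>estimate\<close> makes S Lipschitz at x. The derivative is characterised by the
  differentiated equation, which identifies it since the operator at x is injective.\<close>

lemma solution_has_derivative:
  assumes M: "(M has_derivative M') (at x)" and b: "b = (\<lambda>_. b0)"
  obtains S' where "(S has_derivative S') (at x)" "\<And>k. h (M x) (S' k) = - h (M' k) (S x)"
proof -
  obtain g where g: "bounded_linear g" "\<And>v. g (h (M x) v) = v" using left_inverse by blast
  have hx: "bounded_linear (h (M x))" by (rule bounded_bilinear.bounded_linear_right[OF h])
  have Mcont: "isCont M x" using has_derivative_continuous[OF M] .
  obtain C where C: "C > 0" "\<forall>\<^sub>F y in nhds x. norm (S y - S x) \<le> C * (norm (b y - b x) + norm (M y - M x))"
    using estimate[OF Mcont] by blast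
  obtain K where K: "K > 0" "\<And>m v. norm (h m v) \<le> norm m * norm v * K"
    using bounded_bilinear.pos_bounded[OF h] by blast
  obtain L where L: "L \<ge> 0" "\<And>k. norm (M' k) \<le> L * norm k"
    using bounded_linear.nonneg_bounded[OF has_derivative_bounded_linear[OF M]] by (auto simp: mult.commute)
  have lipM: "\<forall>\<^sub>F y in nhds x. norm (M y - M x) \<le> (L + 1) * norm (y - x)"
  proof -
    obtain d where d: "d > 0" "\<And>y. norm (y - x) < d \<Longrightarrow> norm (M y - M x - M' (y - x)) \<le> 1 * norm (y - x)"
      using M unfolding has_derivative_at_alt by (meson zero_less_one)
    show ?thesis unfolding eventually_nhds_metric
    proof (intro exI[of _ d] conjI allI impI)
      fix y assume "dist y x < d"
      then show "norm (M y - M x) \<le> (L + 1) * norm (y - x)"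
        using d(2)[of y] L(2)[of "y - x"] norm_triangle_sub[of "M y - M x" "M' (y - x)"]
        by (simp add: dist_norm algebra_simps)
    qed (use d in auto)
  qed
  have "\<forall>\<^sub>F y in nhds x. norm (h (M y - M x) (S y - S x)) \<le> (C * (L + 1) * (L + 1) * K) * (norm (y - x))\<^sup>2"
    using C(2) lipM
  proof eventually_elim
    case (elim y)
    have "norm (S y - S x) \<le> C * norm (M y - M x)" using elim(1) by (simp add: b)
    also have "\<dots> \<le> C * ((L + 1) * norm (y - x))"
      using elim(2) C(1) by (intro mult_left_mono) auto
    finally have Sb: "norm (S y - S x) \<le> C * ((L + 1) * norm (y - x))" .
    have "norm (h (M y - M x) (S y - S x)) \<le> ((L + 1) * norm (y - x)) * (C * ((L + 1) * norm (y - x))) * K"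
      using L(1) K(1) by (intro order_trans[OF K(2)] mult_right_mono mult_mono elim(2) Sb) auto
    then show ?case by (simp add: power2_eq_square algebra_simps)
  qed
  then have d2: "((\<lambda>y. h (M y - M x) (S y - S x)) has_derivative (\<lambda>_. 0)) (at x)"
    by (rule has_derivative_zero_if_quadratic)
  have d1: "((\<lambda>y. h (M y - M x) (S x)) has_derivative (\<lambda>k. h (M' k) (S x))) (at x)"
    by (rule bounded_linear.has_derivative[OF bounded_bilinear.bounded_linear_left[OF h]])
      (use M in \<open>auto intro!: derivative_eq_intros\<close>)
  have "((\<lambda>y. S x - g (h (M y - M x) (S x) + h (M y - M x) (S y - S x))) has_derivative (\<lambda>k. 0 - g (h (M' k) (S x) + 0))) (at x)"
    by (intro has_derivative_diff has_derivative_const bounded_linear.has_derivative[OF g(1)] has_derivative_add d1 d2)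
  moreover have ev: "\<forall>\<^sub>F y in nhds x. S x - g (h (M y - M x) (S x) + h (M y - M x) (S y - S x)) = S y"
    using diff_eq[OF g]
  proof eventually_elim
    case (elim y)
    have "h (M y - M x) (S x) + h (M y - M x) (S y - S x) = h (M y - M x) (S y)"
      by (simp add: bounded_bilinear.diff_right[OF h])
    with elim show ?case
      by (simp add: b linear_0[OF bounded_linear.linear[OF g(1)]] algebra_simps)
  qed
  ultimately have "(S has_derivative (\<lambda>k. 0 - g (h (M' k) (S x) + 0))) (at x)"
    using has_derivative_transform_eventually[OF _ filter_leD[OF at_within_le_nhds ev] eventually_nhds_x_imp_x[OF ev]] by blast
  then have D: "(S has_derivative (\<lambda>k. - g (h (M' k) (S x)))) (at x)" by simp
  have surj: "h (M x) (g v) = v" for v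
  proof -
    have "inj (h (M x))" using g(2) by (metis injI)
    then have "surj (h (M x))" using linear_injective_imp_surjective[OF bounded_linear.linear[OF hx]] by auto
    then obtain w where "v = h (M x) w" by (metis surjE)
    then show ?thesis by (simp add: g(2))
  qed
  show ?thesis
    by (rule that[OF D]) (simp add: bounded_bilinear.minus_right[OF h] surj)
qed

end

section \<open>The Lyapunov equation\<close>

lemma map_matrix_nth: "map_matrix h M $ i $ j = h (M $ i $ j)"
  by (simp add: map_matrix_def)

lemma mat_vector_mult: "mat c *v v = c *s v"
  for v :: "'a::comm_ring_1^'n::finite"
  by (simp add: vec_eq_iff matrix_vector_mult_def mat_def if_distrib[of "\<lambda>x. x * y" for y] cong: if_cong)

text \<open>The vector p(M) v, computed by Horner's rule.\<close>

definition poly_act :: "complex^'n^'n \<Rightarrow> complex poly \<Rightarrow> complex^'n \<Rightarrow> complex^'n::finite" where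
  "poly_act M p v = fold_coeffs (\<lambda>a w. a *s v + M *v w) p 0"

lemma poly_act_0 [simp]: "poly_act M 0 v = 0"
  by (simp add: poly_act_def)

lemma poly_act_pCons [simp]: "poly_act M (pCons a p) v = a *s v + M *v poly_act M p v"
  by (cases "p = 0 \<and> a = 0") (auto simp: poly_act_def fold_coeffs_def cCons_def)

lemma matrix_vector_mult_smult: "M *v (a *s v) = a *s (M *v v)"
  for M :: "'a::comm_ring_1^'n^'m::finite"
  by (simp add: vec_eq_iff matrix_vector_mult_def sum_distrib_left mult_ac)

lemma poly_act_add: "poly_act M (p + q) v = poly_act M p v + poly_act M q v"
proof (induction p q rule: poly_induct2)
  case (pCons a p b q)
  then show ?case by (simp add: matrix_vector_right_distrib algebra_simps)
qed simp

lemma poly_act_smult: "poly_act M (smult c p) v = c *s poly_act M p v"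
proof (induction p)
  case (pCons a p)
  then show ?case by (simp add: matrix_vector_mult_smult vector_add_ldistrib)
qed simp

lemma poly_act_monom: "poly_act M (monom a i) v = a *s (((*v) M ^^ i) v)"
  by (induction i) (auto simp: monom_0 monom_Suc matrix_vector_mult_smult)

lemma poly_act_sum: "poly_act M (\<Sum>k\<in>A. p k) v = (\<Sum>k\<in>A. poly_act M (p k) v)"
  by (induction A rule: infinite_finite_induct) (auto simp: poly_act_add)

lemma poly_act_linear_factor: "poly_act M ([:- \<mu>, 1:] * q) v = M *v poly_act M q v - \<mu> *s poly_act M q v"
proof -
  have "[:- \<mu>, 1:] * q = smult (- \<mu>) q + pCons 0 q" by simp
  then show ?thesis
    unfolding poly_act_add poly_act_smult poly_act_pCons by (simp only: poly_act_add poly_act_smult poly_act_pCons) (simp add: vec_eq_iff)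
qed

text \<open>The type \<open>'n option\<close> supplies n + 1 coefficients, one more than the
  dimension, so the map from coefficients to combinations of iterates of x has a kernel. The
  injection \<open>idx\<close> assigns distinct exponents, so a nonzero coefficient vector yields a
  nonzero polynomial.\<close>

lemma annihilating_poly_exists:
  fixes M :: "complex^'n^'n::finite"
  shows "\<exists>p. p \<noteq> 0 \<and> poly_act M p x = 0"
proof -
  obtain idx :: "'n option \<Rightarrow> nat" where idx: "inj idx"
    using finite_imp_inj_to_nat_seg[of "UNIV :: 'n option set"] by auto
  define F :: "complex^('n option) \<Rightarrow> complex^'n" where "F c = (\<Sum>k\<in>UNIV. c $ k *s (((*v) M ^^ idx k) x))" for c
  have lin: "linear F"
    unfolding F_def
    by (rule linearI) (auto simp: vec_eq_iff sum.distrib algebra_simps scaleR_sum_right)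
  have "\<not> inj F"
  proof
    assume "inj F"
    then have "dim (range F) = dim (UNIV :: (complex^('n option)) set)"
      using lin by (intro dim_image_eq) (auto intro: inj_on_subset)
    moreover have "dim (range F) \<le> DIM(complex^'n)" using dim_subset_UNIV by blast
    ultimately have "DIM(complex^('n option)) \<le> DIM(complex^'n)" by simp
    then show False by simp
  qed
  then obtain c where c: "F c = 0" "c \<noteq> 0" using linear_injective_0[OF lin] by blast
  define p where "p = (\<Sum>k\<in>UNIV. monom (c $ k) (idx k))"
  have "coeff p (idx k) = c $ k" for k
  proof -
    have "coeff p (idx k) = (\<Sum>j\<in>UNIV. if j = k then c $ j else 0)"
      unfolding p_def coeff_sum coeff_monom using idx by (intro sum.cong) (auto simp: inj_eq)
    then show ?thesis by simp
  qed
  moreover obtain k where "c $ k \<noteq> 0" using c(2) by (auto simp: vec_eq_iff)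
  ultimately have "p \<noteq> 0" by (metis coeff_0)
  moreover have "poly_act M p x = 0"
    using c(1) by (simp add: p_def poly_act_sum poly_act_monom F_def)
  ultimately show ?thesis by blast
qed

text \<open>An eigenvector of M modulo V. An annihilating polynomial sends x into V; linear factors
  are split off one at a time, and the last one before the vector leaves V provides \<mu> and
  y.\<close>

lemma quotient_eigenvector_exists:
  fixes M :: "complex^'n^'n::finite"
  assumes x: "x \<notin> V" and V: "\<And>c v. v \<in> V \<Longrightarrow> c *s v \<in> V" "0 \<in> V"
  shows "\<exists>\<mu> y. y \<notin> V \<and> M *v y - \<mu> *s y \<in> V"
proof -
  have "\<exists>\<mu> y. y \<notin> V \<and> M *v y - \<mu> *s y \<in> V" if "p \<noteq> 0" "poly_act M p x \<in> V" for p
    using that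
  proof (induction "degree p" arbitrary: p rule: less_induct)
    case less
    show ?case
    proof (cases "degree p = 0")
      case True
      then obtain c where p: "p = [:c:]" using degree_eq_zeroE by blast
      with less.prems have "c \<noteq> 0" "c *s x \<in> V" by simp_all
      have "inverse c *s (c *s x) \<in> V" by (rule V(1)[OF \<open>c *s x \<in> V\<close>])
      moreover have "inverse c *s (c *s x) = x" using \<open>c \<noteq> 0\<close> by (simp add: vec_eq_iff mult.assoc[symmetric])
      ultimately have "x \<in> V" by (simp only:)
      then show ?thesis using x by blast
    next
      case False
      then have "\<not> constant (poly p)" by (simp add: constant_degree)
      then obtain \<mu> where "poly p \<mu> = 0" using fundamental_theorem_of_algebra by blast
      then obtain q where q: "p = [:- \<mu>, 1:] * q" using poly_eq_0_iff_dvd by blast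
      then have q0: "q \<noteq> 0" using less.prems by auto
      have deg: "degree q < degree p" unfolding q using q0 by (subst degree_mult_eq) auto
      show ?thesis
      proof (cases "poly_act M q x \<in> V")
        case True then show ?thesis using less.hyps[OF deg q0] by blast
      next
        case False
        then show ?thesis using less.prems(2) unfolding q poly_act_linear_factor by blast
      qed
    qed
  qed
  then show ?thesis using annihilating_poly_exists[of M x] V(2) by metis
qed

lemma mat_spectrum_iff_det: "\<mu> \<in> mat_spectrum M \<longleftrightarrow> det (cmat M - mat \<mu>) = 0"
proof -
  have "\<mu> \<in> mat_spectrum M \<longleftrightarrow> (\<exists>v. v \<noteq> 0 \<and> (cmat M - mat \<mu>) *v v = 0)"
    unfolding mat_spectrum_def
    by (auto simp: matrix_vector_mult_diff_rdistrib mat_vector_mult)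
  also have "\<dots> \<longleftrightarrow> \<not> invertible (cmat M - mat \<mu>)"
    unfolding invertible_left_inverse matrix_left_invertible_ker by blast
  also have "\<dots> \<longleftrightarrow> det (cmat M - mat \<mu>) = 0"
    by (simp add: invertible_det_nz)
  finally show ?thesis .
qed

lemma mat_spectrum_transpose: "mat_spectrum (transpose M) = mat_spectrum M"
proof -
  have "det (cmat (transpose M) - mat \<mu>) = det (cmat M - mat \<mu>)" for \<mu>
  proof -
    have "cmat (transpose M) - mat \<mu> = transpose (cmat M - mat \<mu>)"
      by (simp add: transpose_cmat[symmetric] transpose_def vec_eq_iff mat_def)
    then show ?thesis by (simp add: det_transpose)
  qed
  then show ?thesis by (auto simp: mat_spectrum_iff_det)
qed

lemma invertible_of_mat_spectrum:
  fixes M :: "real^'n^'n::finite"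
  assumes "\<And>\<mu>. \<mu> \<in> mat_spectrum M \<Longrightarrow> Re \<mu> > 0"
  shows "invertible M"
proof -
  have "0 \<notin> mat_spectrum M" using assms[of 0] by auto
  then have "det (cmat M) \<noteq> 0" by (simp add: mat_spectrum_iff_det)
  then show ?thesis by (simp add: det_cmat invertible_det_nz)
qed

text \<open>If X were nonzero, its kernel V would be proper. For y an eigenvector of B modulo V with
  value \<mu>, the vector X y is an eigenvector of B^T for -\<mu>, so -\<mu> has positive real part
  and \<mu> is no eigenvalue of B. Then B - \<mu> is injective and maps the invariant space V onto
  itself; as (B - \<mu>) y lies in V, so does y, a contradiction.\<close>

lemma sylvester_injective:
  fixes B X :: "real^'n^'n::finite"
  assumes spec: "\<And>\<mu>. \<mu> \<in> mat_spectrum B \<Longrightarrow> Re \<mu> > 0"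
    and X: "X ** B + transpose B ** X = 0"
  shows "X = 0"
proof (rule ccontr)
  assume "X \<noteq> 0"
  let ?X = "cmat X" and ?B = "cmat B" and ?Bt = "cmat (transpose B)"
  define V where "V = {v. ?X *v v = 0}"
  have comm: "?X *v (?B *v v) = - (?Bt *v (?X *v v))" for v
  proof -
    have "?X ** ?B + ?Bt ** ?X = cmat (X ** B + transpose B ** X)"
      by (simp only: cmat_mult[symmetric]) (simp add: vec_eq_iff map_matrix_nth)
    also have "\<dots> = 0" unfolding X by (simp add: map_matrix_def vec_eq_iff)
    finally have "(?X ** ?B + ?Bt ** ?X) *v v = 0" by simp
    then show ?thesis
      by (simp add: matrix_vector_mult_add_rdistrib matrix_vector_mul_assoc eq_neg_iff_add_eq_0)
  qed
  obtain i j where "X $ i $ j \<noteq> 0" using \<open>X \<noteq> 0\<close> by (auto simp: vec_eq_iff)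
  then have "(?X *v axis j 1) $ i \<noteq> 0"
    by (simp add: matrix_vector_mult_def axis_def map_matrix_nth if_distrib cong: if_cong)
  then have x: "axis j 1 \<notin> V" unfolding V_def by (metis mem_Collect_eq zero_index)
  obtain \<mu> y where y: "y \<notin> V" "?B *v y - \<mu> *s y \<in> V"
    using quotient_eigenvector_exists[OF x, of ?B] by (auto simp: V_def matrix_vector_mult_smult)
  have "?Bt *v (?X *v y) = (- \<mu>) *s (?X *v y)"
    using y(2) comm[of y] by (simp add: V_def matrix_vector_mult_diff_distrib matrix_vector_mult_smult)
      (metis add.inverse_inverse vector_smult_lneg)
  moreover have "?X *v y \<noteq> 0" using y(1) by (simp add: V_def)
  ultimately have "- \<mu> \<in> mat_spectrum (transpose B)" unfolding mat_spectrum_def by blast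
  then have "Re (- \<mu>) > 0" using spec by (simp only: mat_spectrum_transpose)
  then have "\<mu> \<notin> mat_spectrum B" using spec[of \<mu>] by auto
  then have inj: "v = 0" if "?B *v v - \<mu> *s v = 0" for v
    using that unfolding mat_spectrum_def by auto
  let ?f = "\<lambda>v. ?B *v v - \<mu> *s v"
  have lin: "linear ?f"
    by (rule linearI) (auto simp: vec_eq_iff matrix_vector_mult_def sum.distrib algebra_simps scaleR_sum_right)
  have subV: "subspace V"
    unfolding V_def subspace_def
    by (auto simp: matrix_vector_right_distrib) (auto simp: vec_eq_iff matrix_vector_mult_def scaleR_sum_right[symmetric])
  have injf: "inj ?f" using inj linear_injective_0[OF lin] by blast
  have "?f ` V \<subseteq> V"
    using comm by (auto simp: V_def matrix_vector_mult_diff_distrib matrix_vector_mult_smult)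
  moreover have "dim (?f ` V) = dim V"
    by (rule dim_image_eq[OF lin]) (use injf inj_on_subset in blast)
  moreover have "subspace (?f ` V)" by (rule linear_subspace_image[OF lin subV])
  ultimately have "?f ` V = V" using subspace_dim_equal[of "?f ` V" V] subV by simp
  then obtain z where "z \<in> V" "?f z = ?f y" using y(2) by (metis (no_types, lifting) image_iff)
  then have "z = y" using injf injD[of ?f z y] by blast
  then show False using y(1) \<open>z \<in> V\<close> by simp
qed

section \<open>The solution of the Lyapunov equation and its positivity\<close>

definition lyap_op :: "real^'n^'n \<Rightarrow> real^'n^'n \<Rightarrow> real^'n^'n::finite" where
  "lyap_op B S = S ** B + transpose B ** S"

lemma bounded_bilinear_lyap_op: "bounded_bilinear lyap_op"
  unfolding bilinear_conv_bounded_bilinear[symmetric] bilinear_def lyap_op_def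
  by (auto intro!: linearI simp: matrix_matrix_mult_def transpose_def vec_eq_iff sum.distrib algebra_simps sum_distrib_left)

definition spec_pos :: "real^'n^'n::finite \<Rightarrow> bool" where
  "spec_pos B \<longleftrightarrow> (\<forall>\<mu>\<in>mat_spectrum B. Re \<mu> > 0)"

lemma lyap_op_inj: "spec_pos B \<Longrightarrow> lyap_op B S = 0 \<Longrightarrow> S = 0"
  unfolding spec_pos_def lyap_op_def using sylvester_injective by blast

lemma lyap_op_ex1:
  assumes "spec_pos B"
  shows "\<exists>!S. lyap_op B S = mat 1"
proof -
  have lin: "linear (lyap_op B)"
    using bounded_bilinear.bounded_linear_right[OF bounded_bilinear_lyap_op] bounded_linear.linear by blast
  have "inj (lyap_op B)" using linear_injective_0[OF lin] lyap_op_inj[OF assms] by blast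
  moreover have "surj (lyap_op B)" using linear_injective_imp_surjective[OF lin] calculation by auto
  ultimately show ?thesis by (metis injD surjD)
qed

definition lyap_sol :: "real^'n^'n \<Rightarrow> real^'n^'n::finite" where
  "lyap_sol B = (THE S. lyap_op B S = mat 1)"

lemma lyap_sol: "spec_pos B \<Longrightarrow> lyap_op B (lyap_sol B) = mat 1"
  unfolding lyap_sol_def by (rule theI'[OF lyap_op_ex1])

lemma lyap_sol_unique: "spec_pos B \<Longrightarrow> lyap_op B S = mat 1 \<Longrightarrow> S = lyap_sol B"
  using lyap_op_ex1 lyap_sol by blast

lemma transpose_add: "transpose (A + B) = transpose A + transpose B"
  by (simp add: transpose_def vec_eq_iff)

lemma lyap_sol_sym:
  assumes "spec_pos B" shows "transpose (lyap_sol B) = lyap_sol B"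
proof (rule lyap_sol_unique[OF assms])
  have "transpose (lyap_op B (lyap_sol B)) = mat 1" by (simp add: lyap_sol[OF assms] transpose_mat)
  then show "lyap_op B (transpose (lyap_sol B)) = mat 1"
    by (simp add: lyap_op_def transpose_add matrix_transpose_mul add.commute)
qed

text \<open>This replaces coercivity of B: in the inner product defined by S the matrix B is
  positive definite, although its symmetric part in the standard inner product may be
  indefinite.\<close>

lemma lyap_quadratic:
  assumes "spec_pos B" shows "2 * ((lyap_sol B *v v) \<bullet> (B *v v)) = v \<bullet> v"
proof -
  let ?S = "lyap_sol B"
  have "v \<bullet> v = v \<bullet> (lyap_op B ?S *v v)" by (simp add: lyap_sol[OF assms])
  also have "\<dots> = v \<bullet> (?S *v (B *v v)) + v \<bullet> (transpose B *v (?S *v v))"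
    by (simp add: lyap_op_def matrix_vector_mult_add_rdistrib matrix_vector_mul_assoc inner_add_right)
  also have "v \<bullet> (?S *v (B *v v)) = (?S *v v) \<bullet> (B *v v)"
    by (metis dot_lmul_matrix lyap_sol_sym[OF assms] transpose_matrix_vector)
  also have "v \<bullet> (transpose B *v (?S *v v)) = (?S *v v) \<bullet> (B *v v)"
    by (metis dot_lmul_matrix inner_commute transpose_matrix_vector)
  finally show ?thesis by simp
qed

lemma spec_pos_homotopy:
  assumes B: "spec_pos B" and \<theta>: "0 \<le> \<theta>" "\<theta> \<le> 1"
  shows "spec_pos ((1 - \<theta>) *\<^sub>R B + \<theta> *\<^sub>R mat 1)"
  unfolding spec_pos_def
proof
  fix \<mu> assume "\<mu> \<in> mat_spectrum ((1 - \<theta>) *\<^sub>R B + \<theta> *\<^sub>R mat 1)"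
  then obtain v where v: "v \<noteq> 0" "cmat ((1 - \<theta>) *\<^sub>R B + \<theta> *\<^sub>R mat 1) *v v = \<mu> *s v"
    by (auto simp: mat_spectrum_def)
  have "cmat ((1 - \<theta>) *\<^sub>R B + \<theta> *\<^sub>R mat 1) = mat (of_real (1 - \<theta>)) ** cmat B + mat (of_real \<theta>)"
    by (simp add: vec_eq_iff mat_mult_nth map_matrix_nth) (simp add: mat_def)
  then have "cmat ((1 - \<theta>) *\<^sub>R B + \<theta> *\<^sub>R mat 1) *v v = of_real (1 - \<theta>) *s (cmat B *v v) + of_real \<theta> *s v"
    by (simp only: matrix_vector_mult_add_rdistrib matrix_vector_mul_assoc[symmetric] mat_vector_mult)
  with v(2) have eq: "of_real (1 - \<theta>) *s (cmat B *v v) = (\<mu> - of_real \<theta>) *s v"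
    by (simp add: vec_eq_iff algebra_simps)
  show "Re \<mu> > 0"
  proof (cases "\<theta> = 1")
    case True
    then have "\<mu> = 1" using eq v(1) by (auto simp: vec_eq_iff)
    then show ?thesis by simp
  next
    case False
    then have t: "1 - \<theta> > 0" using \<theta> by simp
    define \<nu> where "\<nu> = (\<mu> - of_real \<theta>) / of_real (1 - \<theta>)"
    have "cmat B *v v = \<nu> *s v"
    proof -
      have "of_real (1 - \<theta>) * (cmat B *v v) $ i = (\<mu> - of_real \<theta>) * v $ i" for i
        using arg_cong[OF eq, of "\<lambda>w. w $ i"] by (simp only: vector_smult_component)
      then show ?thesis using t by (simp add: vec_eq_iff \<nu>_def field_simps)
    qed
    then have "Re \<nu> > 0" using B v(1) unfolding spec_pos_def mat_spectrum_def by blast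
    moreover have "\<mu> = of_real (1 - \<theta>) * \<nu> + of_real \<theta>" using t by (simp add: \<nu>_def field_simps)
    ultimately show ?thesis using t \<theta> by (simp add: add_pos_nonneg)
  qed
qed

text \<open>Along the segment from \<open>B\<close> to the identity the quadratic form of the solution can lose
  positivity only through a kernel, which the Lyapunov equation excludes.\<close>

lemma lyap_sol_pos:
  fixes B :: "real^'n^'n::finite"
  assumes B: "spec_pos B" and v: "v \<noteq> 0"
  shows "v \<bullet> (lyap_sol B *v v) > 0"
proof (rule ccontr)
  assume neg: "\<not> ?thesis"
  define B\<theta> where "B\<theta> \<theta> = (1 - \<theta>) *\<^sub>R B + \<theta> *\<^sub>R mat 1" for \<theta> :: real
  \<comment> \<open>Clamping \<theta> to the unit interval makes S defined by the equation, and
    continuous, for every real \<theta>.\<close>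
  define S where "S \<theta> = lyap_sol (B\<theta> (max 0 (min 1 \<theta>)))" for \<theta> :: real
  have sp: "spec_pos (B\<theta> (max 0 (min 1 \<theta>)))" for \<theta>
    unfolding B\<theta>_def by (rule spec_pos_homotopy[OF B]) auto
  have S_cont: "isCont S \<theta>" for \<theta>
  proof -
    interpret linear_solution lyap_op "\<lambda>\<theta>. B\<theta> (max 0 (min 1 \<theta>))" "\<lambda>_. mat 1" S \<theta>
    proof (rule linear_solution.intro)
      show "lyap_op (B\<theta> (max 0 (min 1 \<theta>))) v = 0 \<Longrightarrow> v = 0" for v by (rule lyap_op_inj[OF sp])
      show "\<forall>\<^sub>F y in nhds \<theta>. lyap_op (B\<theta> (max 0 (min 1 y))) (S y) = mat 1" by (simp add: S_def lyap_sol[OF sp])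
    qed (rule bounded_bilinear_lyap_op)
    show ?thesis
      by (rule isCont_solution) (auto simp: B\<theta>_def intro!: continuous_intros)
  qed
  have g_cont: "continuous_on UNIV (\<lambda>p::real \<times> (real^'n). snd p \<bullet> (S (fst p) *v snd p))"
  proof -
    have "continuous_on UNIV (\<lambda>p::real \<times> (real^'n). S (fst p))"
      by (rule continuous_on_compose2[of UNIV S _ fst]) (auto intro!: continuous_at_imp_continuous_on S_cont continuous_intros)
    then show ?thesis
      by (intro continuous_intros continuous_on_matrix_vector_mult)
  qed
  define Z where "Z = {p \<in> {0..1} \<times> sphere 0 1. snd p \<bullet> (S (fst p) *v snd p) \<le> 0}"
  have "closed {p::real \<times> (real^'n). snd p \<bullet> (S (fst p) *v snd p) \<le> 0}"
    using g_cont by (intro closed_Collect_le) auto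
  then have "compact Z"
    unfolding Z_def Collect_conj_eq Collect_mem_eq
    by (intro compact_Int_closed compact_Times) auto
  moreover have "Z \<noteq> {}"
  proof -
    have "(1 / norm v) *\<^sub>R v \<bullet> (S 0 *v ((1 / norm v) *\<^sub>R v)) \<le> 0"
      using neg v by (simp add: S_def B\<theta>_def matrix_vector_mult_scaleR divide_le_0_iff)
    then have "(0, (1 / norm v) *\<^sub>R v) \<in> Z" using v by (simp add: Z_def)
    then show ?thesis by blast
  qed
  \<comment> \<open>The first component of p is the largest \<theta> at which positivity fails.
    Beyond it all forms are positive, so the form there is semidefinite and takes the value 0 at the
    unit vector w.\<close>
  ultimately obtain p where p: "p \<in> Z" "\<And>q. q \<in> Z \<Longrightarrow> fst q \<le> fst p"
    using continuous_attains_sup[of Z fst] continuous_on_fst[OF continuous_on_id] by (metis (no_types, lifting))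
  define t w where "t = fst p" and "w = snd p"
  have t: "0 \<le> t" "t \<le> 1" and w: "norm w = 1" and le: "w \<bullet> (S t *v w) \<le> 0"
    using p(1) by (auto simp: Z_def t_def w_def)
  have spt: "spec_pos (B\<theta> t)" and St: "S t = lyap_sol (B\<theta> t)"
    using sp[of t] t by (auto simp: S_def max_def min_def)
  have "t \<noteq> 1"
  proof
    assume "t = 1"
    have "2 * ((S t *v w) \<bullet> w) = w \<bullet> w"
      using lyap_quadratic[OF spt, of w] St \<open>t = 1\<close> by (simp add: B\<theta>_def)
    then show False using le w by (simp add: inner_commute dot_square_norm)
  qed
  then have t1: "t < 1" using t by simp
  have psd: "u \<bullet> (S t *v u) \<ge> 0" for u
  proof (cases "u = 0")
    case False
    have pos: "u \<bullet> (S s *v u) > 0" if s: "t < s" "s \<le> 1" for s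
    proof (rule ccontr)
      assume "\<not> u \<bullet> (S s *v u) > 0"
      then have "(1 / norm u) *\<^sub>R u \<bullet> (S s *v ((1 / norm u) *\<^sub>R u)) \<le> 0"
        using False by (simp add: matrix_vector_mult_scaleR divide_le_0_iff)
      then have "(s, (1 / norm u) *\<^sub>R u) \<in> Z" using False s t by (simp add: Z_def)
      then show False using p(2) s by (force simp: t_def)
    qed
    have "isCont (\<lambda>s. u \<bullet> (S s *v u)) t"
      by (intro continuous_intros bounded_bilinear.continuous[OF bounded_bilinear_matrix_vector_mult'] S_cont)
    then have "((\<lambda>s. u \<bullet> (S s *v u)) \<longlongrightarrow> u \<bullet> (S t *v u)) (at_right t)"
      unfolding isCont_def by (rule filterlim_mono) (auto simp: at_le)
    moreover have "\<forall>\<^sub>F s in at_right t. 0 \<le> u \<bullet> (S s *v u)"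
      using pos t1 unfolding eventually_at_right_field by (intro exI[of _ 1]) (auto intro: less_imp_le)
    ultimately show ?thesis by (intro tendsto_lowerbound) auto
  qed simp
  have sym: "u \<bullet> (S t *v w) = w \<bullet> (S t *v u)" for u
    by (metis St dot_lmul_matrix inner_commute lyap_sol_sym[OF spt] transpose_matrix_vector)
  have w0: "w \<bullet> (S t *v w) = 0" using le psd[of w] by simp
  have "S t *v w = 0"
  proof (rule ccontr)
    assume ne: "S t *v w \<noteq> 0"
    let ?u = "S t *v w"
    define a c where "a = ?u \<bullet> ?u" and "c = ?u \<bullet> (S t *v ?u)"
    have a: "a > 0" using ne by (simp add: a_def)
    have c: "c \<ge> 0" using psd[of ?u] by (simp add: c_def)
    have q: "0 \<le> - 2 * e * a + e\<^sup>2 * c" for e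
    proof -
      have "0 \<le> (w - e *\<^sub>R ?u) \<bullet> (S t *v (w - e *\<^sub>R ?u))" by (rule psd)
      also have "\<dots> = - 2 * e * a + e\<^sup>2 * c"
        using w0 sym[of ?u]
        by (simp add: matrix_vector_mult_diff_distrib matrix_vector_mult_scaleR inner_diff_left inner_diff_right a_def c_def power2_eq_square algebra_simps)
      finally show ?thesis .
    qed
    \<comment> \<open>A short step from w against S w would make the form negative, since -2 e a
      dominates e^2 c. The added 1 keeps the denominator positive when c = 0.\<close>
    define e where "e = a / (c + 1)"
    have "e > 0" using a c by (simp add: e_def)
    have "e * c < 2 * a" using a c by (simp add: e_def field_simps add_pos_nonneg) (simp add: add_nonneg_pos)
    then have "e * (e * c) < e * (2 * a)" using \<open>e > 0\<close> by (rule mult_strict_left_mono)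
    then show False using q[of e] by (simp add: power2_eq_square algebra_simps)
  qed
  then have "w \<bullet> w = 0" using lyap_quadratic[OF spt, of w] St by simp
  then show False using w by simp
qed

section \<open>The Evans function of a periodic pencil\<close>

lemma has_vector_derivative_vec:
  fixes g :: "real \<Rightarrow> 'a::euclidean_space^'n::finite"
  assumes "\<And>i. ((\<lambda>x. g x $ i) has_vector_derivative g' $ i) (at x within S)"
  shows "(g has_vector_derivative g') (at x within S)"
proof -
  have bl: "bounded_linear (axis i :: 'a \<Rightarrow> 'a^'n)" for i
    unfolding linear_conv_bounded_linear[symmetric] by (rule linearI) (auto simp: axis_def vec_eq_iff)
  have eq: "v = (\<Sum>i\<in>UNIV. axis i (v $ i))" for v :: "'a^'n"
    by (simp add: vec_eq_iff axis_def if_distrib cong: if_cong)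
  have "((\<lambda>x. \<Sum>i\<in>UNIV. axis i (g x $ i)) has_vector_derivative (\<Sum>i\<in>UNIV. axis i (g' $ i))) (at x within S)"
    by (intro has_vector_derivative_sum bounded_linear.has_vector_derivative[OF bl] assms)
  then show ?thesis by (simp only: eq[symmetric])
qed

lemma continuous_on_vec:
  fixes g :: "'b::topological_space \<Rightarrow> 'a::topological_space^'n::finite"
  assumes "\<And>i. continuous_on S (\<lambda>x. g x $ i)"
  shows "continuous_on S g"
  using assms unfolding continuous_on_def by (auto intro: vec_tendstoI)

lemma has_vector_derivative_nth:
  "(g has_vector_derivative g') F \<Longrightarrow> ((\<lambda>x. g x $ i) has_vector_derivative g' $ i) F"
  by (rule bounded_linear.has_vector_derivative[OF bounded_linear_vec_nth])

lemma has_vector_derivative_block_mat: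
  fixes P Q R S :: "real \<Rightarrow> 'a::euclidean_space^'n^'n::finite"
  assumes "(P has_vector_derivative P') (at x within X)" "(Q has_vector_derivative Q') (at x within X)"
    "(R has_vector_derivative R') (at x within X)" "(S has_vector_derivative S') (at x within X)"
  shows "((\<lambda>x. block_mat (P x) (Q x) (R x) (S x)) has_vector_derivative block_mat P' Q' R' S') (at x within X)"
proof (intro has_vector_derivative_vec)
  fix i j show "((\<lambda>x. block_mat (P x) (Q x) (R x) (S x) $ i $ j) has_vector_derivative block_mat P' Q' R' S' $ i $ j) (at x within X)"
    by (cases i; cases j) (use assms in \<open>auto intro!: has_vector_derivative_nth\<close>)
qed

lemma continuous_on_block_mat:
  fixes P Q R S :: "'b::topological_space \<Rightarrow> 'a::topological_space^'n^'n::finite"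
  assumes "continuous_on X P" "continuous_on X Q" "continuous_on X R" "continuous_on X S"
  shows "continuous_on X (\<lambda>x. block_mat (P x) (Q x) (R x) (S x))"
proof (intro continuous_on_vec)
  fix i j show "continuous_on X (\<lambda>x. block_mat (P x) (Q x) (R x) (S x) $ i $ j)"
    by (cases i; cases j) (use assms in \<open>auto intro!: continuous_intros\<close>)
qed

lemma bounded_linear_cmat: "bounded_linear (cmat :: real^'n^'m \<Rightarrow> complex^'n::finite^'m::finite)"
  unfolding linear_conv_bounded_linear[symmetric]
  by (rule linearI) (auto simp: vec_eq_iff map_matrix_nth complex_eq_iff)

lemmas has_vector_derivative_cmat = bounded_linear.has_vector_derivative[OF bounded_linear_cmat]
lemmas continuous_on_cmat = bounded_linear.continuous_on[OF bounded_linear_cmat]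

lemma cmat_mat: "cmat (mat c) = mat (complex_of_real c)"
  by (simp add: vec_eq_iff map_matrix_nth mat_def)

lemma cmat_diff: "cmat (M - N) = cmat M - cmat N" and cmat_0: "cmat 0 = 0"
  by (simp_all add: vec_eq_iff map_matrix_nth)

lemma cmat_block_mat: "cmat (block_mat P Q R S) = block_mat (cmat P) (cmat Q) (cmat R) (cmat S)"
  by (rule block_mat_eqI) (simp_all add: map_matrix_nth)

text \<open>Differentiates the identity M M^(-1) = 1; invertibility near x follows from continuity
  of the determinant.\<close>

lemma has_derivative_matrix_inv:
  fixes M :: "'a::real_normed_vector \<Rightarrow> real^'n^'n::finite"
  assumes M: "(M has_derivative M') (at x)" and inv: "invertible (M x)"
  shows "((\<lambda>y. matrix_inv (M y)) has_derivative (\<lambda>k. - (matrix_inv (M x) ** M' k ** matrix_inv (M x)))) (at x)"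
proof -
  have "((\<lambda>y. det (M y)) \<longlongrightarrow> det (M x)) (at x)"
    using has_derivative_continuous[OF M] by (intro tendsto_det tendsto_vec_nth) (simp add: isCont_def)
  then have "\<forall>\<^sub>F y in at x. det (M y) \<noteq> 0"
    using inv by (intro tendsto_imp_eventually_ne) (simp_all add: invertible_det_nz)
  then have ev: "\<forall>\<^sub>F y in nhds x. invertible (M y)"
    unfolding eventually_at_filter using inv by (auto elim!: eventually_mono simp: invertible_det_nz)
  interpret linear_solution "(**) :: real^'n^'n \<Rightarrow> real^'n^'n \<Rightarrow> real^'n^'n" M "\<lambda>_. mat 1" "\<lambda>y. matrix_inv (M y)" x
  proof (rule linear_solution.intro)
    show "bounded_bilinear ((**) :: real^'n^'n \<Rightarrow> real^'n^'n \<Rightarrow> real^'n^'n)" by (rule bounded_bilinear_matrix_matrix_mult)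
    show "v = 0" if "M x ** v = 0" for v :: "real^'n^'n"
    proof -
      have "matrix_inv (M x) ** (M x ** v) = 0" using that by simp
      then show ?thesis by (simp add: matrix_mul_assoc matrix_inv_cancel[OF inv])
    qed
    show "\<forall>\<^sub>F y in nhds x. M y ** matrix_inv (M y) = mat 1"
      using ev by eventually_elim (rule matrix_inv_cancel)
  qed
  obtain S' where S': "((\<lambda>y. matrix_inv (M y)) has_derivative S') (at x)"
    "\<And>k. M x ** S' k = - (M' k ** matrix_inv (M x))"
    using solution_has_derivative[OF M refl] by blast
  have "S' k = - (matrix_inv (M x) ** M' k ** matrix_inv (M x))" for k
  proof -
    have "matrix_inv (M x) ** (M x ** S' k) = matrix_inv (M x) ** - (M' k ** matrix_inv (M x))" by (simp add: S')
    then show ?thesis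
      by (simp add: matrix_mul_assoc matrix_inv_cancel[OF inv] bounded_bilinear.minus_right[OF bounded_bilinear_matrix_matrix_mult])
  qed
  then have "S' = (\<lambda>k. - (matrix_inv (M x) ** M' k ** matrix_inv (M x)))" by blast
  with S'(1) show ?thesis by simp
qed

lemma has_vector_derivative_matrix_inv:
  fixes M :: "real \<Rightarrow> real^'n^'n::finite"
  assumes M: "(M has_vector_derivative M') (at x)" and inv: "invertible (M x)"
  shows "((\<lambda>y. matrix_inv (M y)) has_vector_derivative - (matrix_inv (M x) ** M' ** matrix_inv (M x))) (at x)"
  unfolding has_vector_derivative_def
  by (rule has_derivative_eq_rhs[OF has_derivative_matrix_inv[OF M[unfolded has_vector_derivative_def] inv]])
    (simp add: fun_eq_iff bounded_bilinear.scaleR_left[OF bounded_bilinear_matrix_matrix_mult]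
      bounded_bilinear.scaleR_right[OF bounded_bilinear_matrix_matrix_mult])

text \<open>Multilinearity moves the divisor h of the difference quotient into column j, where it
  produces the derivative of that column because the column vanishes at 0. The other columns
  converge to their values.\<close>

lemma det_deriv_zero_column:
  fixes M :: "'a::real_normed_field \<Rightarrow> 'a^'m^'m::finite"
  assumes M: "\<And>i k. ((\<lambda>l. M l $ i $ k) has_field_derivative M' $ i $ k) (at 0)"
    and zero: "\<And>i. M 0 $ i $ j = 0"
  shows "((\<lambda>l. det (M l)) has_field_derivative det (\<chi> i k. if k = j then M' $ i $ j else M 0 $ i $ k)) (at 0)"
proof -
  let ?N = "\<lambda>h. \<chi> i k. if k = j then M h $ i $ j / h else M h $ i $ k"
  have "column j (M 0) = 0" by (simp add: column_def vec_eq_iff zero)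
  then have M0: "det (M 0) = 0" by (rule det_zero_column)
  have scale: "det (M h) = h * det (?N h)" if "h \<noteq> 0" for h
  proof -
    have "transpose (M h) = (\<chi> k. if k = j then h *s (\<chi> i. M h $ i $ j / h) else (\<chi> i. M h $ i $ k))"
      using that by (simp add: transpose_def vec_eq_iff)
    then have "det (transpose (M h)) = h * det (\<chi> k. if k = j then (\<chi> i. M h $ i $ j / h) else (\<chi> i. M h $ i $ k))"
      by (simp add: det_row_mul)
    also have "(\<chi> k. if k = j then (\<chi> i. M h $ i $ j / h) else (\<chi> i. M h $ i $ k)) = transpose (?N h)"
      by (simp add: transpose_def vec_eq_iff)
    finally show ?thesis by (simp only: det_transpose)
  qed
  have "((\<lambda>h. det (?N h)) \<longlongrightarrow> det (\<chi> i k. if k = j then M' $ i $ j else M 0 $ i $ k)) (at 0)"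
  proof (rule tendsto_det)
    fix i k
    have "(\<lambda>l. M l $ i $ k) \<midarrow>0\<rightarrow> M 0 $ i $ k" using DERIV_isCont[OF M] by (simp add: isCont_def)
    moreover have "(\<lambda>h. M h $ i $ j / h) \<midarrow>0\<rightarrow> M' $ i $ j" using M[of i j] by (simp add: DERIV_def zero)
    ultimately show "((\<lambda>h. ?N h $ i $ k) \<longlongrightarrow> (\<chi> i k. if k = j then M' $ i $ j else M 0 $ i $ k) $ i $ k) (at 0)" by simp
  qed
  then have "((\<lambda>h. det (M h) / h) \<longlongrightarrow> det (\<chi> i k. if k = j then M' $ i $ j else M 0 $ i $ k)) (at 0)"
    by (rule Lim_transform_eventually) (auto simp: eventually_at_filter scale)
  then show ?thesis by (simp add: DERIV_def M0)
qed

text \<open>In Leibniz's rule only the term with n derivatives on the power survives: fewer leave a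
  factor 0, and n + 1 annihilate the power. Its coefficient (n + 1) n! is (n + 1)!.\<close>

lemma higher_deriv_power_mult:
  assumes H: "H holomorphic_on UNIV" and H0: "H 0 = 0"
  shows "(deriv ^^ (n + 1)) (\<lambda>l. l ^ n * H l) 0 = fact (n + 1) * deriv H 0"
proof -
  have pow: "(deriv ^^ i) (\<lambda>w::complex. w ^ n) 0 = (if i = n then fact n else 0)" if "i \<le> n + 1" for i
  proof -
    have eq: "(deriv ^^ i) (\<lambda>w::complex. w ^ n) 0 = pochhammer (of_nat (Suc n - i)) i * 0 ^ (n - i)"
      using higher_deriv_power[of i 0 n 0] by simp
    from that consider "i < n" | "i = n" | "i = n + 1" by (metis Suc_eq_plus1 le_SucE nat_less_le)
    then show ?thesis
    proof cases
      case 1 then show ?thesis unfolding eq by simp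
    next
      case 2 then show ?thesis unfolding eq by (simp add: pochhammer_fact)
    next
      case 3 then show ?thesis unfolding eq by (simp add: pochhammer_0_left)
    qed
  qed
  have "(deriv ^^ (n + 1)) (\<lambda>l. l ^ n * H l) 0
      = (\<Sum>i = 0..n + 1. of_nat ((n + 1) choose i) * (deriv ^^ i) (\<lambda>w. w ^ n) 0 * (deriv ^^ (n + 1 - i)) H 0)"
    by (rule higher_deriv_mult[where S=UNIV]) (auto intro!: holomorphic_intros H)
  also have "\<dots> = (\<Sum>i = 0..n + 1. if i = n then of_nat ((n + 1) choose n) * fact n * deriv H 0 else 0)"
    by (rule sum.cong) (auto simp: pow)
  also have "\<dots> = fact (n + 1) * deriv H 0" by simp
  finally show ?thesis .
qed

text \<open>What the Evans function and the spectrum require of the profile: periodic coefficients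
  with continuous derivatives, and the spectral condition on B.\<close>

locale periodic_pencil =
  fixes Bx Ax Bx' Ax' :: "real \<Rightarrow> real^'n^'n::finite" and T :: real
  assumes T_pos: "0 < T"
    and Bx_deriv: "\<And>x. (Bx has_vector_derivative Bx' x) (at x)"
    and Ax_deriv: "\<And>x. (Ax has_vector_derivative Ax' x) (at x)"
    and Bx'_cont: "continuous_on UNIV Bx'" and Ax'_cont: "continuous_on UNIV Ax'"
    and Bx_per: "\<And>x. Bx (x + T) = Bx x" and Ax_per: "\<And>x. Ax (x + T) = Ax x"
    and spec: "\<And>x. spec_pos (Bx x)"
begin

definition Qx :: "real \<Rightarrow> real^'n^'n" where "Qx x = matrix_inv (Bx x)"

definition Px :: "real \<Rightarrow> real^'n^'n" where "Px x = Qx x ** Ax x"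

lemma Bx_inv: "invertible (Bx x)"
  using invertible_of_mat_spectrum spec unfolding spec_pos_def by blast

lemma Bx_Qx: "Bx x ** Qx x = mat 1" and Qx_Bx: "Qx x ** Bx x = mat 1"
  using matrix_inv_cancel[OF Bx_inv] by (auto simp: Qx_def)

lemma periodic_derivative:
  fixes g :: "real \<Rightarrow> 'b::real_normed_vector"
  assumes "\<And>x. (g has_vector_derivative g' x) (at x)" "\<And>x. g (x + T) = g x"
  shows "g' (x + T) = g' x"
proof -
  have "((\<lambda>y. g (y + T)) has_vector_derivative g' (x + T)) (at x)"
  proof -
    have "((\<lambda>y. y + T) has_vector_derivative 1) (at x)" by (auto intro!: derivative_eq_intros)
    from vector_diff_chain_at[OF this assms(1)] show ?thesis by (simp add: o_def)
  qed
  then have "(g has_vector_derivative g' (x + T)) (at x)" by (simp add: assms(2))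
  then show ?thesis using assms(1) vector_derivative_at by metis
qed

lemma Bx'_per: "Bx' (x + T) = Bx' x" and Ax'_per: "Ax' (x + T) = Ax' x"
  using periodic_derivative[OF Bx_deriv Bx_per] periodic_derivative[OF Ax_deriv Ax_per] by blast+

lemma Bx_cont: "continuous_on S Bx" and Ax_cont: "continuous_on S Ax"
  by (rule continuous_on_vector_derivative[OF has_vector_derivative_at_within], rule Bx_deriv Ax_deriv)+

lemma Qx_deriv: "(Qx has_vector_derivative - (Qx x ** Bx' x ** Qx x)) (at x)"
  unfolding Qx_def[abs_def] by (rule has_vector_derivative_matrix_inv[OF Bx_deriv Bx_inv])

lemma Qx_cont: "continuous_on S Qx"
  by (rule continuous_on_vector_derivative[OF has_vector_derivative_at_within[OF Qx_deriv]])

lemma Qx_per: "Qx (x + T) = Qx x" and Px_per: "Px (x + T) = Px x"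
  by (simp_all add: Px_def Qx_def Bx_per Ax_per)

lemma Px_cont: "continuous_on S Px"
  unfolding Px_def[abs_def] by (intro continuous_on_matrix_mult Qx_cont Ax_cont)

definition csys :: "complex \<Rightarrow> real \<Rightarrow> complex^('n + 'n)^('n + 'n)" where
  "csys l x = block_mat (cmat (Px x)) (cmat (Qx x)) (mat l) 0"

lemma csys_reg: "regular_coef (csys l)"
  by (rule regular_coef_periodic[OF _ T_pos])
    (auto simp: csys_def[abs_def] Qx_per Px_per intro!: continuous_on_block_mat continuous_on_cmat Px_cont Qx_cont)

definition ev_coef :: "complex \<Rightarrow> real \<Rightarrow> complex^('n + 'n)^('n + 'n)" where
  "ev_coef l x = block_mat 0 (mat 1) (cmat (Qx x) ** (mat l + cmat (Ax' x))) (cmat (Qx x ** (Ax x - Bx' x)))"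

lemma ev_coef_eq: "ev_coef = evans_coef Bx Ax"
  by (simp add: fun_eq_iff ev_coef_def evans_coef_def Qx_def vector_derivative_at[OF Bx_deriv] vector_derivative_at[OF Ax_deriv])

lemma ev_coef_reg: "regular_coef (ev_coef l)"
  by (rule regular_coef_periodic[OF _ T_pos])
    (auto simp: ev_coef_def[abs_def] Qx_per Ax_per Ax'_per Bx'_per
      intro!: continuous_on_block_mat continuous_on_cmat Qx_cont continuous_on_matrix_mult continuous_intros
        continuous_on_diff Ax_cont Ax'_cont Bx'_cont)

definition Phi :: "complex \<Rightarrow> real \<Rightarrow> complex^('n + 'n)^('n + 'n)" where
  "Phi l = fund_sol (csys l)"

definition conj_mat :: "real \<Rightarrow> complex^('n + 'n)^('n + 'n)" where
  "conj_mat x = block_mat (mat 1) 0 (- cmat (Ax x)) (cmat (Bx x))"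

lemma conj_mat_inv: "block_mat (mat 1) 0 (cmat (Px x)) (cmat (Qx x)) ** conj_mat x = mat 1"
proof -
  have "cmat (Qx x) ** cmat (Bx x) = mat 1" by (simp add: cmat_mult[symmetric] Qx_Bx cmat_mat)
  moreover have "cmat (Px x) + cmat (Qx x) ** - cmat (Ax x) = 0"
    by (simp add: Px_def cmat_mult bounded_bilinear.minus_right[OF bounded_bilinear_matrix_matrix_mult])
  ultimately show ?thesis by (simp add: conj_mat_def block_mat_mult block_mat_1)
qed

text \<open>Passing from \<open>(w, w')\<close> to \<open>(w, B w' - A w)\<close>.\<close>

lemma conj_mat_intertwines:
  "conj_mat x ** fund_sol (ev_coef l) x = Phi l x ** conj_mat 0"
proof -
  let ?\<Psi> = "fund_sol (ev_coef l)"
  define dC where "dC x = block_mat 0 0 (- cmat (Ax' x)) (cmat (Bx' x))" for x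
  have conj': "(conj_mat has_vector_derivative dC x) (at x)" for x
    unfolding conj_mat_def[abs_def] dC_def
    by (intro has_vector_derivative_block_mat has_vector_derivative_const has_vector_derivative_minus
        has_vector_derivative_cmat Ax_deriv Bx_deriv)
  have alg: "dC x + conj_mat x ** ev_coef l x = csys l x ** conj_mat x" for x
  proof -
    have BQ: "cmat (Bx x) ** (cmat (Qx x) ** M) = M" for M :: "complex^'n^'n"
      by (simp add: matrix_mul_assoc cmat_mult[symmetric] Bx_Qx cmat_mat)
    have QB: "cmat (Qx x) ** cmat (Bx x) = mat 1"
      by (simp add: cmat_mult[symmetric] Qx_Bx cmat_mat)
    have add: "block_mat P Q R S + block_mat P' Q' R' S' = block_mat (P + P') (Q + Q') (R + R') (S + S')"
      for P Q R S P' Q' R' S' :: "complex^'n^'n"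
      by (rule block_mat_eqI) simp_all
    have "dC x + conj_mat x ** ev_coef l x = block_mat 0 (mat 1) (mat l) 0"
      by (simp add: dC_def conj_mat_def ev_coef_def block_mat_mult add BQ cmat_mult cmat_diff)
    moreover have "csys l x ** conj_mat x = block_mat 0 (mat 1) (mat l) 0"
      by (simp add: csys_def conj_mat_def block_mat_mult QB Px_def cmat_mult
          bounded_bilinear.minus_right[OF bounded_bilinear_matrix_matrix_mult])
    ultimately show ?thesis by simp
  qed
  have "((\<lambda>x. conj_mat x ** ?\<Psi> x) has_vector_derivative csys l x ** (conj_mat x ** ?\<Psi> x)) (at x)" for x
    using has_vector_derivative_matrix_mult[OF conj' fund_sol_deriv[OF ev_coef_reg[of l]], of x]
    by (simp add: matrix_mul_assoc alg[symmetric] bounded_bilinear.add_left[OF bounded_bilinear_matrix_matrix_mult] add.commute)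
  from fund_sol_matrix[OF csys_reg this]
  show ?thesis by (simp add: fund_sol_0[OF ev_coef_reg] Phi_def)
qed

definition D :: "complex \<Rightarrow> complex" where "D l = det (Phi l T - mat 1)"

text \<open>The conjugating matrix takes equal values at 0 and T, so the two monodromy matrices are
  similar through \<open>conj_mat 0\<close>, and subtracting the identity respects this.\<close>

lemma evans_det_eq: "det (fundamental_solution (evans_coef Bx Ax l) T - mat 1) = D l"
proof -
  have fs: "fundamental_solution (evans_coef Bx Ax l) = fund_sol (ev_coef l)"
    by (simp add: fundamental_solution_def fund_sol_def ev_coef_eq)
  have "conj_mat T = conj_mat 0" using Ax_per[of 0] Bx_per[of 0] by (simp add: conj_mat_def)
  then have "conj_mat 0 ** (fund_sol (ev_coef l) T - mat 1) = (Phi l T - mat 1) ** conj_mat 0"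
    using conj_mat_intertwines[of T l] by (simp add: matrix_sub_ldistrib' matrix_sub_rdistrib')
  then have "det (conj_mat 0) * det (fund_sol (ev_coef l) T - mat 1) = D l * det (conj_mat 0)"
    unfolding D_def by (simp only: det_mul[symmetric])
  moreover have "det (conj_mat 0) \<noteq> 0"
    using arg_cong[OF conj_mat_inv[of 0], of det] by (auto simp: det_mul)
  ultimately show ?thesis by (simp add: fs)
qed

text \<open>\<open>Phi l T - mat 1\<close> with its lower rows divided by l. Writing these rows as
  integrals gives them a value at l = 0 too.\<close>

definition Hmat :: "complex \<Rightarrow> complex^('n + 'n)^('n + 'n)" where
  "Hmat l = (\<chi> i j. case i of Inl a \<Rightarrow> (Phi l T - mat 1) $ Inl a $ j
     | Inr a \<Rightarrow> integral {0..T} (\<lambda>x. Phi l x $ Inl a $ j))"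

lemma Phi_0: "Phi l 0 = mat 1" and Phi_deriv: "(Phi l has_vector_derivative csys l x ** Phi l x) (at x within S)"
  by (simp_all add: Phi_def fund_sol_0[OF csys_reg] fund_sol_deriv[OF csys_reg])

lemma csys_lower: "(csys l x ** M) $ Inr a $ j = l * M $ Inl a $ j"
  by (simp add: matrix_matrix_mult_def sum_UNIV_sum csys_def mat_def if_distrib[of "\<lambda>x. x * y" for y] cong: if_cong)

lemma Phi_lower: "(Phi l T - mat 1) $ Inr a $ j = l * integral {0..T} (\<lambda>x. Phi l x $ Inl a $ j)"
proof -
  have "((\<lambda>x. Phi l x $ Inr a $ j) has_vector_derivative l * Phi l x $ Inl a $ j) (at x within {0..T})" for x
    using has_vector_derivative_nth[OF has_vector_derivative_nth[OF Phi_deriv[of l x "{0..T}"]], of "Inr a" j]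
    by (simp add: csys_lower)
  then have "((\<lambda>x. l * Phi l x $ Inl a $ j) has_integral Phi l T $ Inr a $ j - Phi l 0 $ Inr a $ j) {0..T}"
    using T_pos by (intro fundamental_theorem_of_calculus) auto
  then have "integral {0..T} (\<lambda>x. l * Phi l x $ Inl a $ j) = Phi l T $ Inr a $ j - Phi l 0 $ Inr a $ j"
    by (rule integral_unique)
  then show ?thesis by (simp add: Phi_0)
qed

lemma D_factor: "D l = l ^ CARD('n) * det (Hmat l)"
proof -
  have "Phi l T - mat 1 = block_mat (mat 1) 0 0 (mat l) ** Hmat l"
  proof (simp only: vec_eq_iff, intro allI)
    fix i j show "(Phi l T - mat 1) $ i $ j = (block_mat (mat 1) 0 0 (mat l) ** Hmat l) $ i $ j"
    proof (cases i)
      case (Inl a)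
      then show ?thesis
        by (simp add: matrix_matrix_mult_def sum_UNIV_sum Hmat_def mat_def if_distrib[of "\<lambda>x. x * y" for y] cong: if_cong)
    next
      case (Inr a)
      have "(block_mat (mat 1) 0 0 (mat l) ** Hmat l) $ Inr a $ j = l * Hmat l $ Inr a $ j"
        by (simp add: matrix_matrix_mult_def sum_UNIV_sum mat_def if_distrib[of "\<lambda>x. x * y" for y] cong: if_cong)
      then show ?thesis unfolding Inr by (simp only: Phi_lower) (simp add: Hmat_def)
    qed
  qed
  then show ?thesis by (simp add: D_def det_mul det_block_Inr det_mat)
qed

lemma csys_affine: "csys l = (\<lambda>x. csys 0 x + mat l ** block_mat 0 0 (mat 1) 0)"
proof
  fix x show "csys l x = csys 0 x + mat l ** block_mat 0 0 (mat 1) 0"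
    by (rule block_mat_eqI; simp add: mat_mult_nth csys_def; simp add: mat_def)
qed

lemma Hmat_derivative:
  obtains Z where "Z 0 = 0" "\<And>x. (Z has_vector_derivative csys l x ** Z x + block_mat 0 0 (mat 1) 0 ** Phi l x) (at x)"
    "\<And>i j. ((\<lambda>l. Hmat l $ i $ j) has_field_derivative
        (case i of Inl a \<Rightarrow> Z T $ Inl a $ j | Inr a \<Rightarrow> integral {0..T} (\<lambda>x. Z x $ Inl a $ j))) (at l)"
proof -
  have "0 \<le> T" using T_pos by simp
  have aff: "fund_sol (\<lambda>x. csys 0 x + mat l ** block_mat 0 0 (mat 1) 0) = Phi l" for l
    by (simp only: Phi_def csys_affine[of l, symmetric])
  show ?thesis
  proof (rule fund_sol_parameter_derivative[OF csys_reg[of 0] regular_coef_const[of "block_mat 0 0 (mat 1) 0"] \<open>0 \<le> T\<close>, of l, unfolded aff])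
    fix Z
    assume Z: "Z 0 = 0"
    "\<And>x. (Z has_vector_derivative (csys 0 x + mat l ** block_mat 0 0 (mat 1) 0) ** Z x
        + block_mat 0 0 (mat 1) 0 ** Phi l x) (at x)"
    "\<And>i j. ((\<lambda>l. Phi l T $ i $ j) has_field_derivative Z T $ i $ j) (at l)"
    "\<And>i j. ((\<lambda>l. integral {0..T} (\<lambda>x. Phi l x $ i $ j)) has_field_derivative integral {0..T} (\<lambda>x. Z x $ i $ j)) (at l)"
  show ?thesis
  proof (rule that[of Z])
    show "Z 0 = 0" by (rule Z(1))
    show "(Z has_vector_derivative csys l x ** Z x + block_mat 0 0 (mat 1) 0 ** Phi l x) (at x)" for x
      using Z(2)[of x] by (simp add: csys_affine[of l, THEN fun_cong])
    show "((\<lambda>l. Hmat l $ i $ j) has_field_derivative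
        (case i of Inl a \<Rightarrow> Z T $ Inl a $ j | Inr a \<Rightarrow> integral {0..T} (\<lambda>x. Z x $ Inl a $ j))) (at l)" for i j
    proof (cases i)
      case (Inl a)
      then show ?thesis using DERIV_diff[OF Z(3)[of "Inl a" j] DERIV_const[of "mat 1 $ Inl a $ j"]] by (simp add: Hmat_def)
    next
      case (Inr a)
      then show ?thesis using Z(4)[of "Inl a" j] by (simp add: Hmat_def)
    qed
  qed
  qed
qed

lemma det_Hmat_holomorphic: "(\<lambda>l. det (Hmat l)) holomorphic_on UNIV"
  unfolding holomorphic_on_def
proof (intro ballI)
  fix l :: complex
  show "(\<lambda>l. det (Hmat l)) field_differentiable at l"
  proof (rule Hmat_derivative[of l])
    fix Z
    assume Z: "\<And>i j. ((\<lambda>l. Hmat l $ i $ j) has_field_derivative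
        (case i of Inl a \<Rightarrow> Z T $ Inl a $ j | Inr a \<Rightarrow> integral {0..T} (\<lambda>x. Z x $ Inl a $ j))) (at l)"
    show ?thesis
      by (rule det_field_differentiable) (use Z field_differentiable_def in blast)
  qed
qed

end

section \<open>Real parameters, the constant-coefficient model, and the derivative of H at
  zero\<close>

definition rsys :: "(real \<Rightarrow> real^'n^'n) \<Rightarrow> (real \<Rightarrow> real^'n^'n) \<Rightarrow> real \<Rightarrow> real \<Rightarrow> real^('n + 'n)^('n + 'n::finite)" where
  "rsys P Q l x = block_mat (P x) (Q x) (mat l) 0"

lemma matrix_inv_unique:
  fixes A B :: "'a::semiring_1^'n^'n::finite"
  assumes "A ** B = mat 1" "B ** A = mat 1"
  shows "matrix_inv A = B"
proof -
  have inv: "invertible A" using assms unfolding invertible_def by blast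
  have "matrix_inv A ** (A ** B) = matrix_inv A" by (simp add: assms)
  then show ?thesis by (simp add: matrix_mul_assoc matrix_inv_cancel[OF inv])
qed

lemma mat_mult_mat: "mat a ** mat b = mat (a * b)"
  for a b :: "'a::comm_ring_1"
  by (simp add: vec_eq_iff mat_mult_nth) (simp add: mat_def)

lemma det_block_scalar:
  fixes a b c d :: real
  assumes "a \<noteq> 0"
  shows "det (block_mat (mat a) (mat b) (mat c) (mat d) :: real^('n + 'n)^('n + 'n::finite)) = (a * d - b * c) ^ CARD('n)"
proof -
  have inv: "matrix_inv (mat a :: real^'n^'n) = mat (1 / a)"
    by (rule matrix_inv_unique) (simp_all add: mat_mult_mat assms)
  have "invertible (mat a :: real^'n^'n)" using assms by (simp add: invertible_det_nz det_mat)
  then have "det (block_mat (mat a) (mat b) (mat c) (mat d) :: real^('n + 'n)^('n + 'n::finite))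
      = a ^ CARD('n) * det (mat d - mat c ** mat (1 / a) ** mat b :: real^'n^'n)"
    by (simp add: det_block_schur inv det_mat)
  also have "mat d - mat c ** mat (1 / a) ** mat b = (mat (d - c * (1 / a) * b) :: real^'n^'n)"
    unfolding mat_mult_mat by (simp add: vec_eq_iff mat_def)
  also have "a ^ CARD('n) * det (mat (d - c * (1 / a) * b) :: real^'n^'n) = (a * (d - c * (1 / a) * b)) ^ CARD('n)"
    by (simp add: det_mat power_mult_distrib)
  also have "a * (d - c * (1 / a) * b) = a * d - b * c" using assms by (simp add: field_simps)
  finally show ?thesis .
qed

lemma has_vector_derivative_mat:
  assumes "(g has_vector_derivative g') (at x within S)"
  shows "((\<lambda>x. mat (g x) :: real^'n^'n::finite) has_vector_derivative mat g') (at x within S)"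
proof (intro has_vector_derivative_vec)
  fix i j :: 'n show "((\<lambda>x. (mat (g x) :: real^'n^'n) $ i $ j) has_vector_derivative mat g' $ i $ j) (at x within S)"
    using assms by (cases "i = j") (auto simp: mat_def)
qed

lemma fund_sol_rsys_constant:
  assumes k: "k > 0"
  shows "fund_sol (rsys (\<lambda>_. 0 :: real^'n^'n::finite) (\<lambda>_. mat 1) (k * k)) x
    = block_mat (mat (cosh (k * x))) (mat (sinh (k * x) / k)) (mat (k * sinh (k * x))) (mat (cosh (k * x)))"
proof -
  let ?Y = "\<lambda>x. block_mat (mat (cosh (k * x))) (mat (sinh (k * x) / k)) (mat (k * sinh (k * x))) (mat (cosh (k * x))) :: real^('n+'n)^('n+'n)"
  have "regular_coef (rsys (\<lambda>_. 0 :: real^'n^'n) (\<lambda>_. mat 1) (k * k))"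
    unfolding rsys_def[abs_def] by (rule regular_coef_const)
  then have Y: "?Y = fund_sol (rsys (\<lambda>_. 0 :: real^'n^'n) (\<lambda>_. mat 1) (k * k))"
  proof (rule fund_sol_unique)
    show "?Y 0 = mat 1" by (simp add: block_mat_1)
    fix x :: real
    have "(?Y has_vector_derivative block_mat (mat (k * sinh (k * x))) (mat (cosh (k * x))) (mat (k * (k * cosh (k * x)))) (mat (k * sinh (k * x)))) (at x)"
      using k by (intro has_vector_derivative_block_mat has_vector_derivative_mat)
        (auto intro!: derivative_eq_intros simp: has_real_derivative_iff_has_vector_derivative[symmetric])
    also have "block_mat (mat (k * sinh (k * x))) (mat (cosh (k * x))) (mat (k * (k * cosh (k * x)))) (mat (k * sinh (k * x)))
        = rsys (\<lambda>_. 0) (\<lambda>_. mat 1) (k * k) x ** ?Y x"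
      using k by (simp add: rsys_def block_mat_mult mat_mult_mat mult.assoc)
    finally show "(?Y has_vector_derivative rsys (\<lambda>_. 0) (\<lambda>_. mat 1) (k * k) x ** ?Y x) (at x)" .
  qed
  show ?thesis by (rule fun_cong[OF Y, symmetric])
qed

text \<open>Each of the n components contributes (cosh - 1)^2 - sinh^2 = -2 (cosh - 1), which is
  negative for T > 0; this is the origin of (-1)^n.\<close>

lemma sgn_det_constant:
  assumes l: "l > 0" and T: "T > 0"
  shows "sgn (det (fund_sol (rsys (\<lambda>_. 0 :: real^'n^'n::finite) (\<lambda>_. mat 1) l) T - mat 1)) = (-1) ^ CARD('n)"
proof -
  define k where "k = sqrt l"
  have k: "k > 0" "k * k = l" using l by (auto simp: k_def)
  let ?c = "cosh (k * T)" and ?s = "sinh (k * T)"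
  have c: "?c > 1"
  proof -
    have "?s > 0" using k T by simp
    then have "0 < ?s\<^sup>2" by (rule zero_less_power)
    then have "1 < ?c\<^sup>2" using hyperbolic_pythagoras[of "k * T"] by linarith
    then show ?thesis using power2_less_imp_less[of 1 ?c] cosh_real_nonneg[of "k * T"] by simp
  qed
  have "fund_sol (rsys (\<lambda>_. 0 :: real^'n^'n) (\<lambda>_. mat 1) l) T - mat 1
      = block_mat (mat (?c - 1)) (mat (?s / k)) (mat (k * ?s)) (mat (?c - 1))"
    unfolding k(2)[symmetric] fund_sol_rsys_constant[OF k(1)]
    by (rule block_mat_eqI) (auto simp: mat_def)
  then have "det (fund_sol (rsys (\<lambda>_. 0 :: real^'n^'n) (\<lambda>_. mat 1) l) T - mat 1)
      = ((?c - 1) * (?c - 1) - ?s / k * (k * ?s)) ^ CARD('n)"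
    by (simp only:) (rule det_block_scalar, use c in linarith)
  also have "(?c - 1) * (?c - 1) - ?s / k * (k * ?s) = - (2 * (?c - 1))"
    using hyperbolic_pythagoras[of "k * T"] k by (simp add: power2_eq_square algebra_simps)
  also have "(- (2 * (?c - 1))) ^ CARD('n) = (-1) ^ CARD('n) * (2 * (?c - 1)) ^ CARD('n)"
    by (rule power_minus)
  finally show ?thesis using c
    by (simp add: sgn_mult)
qed

text \<open>The constant is the minimum of the form over the compact product of the interval and the
  unit sphere.\<close>

lemma uniform_positive_form:
  fixes M :: "real \<Rightarrow> real^'n^'n::finite"
  assumes M: "continuous_on {a..b} M" and pos: "\<And>x v. x \<in> {a..b} \<Longrightarrow> v \<noteq> 0 \<Longrightarrow> v \<bullet> (M x *v v) > 0"
  obtains c where "c > 0" "\<And>x v. x \<in> {a..b} \<Longrightarrow> c * (norm v)\<^sup>2 \<le> v \<bullet> (M x *v v)"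
proof (cases "a \<le> b")
  case False
  then show ?thesis using that[of 1] by auto
next
  case True
  let ?K = "{a..b} \<times> sphere (0 :: real^'n) 1"
  have "continuous_on ?K (\<lambda>p. snd p \<bullet> (M (fst p) *v snd p))"
    by (intro continuous_intros continuous_on_matrix_vector_mult continuous_on_compose2[OF M]) auto
  moreover have "compact ?K" by (intro compact_Times) auto
  moreover have "(a, axis undefined 1) \<in> ?K" using True by auto
  ultimately obtain p where p: "p \<in> ?K" "\<And>q. q \<in> ?K \<Longrightarrow> snd p \<bullet> (M (fst p) *v snd p) \<le> snd q \<bullet> (M (fst q) *v snd q)"
    using continuous_attains_inf[of ?K "\<lambda>p. snd p \<bullet> (M (fst p) *v snd p)"] by (metis (no_types, lifting) empty_iff)
  show ?thesis
  proof (rule that[of "snd p \<bullet> (M (fst p) *v snd p)"])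
    have "fst p \<in> {a..b}" "snd p \<noteq> 0" using p(1) by auto
    then show "0 < snd p \<bullet> (M (fst p) *v snd p)" by (rule pos)
    fix x v assume x: "x \<in> {a..b}"
    show "snd p \<bullet> (M (fst p) *v snd p) * (norm v)\<^sup>2 \<le> v \<bullet> (M x *v v)"
    proof (cases "v = 0")
      case False
      then have "(x, (1 / norm v) *\<^sub>R v) \<in> ?K" using x by simp
      from p(2)[OF this] have "snd p \<bullet> (M (fst p) *v snd p) \<le> (v \<bullet> (M x *v v)) / (norm v)\<^sup>2"
        by (simp add: matrix_vector_mult_scaleR power2_eq_square)
      then show ?thesis using False by (simp add: pos_le_divide_eq)
    qed simp
  qed
qed

context periodic_pencil
begin

lemma rsys_reg: "regular_coef (rsys Px Qx l)"
  by (rule regular_coef_periodic[OF _ T_pos])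
    (auto simp: rsys_def[abs_def] Qx_per Px_per intro!: continuous_on_block_mat continuous_intros Px_cont Qx_cont)

lemma csys_of_real: "csys (of_real l) x = cmat (rsys Px Qx l x)"
  by (simp add: csys_def rsys_def cmat_block_mat cmat_mat cmat_0)

lemma Phi_of_real: "Phi (of_real l) x = cmat (fund_sol (rsys Px Qx l) x)"
proof -
  have "(\<lambda>x. cmat (fund_sol (rsys Px Qx l) x)) = fund_sol (csys (of_real l))"
  proof (rule fund_sol_unique[OF csys_reg])
    show "cmat (fund_sol (rsys Px Qx l) 0) = mat 1" by (simp add: fund_sol_0[OF rsys_reg] cmat_mat)
    show "((\<lambda>x. cmat (fund_sol (rsys Px Qx l) x)) has_vector_derivative csys (of_real l) x ** cmat (fund_sol (rsys Px Qx l) x)) (at x)" for x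
      using has_vector_derivative_cmat[OF fund_sol_deriv[OF rsys_reg]] by (simp add: csys_of_real cmat_mult)
  qed
  then show ?thesis by (simp add: Phi_def[symmetric] fun_eq_iff)
qed

definition Dr :: "real \<Rightarrow> real" where "Dr l = det (fund_sol (rsys Px Qx l) T - mat 1)"

lemma D_of_real: "D (of_real l) = of_real (Dr l)"
  by (simp add: D_def Dr_def Phi_of_real det_cmat[symmetric] cmat_diff cmat_mat)

text \<open>At l = 0 the variable y is constant, and \<open>W\<close> and \<open>V\<close> are the
  responses of w to its own initial value and to y. Column k of \<open>W\<close> is periodic with
  mean zero, as its primitive \<open>p\<close> returns to 0; hence column \<open>Inl k\<close> of
  \<open>Hmat 0\<close> vanishes. The pair (\<open>z\<close>, \<open>p\<close>) is the l-derivative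
  of the corresponding column of the fundamental matrix.\<close>

theorem det_Hmat_deriv_0:
  fixes W V :: "real \<Rightarrow> real^'n^'n" and z p :: "real \<Rightarrow> real^'n" and k :: 'n
  assumes W: "W 0 = mat 1" "\<And>x. (W has_vector_derivative Px x ** W x) (at x)"
    and V: "V 0 = 0" "\<And>x. (V has_vector_derivative Px x ** V x + Qx x) (at x)"
    and p: "p 0 = 0" "\<And>x. (p has_vector_derivative column k (W x)) (at x)"
    and z: "z 0 = 0" "\<And>x. (z has_vector_derivative Px x *v z x + Qx x *v p x) (at x)"
    and per: "column k (W T) = axis k 1" "p T = 0"
  shows "det (Hmat 0) = 0 \<and> ((\<lambda>l. det (Hmat l)) has_field_derivative of_real (det (block_mat
      (\<chi> a b. if b = k then z T $ a else (W T - mat 1) $ a $ b) (V T)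
      (\<chi> a b. if b = k then integral {0..T} (\<lambda>x. z x $ a) else integral {0..T} (\<lambda>x. W x $ a $ b))
      (\<chi> a b. integral {0..T} (\<lambda>x. V x $ a $ b))))) (at 0)"
proof -
  have Phi0: "Phi 0 x = cmat (block_mat (W x) (V x) 0 (mat 1))" for x
  proof -
    have "(\<lambda>x. cmat (block_mat (W x) (V x) 0 (mat 1))) = fund_sol (csys 0)"
    proof (rule fund_sol_unique[OF csys_reg])
      show "cmat (block_mat (W 0) (V 0) 0 (mat 1)) = mat 1" by (simp add: W V block_mat_1 cmat_mat)
      fix x
      have "((\<lambda>x. cmat (block_mat (W x) (V x) 0 (mat 1))) has_vector_derivative cmat (block_mat (Px x ** W x) (Px x ** V x + Qx x) 0 0)) (at x)"
        by (intro has_vector_derivative_cmat has_vector_derivative_block_mat W V has_vector_derivative_const)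
      also have "cmat (block_mat (Px x ** W x) (Px x ** V x + Qx x) 0 0) = csys 0 x ** cmat (block_mat (W x) (V x) 0 (mat 1))"
        using csys_of_real[of 0 x] by (simp add: rsys_def cmat_mult[symmetric] block_mat_mult)
      finally show "((\<lambda>x. cmat (block_mat (W x) (V x) 0 (mat 1))) has_vector_derivative csys 0 x ** cmat (block_mat (W x) (V x) 0 (mat 1))) (at x)" .
    qed
    then show ?thesis by (simp add: Phi_def[symmetric] fun_eq_iff)
  qed
  have cont: "continuous_on {0..T} W" "continuous_on {0..T} V" "continuous_on {0..T} z" "continuous_on {0..T} p"
    by (rule continuous_on_vector_derivative[OF has_vector_derivative_at_within], rule W V z p)+
  have int_of_real: "integral {0..T} (\<lambda>x. complex_of_real (g x)) = of_real (integral {0..T} g)"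
    if "continuous_on {0..T} g" for g
    using integral_linear[OF integrable_continuous_real[OF that] bounded_linear_of_real] by (simp add: o_def)
  have pint: "integral {0..T} (\<lambda>x. W x $ a $ k) = 0" for a
  proof -
    have "((\<lambda>x. p x $ a) has_vector_derivative W x $ a $ k) (at x within {0..T})" for x
      using has_vector_derivative_nth[OF has_vector_derivative_at_within[OF p(2)]] by (simp add: column_def)
    then have "((\<lambda>x. W x $ a $ k) has_integral p T $ a - p 0 $ a) {0..T}"
      using T_pos by (intro fundamental_theorem_of_calculus) auto
    then show ?thesis using per p by (simp add: integral_unique)
  qed
  have zero: "Hmat 0 $ i $ Inl k = 0" for i
  proof (cases i)
    case (Inl a)
    have "W T $ a $ k = (if a = k then 1 else 0)"
      using arg_cong[OF per(1), of "\<lambda>v. v $ a"] by (simp add: column_def axis_def eq_commute)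
    then show ?thesis by (simp add: Inl Hmat_def Phi0 map_matrix_nth mat_def)
  next
    case (Inr a)
    then show ?thesis using cont by (simp add: Hmat_def Phi0 map_matrix_nth int_of_real pint continuous_intros)
  qed
  show ?thesis
  proof (rule Hmat_derivative[of 0])
    fix Z
    assume Z: "Z 0 = 0" "\<And>x. (Z has_vector_derivative csys 0 x ** Z x + block_mat 0 0 (mat 1) 0 ** Phi 0 x) (at x)"
      and dH: "\<And>i j. ((\<lambda>l. Hmat l $ i $ j) has_field_derivative
        (case i of Inl a \<Rightarrow> Z T $ Inl a $ j | Inr a \<Rightarrow> integral {0..T} (\<lambda>x. Z x $ Inl a $ j))) (at 0)"
    \<comment> \<open>The pair (z, p) as one complex vector. It solves the equation of column
      \<open>Inl k\<close> of Z with the same source s and the same zero initial value, so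
      uniqueness identifies the two.\<close>
    define y :: "real \<Rightarrow> complex^('n + 'n)" where "y x = (\<chi> i. case i of Inl a \<Rightarrow> of_real (z x $ a) | Inr a \<Rightarrow> of_real (p x $ a) :: complex)" for x
    define s :: "real \<Rightarrow> complex^('n + 'n)" where "s x = (\<chi> i. case i of Inl a \<Rightarrow> 0 | Inr a \<Rightarrow> complex_of_real (W x $ a $ k))" for x
    have y': "(y has_vector_derivative csys 0 x *v y x + s x) (at x)" for x
    proof (rule has_vector_derivative_vec)
      fix i show "((\<lambda>x. y x $ i) has_vector_derivative (csys 0 x *v y x + s x) $ i) (at x)"
      proof (cases i)
        case (Inl a)
        have "((\<lambda>x. complex_of_real (z x $ a)) has_vector_derivative of_real ((Px x *v z x + Qx x *v p x) $ a)) (at x)"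
          by (intro bounded_linear.has_vector_derivative[OF bounded_linear_of_real] has_vector_derivative_nth[OF z(2)])
        then show ?thesis
          by (simp add: Inl y_def s_def csys_def matrix_vector_mult_def sum_UNIV_sum map_matrix_nth)
      next
        case (Inr a)
        have "((\<lambda>x. complex_of_real (p x $ a)) has_vector_derivative of_real (column k (W x) $ a)) (at x)"
          by (intro bounded_linear.has_vector_derivative[OF bounded_linear_of_real] has_vector_derivative_nth[OF p(2)])
        then show ?thesis
          by (simp add: Inr y_def s_def csys_def matrix_vector_mult_def sum_UNIV_sum column_def mat_def)
      qed
    qed
    have c': "((\<lambda>x. column (Inl k) (Z x)) has_vector_derivative csys 0 x *v column (Inl k) (Z x) + s x) (at x)" for x
    proof (rule has_vector_derivative_vec)
      fix i
      have "(block_mat 0 0 (mat 1) 0 ** Phi 0 x) $ i $ Inl k = s x $ i"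
        by (cases i) (simp_all add: s_def Phi0 map_matrix_nth matrix_matrix_mult_def sum_UNIV_sum mat_def if_distrib[of "\<lambda>x. x * y" for y] cong: if_cong)
      moreover have "((\<lambda>x. Z x $ i $ Inl k) has_vector_derivative (csys 0 x ** Z x + block_mat 0 0 (mat 1) 0 ** Phi 0 x) $ i $ Inl k) (at x)"
        by (intro has_vector_derivative_nth Z(2))
      ultimately show "((\<lambda>x. column (Inl k) (Z x) $ i) has_vector_derivative (csys 0 x *v column (Inl k) (Z x) + s x) $ i) (at x)"
        by (simp add: column_def matrix_vector_mult_def matrix_matrix_mult_def[of "csys 0 x"])
    qed
    have "(\<lambda>x. column (Inl k) (Z x) - y x) x = (\<lambda>_. 0) x" for x
    proof (rule vector_ode_unique[OF csys_reg[of 0]])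
      show "((\<lambda>x. column (Inl k) (Z x) - y x) has_vector_derivative csys 0 x *v (column (Inl k) (Z x) - y x)) (at x)" for x
        using has_vector_derivative_diff[OF c' y', of x] by (simp add: matrix_vector_mult_diff_distrib)
      show "((\<lambda>_. 0) has_vector_derivative csys 0 x *v 0) (at x)" for x by simp
      show "column (Inl k) (Z 0) - y 0 = 0"
        by (simp add: Z(1) y_def z p column_def vec_eq_iff split: sum.splits)
    qed
    then have Zy: "Z x $ i $ Inl k = y x $ i" for x i by (simp add: column_def vec_eq_iff)
    let ?X = "block_mat (\<chi> a b. if b = k then z T $ a else (W T - mat 1) $ a $ b) (V T)
      (\<chi> a b. if b = k then integral {0..T} (\<lambda>x. z x $ a) else integral {0..T} (\<lambda>x. W x $ a $ b))
      (\<chi> a b. integral {0..T} (\<lambda>x. V x $ a $ b))"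
    let ?M' = "\<chi> i j. case i of Inl a \<Rightarrow> Z T $ Inl a $ j | Inr a \<Rightarrow> integral {0..T} (\<lambda>x. Z x $ Inl a $ j)"
    have "((\<lambda>l. det (Hmat l)) has_field_derivative det (\<chi> i j. if j = Inl k then ?M' $ i $ Inl k else Hmat 0 $ i $ j)) (at 0)"
      by (rule det_deriv_zero_column) (use dH zero in auto)
    also have "(\<chi> i j. if j = Inl k then ?M' $ i $ Inl k else Hmat 0 $ i $ j) = cmat ?X"
      by (rule block_mat_eqI)
        (use cont in \<open>simp_all add: map_matrix_nth Hmat_def Zy y_def Phi0 int_of_real continuous_intros mat_def\<close>)
    finally have "((\<lambda>l. det (Hmat l)) has_field_derivative of_real (det ?X)) (at 0)" by (simp only: det_cmat)
    moreover have "det (Hmat 0) = 0"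
      by (rule det_zero_column[of "Inl k"]) (simp add: column_def vec_eq_iff zero)
    ultimately show ?thesis by blast
  qed
qed

lemma higher_deriv_D:
  assumes "det (Hmat 0) = 0" "((\<lambda>l. det (Hmat l)) has_field_derivative c) (at 0)"
  shows "(deriv ^^ (CARD('n) + 1)) D 0 = fact (CARD('n) + 1) * c"
proof -
  have "D = (\<lambda>l. l ^ CARD('n) * det (Hmat l))" using D_factor by blast
  then show ?thesis
    using higher_deriv_power_mult[OF det_Hmat_holomorphic, of "CARD('n)"] assms(1) DERIV_imp_deriv[OF assms(2)] by simp
qed

end

section \<open>Absence of periodic modes for large real parameters\<close>

context periodic_pencil
begin

definition Sx :: "real \<Rightarrow> real^'n^'n" where "Sx x = lyap_sol (Bx x)"

lemma Sx_linear_solution: "linear_solution lyap_op Bx (\<lambda>_. mat 1) Sx x"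
proof (rule linear_solution.intro)
  show "lyap_op (Bx x) v = 0 \<Longrightarrow> v = 0" for v by (rule lyap_op_inj[OF spec])
  show "\<forall>\<^sub>F y in nhds x. lyap_op (Bx y) (Sx y) = mat 1" by (simp add: Sx_def lyap_sol[OF spec])
qed (rule bounded_bilinear_lyap_op)

definition Sx' :: "real \<Rightarrow> real^'n^'n" where "Sx' x = vector_derivative Sx (at x)"

text \<open>Differentiating S B + B^T S = 1 gives a Lyapunov equation for S' as well.\<close>

lemma Sx_deriv: "(Sx has_vector_derivative Sx' x) (at x)"
  and Sx'_eq: "lyap_op (Bx x) (Sx' x) = - lyap_op (Bx' x) (Sx x)"
proof -
  interpret linear_solution lyap_op Bx "\<lambda>_. mat 1" Sx x by (rule Sx_linear_solution)
  obtain S' where S': "(Sx has_derivative S') (at x)" "\<And>k. lyap_op (Bx x) (S' k) = - lyap_op (k *\<^sub>R Bx' x) (Sx x)"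
    using solution_has_derivative[OF Bx_deriv[of x, unfolded has_vector_derivative_def] refl] by metis
  have "linear S'" using S'(1) has_derivative_linear by blast
  then have S'1: "(\<lambda>k. k *\<^sub>R S' 1) = S'"
    by (simp add: fun_eq_iff linear_scale[symmetric])
  have "(Sx has_vector_derivative S' 1) (at x)"
    unfolding has_vector_derivative_def S'1 by (rule S'(1))
  moreover from this have "Sx' x = S' 1" unfolding Sx'_def by (rule vector_derivative_at)
  ultimately show "(Sx has_vector_derivative Sx' x) (at x)" "lyap_op (Bx x) (Sx' x) = - lyap_op (Bx' x) (Sx x)"
    using S'(2)[of 1] by simp_all
qed

lemma Sx_cont: "continuous_on X Sx"
  by (rule continuous_on_vector_derivative[OF has_vector_derivative_at_within[OF Sx_deriv]])

lemma Sx_per: "Sx (x + T) = Sx x" by (simp add: Sx_def Bx_per)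

lemma Sx'_per: "Sx' (x + T) = Sx' x"
  by (rule periodic_derivative[OF Sx_deriv Sx_per])

text \<open>S' solves a Lyapunov equation whose coefficient and right side are continuous, so its
  continuity is again that of a solution of a linear equation.\<close>

lemma Sx'_cont: "continuous_on UNIV Sx'"
proof (rule continuous_at_imp_continuous_on, rule ballI)
  fix x
  interpret linear_solution lyap_op Bx "\<lambda>x. - lyap_op (Bx' x) (Sx x)" Sx' x
  proof (rule linear_solution.intro)
    show "lyap_op (Bx x) v = 0 \<Longrightarrow> v = 0" for v by (rule lyap_op_inj[OF spec])
  qed (simp_all add: Sx'_eq bounded_bilinear_lyap_op)
  show "isCont Sx' x"
  proof (rule isCont_solution)
    show "isCont Bx x" using Bx_cont[of UNIV] by (simp add: continuous_on_eq_continuous_at)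
    have "continuous_on UNIV (\<lambda>x. - lyap_op (Bx' x) (Sx x))"
      by (intro continuous_intros bounded_bilinear.continuous_on[OF bounded_bilinear_lyap_op] Bx'_cont Sx_cont)
    then show "isCont (\<lambda>x. - lyap_op (Bx' x) (Sx x)) x" by (simp add: continuous_on_eq_continuous_at)
  qed
qed

lemma Sx_sym_dot: "a \<bullet> (Sx x *v b) = b \<bullet> (Sx x *v a)"
  unfolding Sx_def by (metis dot_lmul_matrix inner_commute lyap_sol_sym[OF spec] transpose_matrix_vector)

lemma Sx_pos: "v \<noteq> 0 \<Longrightarrow> v \<bullet> (Sx x *v v) > 0"
  unfolding Sx_def by (rule lyap_sol_pos[OF spec])

text \<open>For u = Q v one has B u = v, so the form of S Q at v is S u paired with B u, which the
  Lyapunov equation evaluates to half the squared norm of u.\<close>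

lemma SQ_pos:
  assumes "v \<noteq> 0" shows "v \<bullet> ((Sx x ** Qx x) *v v) > 0"
proof -
  have BQ: "Bx x *v (Qx x *v v) = v" by (simp add: matrix_vector_mul_assoc Bx_Qx)
  have "Qx x *v v \<noteq> 0" using BQ assms by (metis matrix_vector_mult_0_right)
  moreover have "2 * ((Sx x *v (Qx x *v v)) \<bullet> v) = (Qx x *v v) \<bullet> (Qx x *v v)"
    using lyap_quadratic[OF spec, of x "Qx x *v v"] by (simp add: BQ Sx_def)
  ultimately have "(Sx x *v (Qx x *v v)) \<bullet> v > 0" by (metis inner_gt_zero_iff mult_pos_pos zero_less_mult_pos zero_less_numeral)
  then show ?thesis by (simp add: matrix_vector_mul_assoc[symmetric] inner_commute)
qed

text \<open>At \<theta> = 0 the given system, at \<theta> = 1 the model w' = y, y' = l w. The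
  inverse Q of B is deformed, rather than B, because the forms of S Q and of S are both positive:
  the same matrix field S then serves for every \<theta>.\<close>

definition hsys :: "real \<Rightarrow> real \<Rightarrow> real \<Rightarrow> real^('n + 'n)^('n + 'n)" where
  "hsys \<theta> l = rsys (\<lambda>x. (1 - \<theta>) *\<^sub>R Px x) (\<lambda>x. (1 - \<theta>) *\<^sub>R Qx x + \<theta> *\<^sub>R mat 1) l"

lemma hsys_reg: "regular_coef (hsys \<theta> l)"
  by (rule regular_coef_periodic[OF _ T_pos])
    (auto simp: hsys_def rsys_def[abs_def] Qx_per Px_per intro!: continuous_on_block_mat continuous_intros Px_cont Qx_cont)

lemma nonzero_solution_nonzero:
  fixes A :: "real \<Rightarrow> 'a::{real_normed_field,euclidean_space}^'m::finite^'m"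
  assumes A: "regular_coef A" and y: "\<And>x. (y has_vector_derivative A x *v y x) (at x)" and "y \<xi> = 0"
  shows "y x = 0"
proof -
  have "((\<lambda>x. y (x + \<xi>)) has_vector_derivative A (x + \<xi>) *v y (x + \<xi>)) (at x)" for x
  proof -
    have "((\<lambda>y. y + \<xi>) has_vector_derivative 1) (at x)" by (auto intro!: derivative_eq_intros)
    from vector_diff_chain_at[OF this y] show ?thesis by (simp add: o_def)
  qed
  moreover obtain K where "\<And>x Y. norm (A x *v Y) \<le> K * norm Y" using regular_vec_bound[OF A] by metis
  ultimately have "(\<lambda>x. y (x + \<xi>)) (x - \<xi>) = 0"
    by (rule ode_zero_uniqueness[where K=K, rotated]) (simp add: assms(3))
  then show ?thesis by simp
qed

text \<open>The quadratic form \<open>w \<bullet> S y\<close> is strictly increasing along nonzero solutions of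
  \<open>w' = P w + Q y\<close>, \<open>y' = l w\<close> when \<open>l\<close> is large, so none of them is periodic.\<close>

lemma no_periodic_solution:
  "\<exists>\<Lambda>. \<forall>l\<ge>\<Lambda>. \<forall>\<theta>\<in>{0..1}. det (fund_sol (hsys \<theta> l) T - mat 1) \<noteq> 0"
proof -
  obtain c1 where c1: "c1 > 0" "\<And>x v. x \<in> {0..T} \<Longrightarrow> c1 * (norm v)\<^sup>2 \<le> v \<bullet> (Sx x *v v)"
    using uniform_positive_form[of 0 T, OF Sx_cont Sx_pos] by blast
  obtain c2 where c2: "c2 > 0" "\<And>x v. x \<in> {0..T} \<Longrightarrow> c2 * (norm v)\<^sup>2 \<le> v \<bullet> ((Sx x ** Qx x) *v v)"
    using uniform_positive_form[of 0 T, OF continuous_on_matrix_mult[OF Sx_cont Qx_cont] SQ_pos] by blast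
  define c where "c = min c1 c2"
  have c: "c > 0" using c1 c2 by (simp add: c_def)
  have cS: "c * (norm v)\<^sup>2 \<le> v \<bullet> (Sx x *v v)" if "x \<in> {0..T}" for x v
    by (rule order_trans[OF mult_right_mono c1(2)[OF that]]) (auto simp: c_def)
  have cSQ: "c * (norm v)\<^sup>2 \<le> v \<bullet> (Sx x *v (Qx x *v v))" if "x \<in> {0..T}" for x v
    using order_trans[OF mult_right_mono c2(2)[OF that], of c v] by (auto simp: c_def matrix_vector_mul_assoc)
  have regs: "regular_coef Px" "regular_coef Sx" "regular_coef Sx'"
    by (rule regular_coef_periodic[OF _ T_pos], auto simp: Px_per Sx_per Sx'_per Px_cont Sx_cont Sx'_cont)+
  obtain KP where KP: "KP \<ge> 0" "\<And>x v. norm (Px x *v v) \<le> KP * norm v" using regular_vec_bound[OF regs(1)] by metis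
  obtain KS where KS: "KS \<ge> 0" "\<And>x v. norm (Sx x *v v) \<le> KS * norm v" using regular_vec_bound[OF regs(2)] by metis
  obtain KS' where KS': "KS' \<ge> 0" "\<And>x v. norm (Sx' x *v v) \<le> KS' * norm v" using regular_vec_bound[OF regs(3)] by metis
  define C where "C = KP * KS + KS'"
  have C: "C \<ge> 0" using KP KS KS' by (simp add: C_def)
  show ?thesis
  \<comment> \<open>C bounds the mixed terms in w and y, which stem from P and from the derivative
    of S. The part C^2/c^2 of the threshold absorbs them together with the y-term; the added 1
    leaves c times the squared norm of w.\<close>
  proof (intro exI[of _ "C\<^sup>2 / c\<^sup>2 + 1"] allI impI ballI notI)
    fix l \<theta> assume l: "C\<^sup>2 / c\<^sup>2 + 1 \<le> l" and \<theta>: "\<theta> \<in> {0..1}" and det: "det (fund_sol (hsys \<theta> l) T - mat 1) = 0"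
    then obtain v where v: "v \<noteq> 0" "(fund_sol (hsys \<theta> l) T - mat 1) *v v = 0"
      using invertible_det_nz[of "fund_sol (hsys \<theta> l) T - mat 1"]
      unfolding invertible_left_inverse matrix_left_invertible_ker by blast
    define Y where "Y x = fund_sol (hsys \<theta> l) x *v v" for x
    have Y': "(Y has_vector_derivative hsys \<theta> l x *v Y x) (at x)" for x
      unfolding Y_def by (rule fund_sol_vec_deriv[OF hsys_reg])
    have Y0: "Y 0 = v" by (simp add: Y_def fund_sol_0[OF hsys_reg])
    have YT: "Y T = Y 0" using v(2) unfolding Y0 by (simp add: Y_def matrix_vector_mult_diff_rdistrib)
    define w where "w x = (\<chi> a. Y x $ Inl a)" for x
    define y where "y x = (\<chi> a. Y x $ Inr a)" for x
    define P where "P x = (1 - \<theta>) *\<^sub>R Px x" for x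
    define Q where "Q x = (1 - \<theta>) *\<^sub>R Qx x + \<theta> *\<^sub>R mat 1" for x
    have w': "(w has_vector_derivative P x *v w x + Q x *v y x) (at x)" for x
    proof (rule has_vector_derivative_vec)
      fix i show "((\<lambda>x. w x $ i) has_vector_derivative (P x *v w x + Q x *v y x) $ i) (at x)"
        using has_vector_derivative_nth[OF Y', of "Inl i" x]
        by (simp add: w_def y_def P_def Q_def hsys_def rsys_def matrix_vector_mult_def sum_UNIV_sum)
    qed
    have y': "(y has_vector_derivative l *\<^sub>R w x) (at x)" for x
    proof (rule has_vector_derivative_vec)
      fix i show "((\<lambda>x. y x $ i) has_vector_derivative (l *\<^sub>R w x) $ i) (at x)"
        using has_vector_derivative_nth[OF Y', of "Inr i" x]
        by (simp add: w_def y_def hsys_def rsys_def matrix_vector_mult_def sum_UNIV_sum mat_def if_distrib[of "\<lambda>x. x * y" for y] cong: if_cong)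
    qed
    define \<phi> where "\<phi> x = w x \<bullet> (Sx x *v y x)" for x
    define \<phi>' where "\<phi>' x = (P x *v w x) \<bullet> (Sx x *v y x) + (Q x *v y x) \<bullet> (Sx x *v y x) + w x \<bullet> (Sx' x *v y x) + l * (w x \<bullet> (Sx x *v w x))" for x
    have \<phi>': "(\<phi> has_vector_derivative \<phi>' x) (at x)" for x
    proof -
      have "((\<lambda>x. Sx x *v y x) has_vector_derivative Sx x *v (l *\<^sub>R w x) + Sx' x *v y x) (at x)"
        by (rule has_vector_derivative_matrix_vector_mult[OF Sx_deriv y'])
      from bounded_bilinear.has_vector_derivative[OF bounded_bilinear_inner w' this]
      show ?thesis unfolding \<phi>_def[abs_def] \<phi>'_def
        by (rule has_vector_derivative_eq_rhs) (simp add: inner_add_left inner_add_right matrix_vector_mult_scaleR algebra_simps)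
    qed
    have lower: "\<phi>' x \<ge> c * (norm (w x))\<^sup>2 + (c * (norm (y x))\<^sup>2 - C * (norm (w x) * norm (y x)) + (C\<^sup>2 / c) * (norm (w x))\<^sup>2)"
      if x: "x \<in> {0..T}" for x
    proof -
      have 1: "(P x *v w x) \<bullet> (Sx x *v y x) \<ge> - (KP * KS * (norm (w x) * norm (y x)))"
      proof -
        have "\<bar>(P x *v w x) \<bullet> (Sx x *v y x)\<bar> \<le> norm (P x *v w x) * norm (Sx x *v y x)" by (rule Cauchy_Schwarz_ineq2)
        also have "\<dots> \<le> (KP * norm (w x)) * (KS * norm (y x))"
        proof (intro mult_mono KS)
          have "norm (P x *v w x) = (1 - \<theta>) * norm (Px x *v w x)"
            using \<theta> by (simp add: P_def scaleR_matrix_vector_assoc[symmetric])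
          also have "\<dots> \<le> 1 * norm (Px x *v w x)" using \<theta> by (intro mult_right_mono) auto
          finally show "norm (P x *v w x) \<le> KP * norm (w x)" using KP(2)[of x "w x"] by simp
        qed (use KP in auto)
        finally show ?thesis by (simp add: algebra_simps)
      qed
      have 2: "(Q x *v y x) \<bullet> (Sx x *v y x) \<ge> c * (norm (y x))\<^sup>2"
      proof -
        have "(Q x *v y x) \<bullet> (Sx x *v y x) = (1 - \<theta>) * (y x \<bullet> (Sx x *v (Qx x *v y x))) + \<theta> * (y x \<bullet> (Sx x *v y x))"
          by (simp add: Q_def matrix_vector_mult_add_rdistrib scaleR_matrix_vector_assoc[symmetric] inner_add_left Sx_sym_dot[of "Qx x *v y x"])
        also have "\<dots> \<ge> (1 - \<theta>) * (c * (norm (y x))\<^sup>2) + \<theta> * (c * (norm (y x))\<^sup>2)"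
          using \<theta> by (intro add_mono mult_left_mono cS[OF x] cSQ[OF x]) auto
        finally show ?thesis by (simp add: algebra_simps)
      qed
      have 3: "w x \<bullet> (Sx' x *v y x) \<ge> - (KS' * (norm (w x) * norm (y x)))"
      proof -
        have "\<bar>w x \<bullet> (Sx' x *v y x)\<bar> \<le> norm (w x) * norm (Sx' x *v y x)" by (rule Cauchy_Schwarz_ineq2)
        also have "\<dots> \<le> norm (w x) * (KS' * norm (y x))" by (intro mult_left_mono KS') auto
        finally show ?thesis by (simp add: algebra_simps)
      qed
      have 4: "l * (w x \<bullet> (Sx x *v w x)) \<ge> (C\<^sup>2 / c) * (norm (w x))\<^sup>2 + c * (norm (w x))\<^sup>2"
      proof -
        have "(C\<^sup>2 / c\<^sup>2 + 1) * (c * (norm (w x))\<^sup>2) \<le> l * (w x \<bullet> (Sx x *v w x))"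
          using c l by (intro mult_mono cS[OF x]) (auto intro: order_trans[OF _ l])
        then show ?thesis using c by (simp add: algebra_simps power2_eq_square)
      qed
      show ?thesis using 1 2 3 4 unfolding \<phi>'_def C_def by (simp add: algebra_simps)
    qed
    have quad: "0 \<le> c * b\<^sup>2 - C * (a * b) + (C\<^sup>2 / c) * a\<^sup>2" for a b :: real
    proof -
      have "c * b\<^sup>2 - C * (a * b) + (C\<^sup>2 / c) * a\<^sup>2 = c * (b - C * a / (2 * c))\<^sup>2 + 3 / 4 * (C\<^sup>2 / c) * a\<^sup>2"
        using c by (simp add: field_simps power2_eq_square)
      then show ?thesis using c by simp
    qed
    \<comment> \<open>A periodic solution gives equal values of \<phi> at both ends, so \<phi>'
      vanishes somewhere. There the lower bound forces w and then y to vanish, and by uniqueness the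
      whole solution.\<close>
    have "\<exists>\<xi>>0. \<xi> < T \<and> \<phi> T - \<phi> 0 = (T - 0) * \<phi>' \<xi>"
      using MVT2[OF T_pos, of \<phi> \<phi>'] \<phi>' by (auto simp: has_real_derivative_iff_has_vector_derivative)
    moreover have "\<phi> T = \<phi> 0" using Sx_per[of 0] YT by (simp add: \<phi>_def w_def y_def)
    ultimately have "\<exists>\<xi>\<in>{0..T}. \<phi>' \<xi> = 0" using T_pos by force
    then obtain \<xi> where \<xi>: "\<xi> \<in> {0..T}" "\<phi>' \<xi> = 0" by blast
    have "c * (norm (w \<xi>))\<^sup>2 \<le> 0" using lower[OF \<xi>(1)] quad[of "norm (y \<xi>)" "norm (w \<xi>)"] \<xi>(2) by simp
    then have w0: "w \<xi> = 0" using c by (simp add: mult_le_0_iff)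
    then have "c * (norm (y \<xi>))\<^sup>2 \<le> 0" using lower[OF \<xi>(1)] \<xi>(2) by simp
    then have y0: "y \<xi> = 0" using c by (simp add: mult_le_0_iff)
    have "Y \<xi> $ i = 0" for i
      using w0 y0 by (cases i) (auto simp: w_def y_def vec_eq_iff)
    then have "Y \<xi> = 0" by (simp add: vec_eq_iff)
    then have "Y 0 = 0" by (rule nonzero_solution_nonzero[OF hsys_reg Y'])
    then show False using v Y0 by simp
  qed
qed

lemma hsys_affine: "hsys \<theta> l = (\<lambda>x. rsys Px Qx l x + mat \<theta> ** block_mat (- Px x) (mat 1 - Qx x) 0 0)"
proof
  fix x show "hsys \<theta> l x = rsys Px Qx l x + mat \<theta> ** block_mat (- Px x) (mat 1 - Qx x) 0 0"
    by (rule block_mat_eqI) (simp_all add: mat_mult_nth hsys_def rsys_def algebra_simps)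
qed

text \<open>The coefficient is affine in \<theta>, so the parameter derivative theorem applies with
  \<theta> as a real parameter.\<close>

lemma hsys_det_cont: "isCont (\<lambda>\<theta>. det (fund_sol (hsys \<theta> l) T - mat 1)) \<theta>"
proof -
  have reg: "regular_coef (\<lambda>x. block_mat (- Px x) (mat 1 - Qx x) 0 0)"
    by (rule regular_coef_periodic[OF _ T_pos])
      (auto simp: Qx_per Px_per intro!: continuous_on_block_mat continuous_intros Px_cont Qx_cont)
  have "0 \<le> T" using T_pos by simp
  have aff: "fund_sol (\<lambda>x. rsys Px Qx l x + mat \<theta> ** block_mat (- Px x) (mat 1 - Qx x) 0 0) = fund_sol (hsys \<theta> l)" for \<theta>
    by (simp only: hsys_affine)
  show ?thesis
  proof (rule fund_sol_parameter_derivative[OF rsys_reg reg \<open>0 \<le> T\<close>, of l \<theta>, unfolded aff])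
    fix Z
    assume Z: "\<And>i j. ((\<lambda>\<theta>. fund_sol (hsys \<theta> l) T $ i $ j) has_field_derivative Z T $ i $ j) (at \<theta>)"
    show ?thesis
      unfolding isCont_def
    proof (rule tendsto_det)
      fix i j
      have "(\<lambda>\<theta>. fund_sol (hsys \<theta> l) T $ i $ j) \<midarrow>\<theta>\<rightarrow> fund_sol (hsys \<theta> l) T $ i $ j"
        using DERIV_isCont[OF Z] by (simp add: isCont_def)
      then show "(\<lambda>\<theta>. (fund_sol (hsys \<theta> l) T - mat 1) $ i $ j) \<midarrow>\<theta>\<rightarrow> (fund_sol (hsys \<theta> l) T - mat 1) $ i $ j"
        by (auto intro!: tendsto_intros)
    qed
  qed
qed

theorem sgn_Dr_large: "\<exists>\<Lambda>>0. \<forall>l\<ge>\<Lambda>. sgn (Dr l) = (-1) ^ CARD('n)"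
proof -
  obtain \<Lambda> where \<Lambda>: "\<And>l \<theta>. \<Lambda> \<le> l \<Longrightarrow> \<theta> \<in> {0..1} \<Longrightarrow> det (fund_sol (hsys \<theta> l) T - mat 1) \<noteq> 0"
    using no_periodic_solution by blast
  have "sgn (Dr l) = (-1) ^ CARD('n)" if l: "max \<Lambda> 1 \<le> l" for l
  proof -
    define g where "g \<theta> = det (fund_sol (hsys \<theta> l) T - mat 1)" for \<theta>
    have cont: "continuous_on {0..1} g"
      unfolding g_def by (rule continuous_at_imp_continuous_on) (simp add: hsys_det_cont)
    have nz: "g \<theta> \<noteq> 0" if "0 \<le> \<theta>" "\<theta> \<le> 1" for \<theta> using \<Lambda>[of l \<theta>] l that by (simp add: g_def)
    have "sgn (g 0) = sgn (g 1)"
    proof (rule ccontr)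
      assume "sgn (g 0) \<noteq> sgn (g 1)"
      then consider "g 0 < 0" "0 < g 1" | "0 < g 0" "g 1 < 0"
        using nz[of 0] nz[of 1] by (auto simp: sgn_if split: if_splits)
      then show False
      proof cases
        case 1
        then obtain \<theta> where "0 \<le> \<theta>" "\<theta> \<le> 1" "g \<theta> = 0" using IVT'[of g 0 0 1] cont by auto
        then show False using nz by blast
      next
        case 2
        then obtain \<theta> where "0 \<le> \<theta>" "\<theta> \<le> 1" "g \<theta> = 0" using IVT2'[of g 1 0 0] cont by auto
        then show False using nz by blast
      qed
    qed
    moreover have "g 0 = Dr l" by (simp add: g_def Dr_def hsys_def)
    moreover have "hsys 1 l = rsys (\<lambda>_. 0) (\<lambda>_. mat 1) l" by (simp add: hsys_def)
    then have "sgn (g 1) = (-1) ^ CARD('n)" using sgn_det_constant[of l T] l T_pos by (simp add: g_def)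
    ultimately show ?thesis by simp
  qed
  then show ?thesis by (intro exI[of _ "max \<Lambda> 1"]) auto
qed

end

section \<open>Periodic modes belong to the spectrum\<close>

lemma DERIV_max_power:
  "((\<lambda>s. max 0 s ^ (k + 2)) has_real_derivative real (k + 2) * max 0 s ^ (k + 1)) (at s)"
proof -
  consider "s < 0" | "s = 0" | "0 < s" by linarith
  then show ?thesis
  proof cases
    case 1
    have "((\<lambda>_. 0) has_real_derivative 0) (at s)" by simp
    then have "((\<lambda>s. max 0 s ^ (k + 2)) has_real_derivative 0) (at s)"
      by (rule has_field_derivative_transform_within_open[where S="{..<0}"]) (use 1 in auto)
    then show ?thesis using 1 by simp
  next
    case 2
    have "\<forall>\<^sub>F h in nhds 0. norm (max 0 h ^ (k + 2)) \<le> 1 * (norm (h - 0 :: real))\<^sup>2"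
      unfolding eventually_nhds_metric
    proof (intro exI[of _ 1] conjI allI impI)
      fix h :: real assume "dist h 0 < 1"
      then have "max 0 h ^ k \<le> 1" by (intro power_le_one) auto
      then have "max 0 h ^ k * (max 0 h)\<^sup>2 \<le> 1 * (max 0 h)\<^sup>2" by (intro mult_right_mono) auto
      also have "(max 0 h)\<^sup>2 \<le> h\<^sup>2" by (auto simp: max_def)
      finally show "norm (max 0 h ^ (k + 2)) \<le> 1 * (norm (h - 0))\<^sup>2"
        by (simp only: power_add) (simp add: abs_mult)
    qed simp
    from has_derivative_zero_if_quadratic[OF this] show ?thesis
      using 2 by (simp add: has_field_derivative_def lambda_zero[symmetric])
  next
    case 3
    have "((\<lambda>s. s ^ (k + 2)) has_real_derivative real (k + 2) * s ^ (k + 1)) (at s)"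
      using DERIV_pow[of "k + 2" s] by simp
    then have "((\<lambda>s. max 0 s ^ (k + 2)) has_real_derivative real (k + 2) * s ^ (k + 1)) (at s)"
      by (rule has_field_derivative_transform_within_open[where S="{0<..}"]) (use 3 in auto)
    then show ?thesis using 3 by simp
  qed
qed

text \<open>The cube is chosen because a cutoff has to preserve the domain of L: the third power of
  the positive part still has a continuous second derivative at the boundary of its support.\<close>

definition bump :: "real \<Rightarrow> real" where "bump t = max 0 (1 - t\<^sup>2) ^ 3"
definition bump' :: "real \<Rightarrow> real" where "bump' t = - 6 * t * max 0 (1 - t\<^sup>2) ^ 2"
definition bump'' :: "real \<Rightarrow> real" where
  "bump'' t = - 6 * max 0 (1 - t\<^sup>2) ^ 2 + 24 * t\<^sup>2 * max 0 (1 - t\<^sup>2)"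

lemma bump_deriv: "(bump has_real_derivative bump' t) (at t)"
proof -
  have "((\<lambda>t. 1 - t\<^sup>2) has_real_derivative - 2 * t) (at t)" by (auto intro!: derivative_eq_intros)
  from DERIV_chain2[OF DERIV_max_power[of 1] this] show ?thesis
    by (simp add: bump_def[abs_def] bump'_def numeral_3_eq_3 numeral_2_eq_2 algebra_simps)
qed

lemma bump'_deriv: "(bump' has_real_derivative bump'' t) (at t)"
proof -
  have "((\<lambda>t. 1 - t\<^sup>2) has_real_derivative - 2 * t) (at t)" by (auto intro!: derivative_eq_intros)
  from DERIV_chain2[OF DERIV_max_power[of 0] this]
  have "((\<lambda>t. max 0 (1 - t\<^sup>2) ^ 2) has_real_derivative - 4 * t * max 0 (1 - t\<^sup>2)) (at t)"
    by (simp add: power2_eq_square algebra_simps)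
  from DERIV_mult[OF DERIV_cmult[OF DERIV_ident, of "-6" t] this] show ?thesis
    by (simp add: bump'_def[abs_def] bump''_def power2_eq_square algebra_simps)
qed

lemma bump_zero: "\<bar>t\<bar> \<ge> 1 \<Longrightarrow> bump t = 0" "\<bar>t\<bar> \<ge> 1 \<Longrightarrow> bump' t = 0" "\<bar>t\<bar> \<ge> 1 \<Longrightarrow> bump'' t = 0"
  using abs_le_square_iff[of 1 t] by (auto simp: bump_def bump'_def bump''_def)

lemma bump'_bound: "\<bar>bump' t\<bar> \<le> 6" and bump''_bound: "\<bar>bump'' t\<bar> \<le> 30"
proof -
  show "\<bar>bump' t\<bar> \<le> 6"
  proof (cases "\<bar>t\<bar> \<ge> 1")
    case False
    have "max 0 (1 - t\<^sup>2) ^ 2 \<le> 1" by (intro power_le_one) auto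
    then have "\<bar>t\<bar> * max 0 (1 - t\<^sup>2) ^ 2 \<le> 1 * 1" using False by (intro mult_mono) auto
    then show ?thesis by (simp add: bump'_def abs_mult)
  qed (simp add: bump_zero)
  show "\<bar>bump'' t\<bar> \<le> 30"
  proof (cases "\<bar>t\<bar> \<ge> 1")
    case False
    have 1: "max 0 (1 - t\<^sup>2) ^ 2 \<le> 1" by (rule power_le_one) auto
    have "t\<^sup>2 \<le> 1" using False abs_square_le_1[of t] by linarith
    then have 2: "t\<^sup>2 * max 0 (1 - t\<^sup>2) \<le> 1 * 1" by (rule mult_mono) (auto simp: max_def)
    have 3: "0 \<le> t\<^sup>2 * max 0 (1 - t\<^sup>2)" "0 \<le> max 0 (1 - t\<^sup>2) ^ 2" by (simp_all add: max_def)
    have "bump'' t = - 6 * max 0 (1 - t\<^sup>2) ^ 2 + 24 * (t\<^sup>2 * max 0 (1 - t\<^sup>2))"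
      by (simp add: bump''_def mult.assoc)
    then show ?thesis using 1 2 3 by linarith
  qed (simp add: bump_zero)
qed

text \<open>The value at 1/2 is (3/4)^3 = 27/64.\<close>

lemma bump_ge: "\<bar>t\<bar> \<le> 1 / 2 \<Longrightarrow> 27 / 64 \<le> bump t"
proof -
  assume "\<bar>t\<bar> \<le> 1 / 2"
  then have "\<bar>t\<bar>\<^sup>2 \<le> (1 / 2)\<^sup>2" by (intro power_mono) auto
  then have "t\<^sup>2 \<le> 1 / 4" by (simp add: power_divide)
  then have "3 / 4 \<le> max 0 (1 - t\<^sup>2)" by linarith
  then have "(3 / 4) ^ 3 \<le> max 0 (1 - t\<^sup>2) ^ 3" by (rule power_mono) simp
  then show ?thesis by (simp add: bump_def power3_eq_cube)
qed

lemma bump_cont: "continuous_on S bump" "continuous_on S bump'" "continuous_on S bump''"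
  unfolding bump_def[abs_def] bump'_def[abs_def] bump''_def[abs_def] by (intro continuous_intros)+

lemma ac_deriv_C1:
  assumes "\<And>x. (v has_vector_derivative w x) (at x)" "continuous_on UNIV w"
  shows "ac_deriv v w"
  unfolding ac_deriv_def
proof (intro allI impI conjI)
  fix a b :: real assume "a \<le> b"
  have w: "continuous_on {a..b} w" using assms(2) continuous_on_subset by blast
  show "set_integrable lborel {a..b} w" by (rule borel_integrable_atLeastAtMost'[OF w])
  show "(LINT x:{a..b}|lborel. w x) = v b - v a"
    unfolding set_lebesgue_integral_def
    by (rule integral_FTC_atLeastAtMost[OF \<open>a \<le> b\<close> _ w]) (rule has_vector_derivative_at_within[OF assms(1)])
qed

lemma powr_norm_cont:
  assumes "continuous_on S v" "0 < q" shows "continuous_on S (\<lambda>x. norm (v x) powr q)"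
  using assms by (intro continuous_on_powr' continuous_intros) auto

lemma Lp_compact_support:
  fixes v :: "real \<Rightarrow> 'a::euclidean_space"
  assumes v: "continuous_on UNIV v" and supp: "\<And>x. N < \<bar>x\<bar> \<Longrightarrow> v x = 0" and p: "1 \<le> p" "p \<noteq> \<infinity>"
  shows "Lp p v"
proof -
  have q: "1 \<le> enn2real p" using p by (cases p) (auto simp: ennreal_le_iff2 simp flip: ennreal_1)
  have "set_integrable lborel {-N..N} (\<lambda>x. norm (v x) powr enn2real p)"
    using q by (intro borel_integrable_atLeastAtMost' powr_norm_cont continuous_on_subset[OF v]) auto
  moreover have "(\<lambda>x. indicator {-N..N} x *\<^sub>R (norm (v x) powr enn2real p)) = (\<lambda>x. norm (v x) powr enn2real p)"
  proof
    show "indicator {-N..N} x *\<^sub>R (norm (v x) powr enn2real p) = norm (v x) powr enn2real p" for x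
      using supp[of x] q by (cases "x \<in> {-N..N}") auto
  qed
  ultimately have "integrable lborel (\<lambda>x. norm (v x) powr enn2real p)"
    by (simp only: set_integrable_def)
  moreover have "v \<in> borel_measurable lborel" using borel_measurable_continuous_onI[OF v] by simp
  ultimately show ?thesis using p by (simp add: Lp_def)
qed

lemma Lp_infinity_bounded:
  fixes v :: "real \<Rightarrow> 'a::euclidean_space"
  assumes v: "continuous_on UNIV v" and bd: "\<And>x. norm (v x) \<le> C"
  shows "Lp \<infinity> v"
proof -
  have meas: "v \<in> borel_measurable lborel" using borel_measurable_continuous_onI[OF v] by simp
  have "esssup lborel (\<lambda>x. ennreal (norm (v x))) \<le> ennreal C"
    using meas bd by (intro esssup_I) (auto intro!: ennreal_leI)
  also have "\<dots> < \<infinity>" by simp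
  finally show ?thesis using meas by (simp add: Lp_def)
qed

lemma integral_periodic:
  fixes g :: "real \<Rightarrow> real"
  assumes g: "continuous_on UNIV g" and per: "\<And>x. g (x + T) = g x" and T: "0 \<le> T"
  shows "integral {0..real k * T} g = real k * integral {0..T} g"
proof (induction k)
  case (Suc k)
  have int: "g integrable_on {a..b}" for a b
    using g by (intro integrable_continuous_real continuous_on_subset[OF g]) auto
  have per': "g (x + real k * T) = g x" for x
    by (induction k) (auto simp: algebra_simps per[symmetric, of "x + _"] per simp flip: add.assoc)
  have "integral {real k * T..real (Suc k) * T} g = integral {0..T} (\<lambda>x. g (x + real k * T))"
    using integral_shift_real_ivl[of "real k * T" "real k * T" "real (Suc k) * T" g] by (simp add: algebra_simps)
  also have "\<dots> = integral {0..T} g" by (simp add: per')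
  finally show ?case
    using Henstock_Kurzweil_Integration.integral_combine[of 0 "real k * T" "real (Suc k) * T" g] int Suc T
    by (simp add: algebra_simps)
qed simp

context periodic_pencil
begin

text \<open>A periodic solution of \<open>L w = l w\<close> is an eigenfunction for \<open>p = \<infinity>\<close>; for finite \<open>p\<close> it is
  turned into approximate eigenfunctions by slowly varying cutoffs.\<close>

theorem periodic_mode_in_spectrum:
  fixes w w1 w2 y :: "real \<Rightarrow> complex^'n"
  assumes p: "1 \<le> p"
    and w: "\<And>x. (w has_vector_derivative w1 x) (at x)" and w1: "\<And>x. (w1 has_vector_derivative w2 x) (at x)"
    and w2: "continuous_on UNIV w2"
    and per: "\<And>x. w (x + T) = w x"
    and y: "\<And>x. y x = cmat (Bx x) *v w1 x - cmat (Ax x) *v w x"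
    and y': "\<And>x. (y has_vector_derivative l *s w x) (at x)"
    and nz: "\<xi> \<in> {0..T}" "w \<xi> \<noteq> 0"
  shows "l \<in> L_spectrum Bx Ax p"
proof (rule ccontr)
  assume "l \<notin> L_spectrum Bx Ax p"
  then have res: "l \<in> L_resolvent_set Bx Ax p" by (simp add: L_spectrum_def)
  then have uniq: "\<And>h. Lp p h \<Longrightarrow> \<exists>!v. L_graph Bx Ax p v (\<lambda>x. h x + l *s v x)"
    and "\<exists>C. \<forall>h v. Lp p h \<and> L_graph Bx Ax p v (\<lambda>x. h x + l *s v x) \<longrightarrow> Lp_norm p v \<le> C * Lp_norm p h"
    unfolding L_resolvent_set_def mem_Collect_eq by simp_all
  then obtain C0 where C0: "\<And>h v. Lp p h \<Longrightarrow> L_graph Bx Ax p v (\<lambda>x. h x + l *s v x) \<Longrightarrow> Lp_norm p v \<le> C0 * Lp_norm p h"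
    by blast
  have cont: "continuous_on UNIV w" "continuous_on UNIV w1" "continuous_on UNIV y"
    by (rule continuous_on_vector_derivative[OF has_vector_derivative_at_within], rule w w1 y')+
  have bl_s: "bounded_linear (\<lambda>v::complex^'n. l *s v)"
    unfolding linear_conv_bounded_linear[symmetric]
    by (rule linearI) (auto simp: vec_eq_iff algebra_simps)
  have w1_per: "w1 (x + T) = w1 x" for x by (rule periodic_derivative[OF w per])
  have w2_per: "w2 (x + T) = w2 x" for x by (rule periodic_derivative[OF w1 w1_per])
  have y_per: "y (x + T) = y x" for x by (simp add: y per w1_per Bx_per Ax_per)
  show False
  proof (cases "p = \<infinity>")
    case True
    have bd: "Lp \<infinity> g" if "continuous_on UNIV g" "\<And>x. g (x + T) = g x" for g :: "real \<Rightarrow> complex^'n"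
      using regular_coef_norm_le[OF regular_coef_periodic[OF that(1) T_pos that(2)]] Lp_infinity_bounded[OF that(1)] by metis
    have lw: "continuous_on UNIV (\<lambda>x. l *s w x)" by (rule bounded_linear.continuous_on[OF bl_s cont(1)])
    have "L_graph Bx Ax p w (\<lambda>x. 0 + l *s w x)"
      unfolding L_graph_def True
      using bd[OF cont(1) per] bd[OF cont(2) w1_per] bd[OF w2 w2_per] bd[OF lw] per
        ac_deriv_C1[OF w cont(2)] ac_deriv_C1[OF w1 w2] ac_deriv_C1[OF y' lw] y
      by (intro conjI exI[of _ w1] exI[of _ w2]) (auto simp flip: y)
    moreover have "L_graph Bx Ax p (\<lambda>_. 0) (\<lambda>x. 0 + l *s 0)"
    proof -
      have z: "Lp \<infinity> (\<lambda>_::real. 0 :: complex^'n)" by (rule bd) auto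
      have "ac_deriv (\<lambda>_. 0 :: complex^'n) (\<lambda>_. 0)" by (rule ac_deriv_C1) auto
      then show ?thesis unfolding L_graph_def True using z by (auto intro!: exI[of _ "\<lambda>_. 0"])
    qed
    moreover have "Lp p (\<lambda>_::real. 0 :: complex^'n)" unfolding True by (rule bd) auto
    ultimately have "w = (\<lambda>_. 0)" using uniq[of "\<lambda>_. 0"] by blast
    then show False using nz by simp
  next
    case False
    define q where "q = enn2real p"
    have q: "1 \<le> q" using p False unfolding q_def by (cases p) (auto simp: ennreal_le_iff2 simp flip: ennreal_1)
    \<comment> \<open>These are the coefficients of the commutator of L with the cutoff: (L - l)
      applied to c0 w is c1 r1 + c2 r2, where c1 and c2 are the derivatives of c0. Here
      \<open>r1\<close> is y + (B w)' and \<open>r2\<close> is B w.\<close>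
    define r1 where "r1 x = y x + (cmat (Bx x) *v w1 x + cmat (Bx' x) *v w x)" for x
    define r2 where "r2 x = cmat (Bx x) *v w x" for x
    have Bw': "(r2 has_vector_derivative cmat (Bx x) *v w1 x + cmat (Bx' x) *v w x) (at x)" for x
      unfolding r2_def[abs_def]
      by (rule has_vector_derivative_matrix_vector_mult[OF has_vector_derivative_cmat[OF Bx_deriv] w])
    have r_cont: "continuous_on UNIV r1" "continuous_on UNIV r2"
      unfolding r1_def[abs_def] r2_def[abs_def]
      by (intro continuous_intros continuous_on_matrix_vector_mult continuous_on_cmat cont Bx_cont Bx'_cont)+
    have "regular_coef r1" "regular_coef r2"
      by (rule regular_coef_periodic[OF _ T_pos], rule r_cont, simp add: r1_def r2_def y_per per w1_per Bx_per Bx'_per)+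
    then obtain M1 M2 where M12: "\<And>x. norm (r1 x) \<le> M1" "\<And>x. norm (r2 x) \<le> M2" using regular_coef_norm_le by metis
    define M where "M = max (max M1 M2) 1"
    have M: "\<And>x. norm (r1 x) \<le> M" "\<And>x. norm (r2 x) \<le> M" "0 < M"
      unfolding M_def using M12 by (meson max.coboundedI1 max.coboundedI2)+ (simp add: less_max_iff_disj)
    define G where "G x = norm (w x) powr q" for x
    have G_cont: "continuous_on S G" for S
      unfolding G_def using q by (intro powr_norm_cont continuous_on_subset[OF cont(1)]) auto
    define I where "I = integral {0..T} G"
    have "0 < I"
    proof -
      have "I \<noteq> 0"
        unfolding I_def using integral_eq_0_iff[OF G_cont T_pos] nz by (auto simp: G_def)
      moreover have "0 \<le> I" unfolding I_def by (intro integral_nonneg integrable_continuous_real G_cont) (auto simp: G_def)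
      ultimately show ?thesis by simp
    qed
    have main: "(27 / 64) powr q * (real k * I) \<le> \<bar>C0\<bar> powr q * (4 * real k * T * (18 * M / (real k * T)) powr q)"
      if k: "0 < k" "1 \<le> 2 * real k * T" for k
    proof -
      \<comment> \<open>The cutoff lives on [-N, N], and the k periods in [0, k T] fill the range
        where it is at least 27/64. So the q-th power of the norm of v grows at least like k, while
        h is of size 1/N on a set of length 2 N. Since 1 \<le> q, the corresponding power for h
        stays bounded.\<close>
      define N where "N = 2 * real k * T"
      have N: "1 \<le> N" using k by (simp add: N_def)
      define c0 where "c0 x = bump (x / N)" for x
      define c1 where "c1 x = bump' (x / N) / N" for x
      define c2 where "c2 x = bump'' (x / N) / N\<^sup>2" for x
      have dN: "((\<lambda>x. x / N) has_real_derivative 1 / N) (at x)" for x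
        by (rule DERIV_cdivide[OF DERIV_ident])
      have dc0: "(c0 has_real_derivative c1 x) (at x)" for x
        unfolding c0_def[abs_def] c1_def
        using DERIV_chain2[OF bump_deriv dN] by simp
      have dc1: "(c1 has_real_derivative c2 x) (at x)" for x
        unfolding c1_def[abs_def] c2_def
        using DERIV_chain2[OF bump'_deriv dN]
        by (rule DERIV_cdivide[THEN DERIV_cong]) (simp add: power2_eq_square)
      have c_cont: "continuous_on UNIV c0" "continuous_on UNIV c1" "continuous_on UNIV c2"
        unfolding c0_def[abs_def] c1_def[abs_def] c2_def[abs_def] using N
        by (intro continuous_intros continuous_on_compose2[OF bump_cont(1)[of UNIV]]
            continuous_on_compose2[OF bump_cont(2)[of UNIV]] continuous_on_compose2[OF bump_cont(3)[of UNIV]]; simp)+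
      have c_zero: "c0 x = 0" "c1 x = 0" "c2 x = 0" if "N < \<bar>x\<bar>" for x
      proof -
        have "1 \<le> \<bar>x / N\<bar>" using that N by (simp add: abs_divide)
        then show "c0 x = 0" "c1 x = 0" "c2 x = 0" by (simp_all add: c0_def c1_def c2_def bump_zero)
      qed
      define v where "v x = c0 x *\<^sub>R w x" for x
      define v1 where "v1 x = c0 x *\<^sub>R w1 x + c1 x *\<^sub>R w x" for x
      define v2 where "v2 x = (c0 x *\<^sub>R w2 x + c1 x *\<^sub>R w1 x) + (c1 x *\<^sub>R w1 x + c2 x *\<^sub>R w x)" for x
      define h where "h x = c1 x *\<^sub>R r1 x + c2 x *\<^sub>R r2 x" for x
      have v': "(v has_vector_derivative v1 x) (at x)" for x
        unfolding v_def[abs_def] v1_def by (rule has_vector_derivative_scaleR[OF dc0 w])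
      have v1': "(v1 has_vector_derivative v2 x) (at x)" for x
        unfolding v1_def[abs_def] v2_def
        by (intro has_vector_derivative_add has_vector_derivative_scaleR dc0 dc1 w w1)
      have flux: "cmat (Bx x) *v v1 x - cmat (Ax x) *v v x = c0 x *\<^sub>R y x + c1 x *\<^sub>R r2 x" for x
        by (simp add: v_def v1_def y r2_def algebra_simps
            bounded_bilinear.add_right[OF bounded_bilinear_matrix_vector_mult']
            bounded_bilinear.scaleR_right[OF bounded_bilinear_matrix_vector_mult'])
      have lscale: "l *s (c *\<^sub>R u) = c *\<^sub>R (l *s u)" for c and u :: "complex^'n"
        by (simp add: vec_eq_iff)
      have flux': "((\<lambda>x. cmat (Bx x) *v v1 x - cmat (Ax x) *v v x) has_vector_derivative h x + l *s v x) (at x)" for x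
      proof -
        have "((\<lambda>x. c0 x *\<^sub>R y x + c1 x *\<^sub>R r2 x) has_vector_derivative
          (c0 x *\<^sub>R (l *s w x) + c1 x *\<^sub>R y x) + (c1 x *\<^sub>R (cmat (Bx x) *v w1 x + cmat (Bx' x) *v w x) + c2 x *\<^sub>R r2 x)) (at x)"
          by (intro has_vector_derivative_add has_vector_derivative_scaleR dc0 dc1 y' Bw')
        then show ?thesis unfolding flux
          by (rule has_vector_derivative_eq_rhs) (simp add: h_def r1_def v_def lscale scaleR_add_right)
      qed
      have contv: "continuous_on UNIV v" "continuous_on UNIV v1" "continuous_on UNIV v2" "continuous_on UNIV h"
        unfolding v_def[abs_def] v1_def[abs_def] v2_def[abs_def] h_def[abs_def]
        by (intro continuous_intros c_cont cont w2 r_cont)+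
      have contg: "continuous_on UNIV (\<lambda>x. h x + l *s v x)"
        by (intro continuous_intros contv bounded_linear.continuous_on[OF bl_s])
      have Lps: "Lp p v" "Lp p v1" "Lp p v2" "Lp p h" "Lp p (\<lambda>x. h x + l *s v x)"
        by (rule Lp_compact_support[where N=N, OF _ _ p False],
          rule contv contg, simp add: v_def v1_def v2_def h_def c_zero)+
      have "L_graph Bx Ax p v (\<lambda>x. h x + l *s v x)"
        unfolding L_graph_def
        using Lps ac_deriv_C1[OF v' contv(2)] ac_deriv_C1[OF v1' contv(3)] ac_deriv_C1[OF flux' contg]
        by blast
      from C0[OF Lps(4) this] have "Lp_norm p v \<le> C0 * Lp_norm p h" .
      moreover define a where "a = (LINT x|lborel. norm (v x) powr q)"
      moreover define b where "b = (LINT x|lborel. norm (h x) powr q)"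
      ultimately have "a powr (1 / q) \<le> C0 * b powr (1 / q)"
        using False by (simp add: Lp_norm_def q_def)
      also have "\<dots> \<le> \<bar>C0\<bar> * b powr (1 / q)" by (intro mult_right_mono) auto
      finally have "(a powr (1 / q)) powr q \<le> (\<bar>C0\<bar> * b powr (1 / q)) powr q"
        using q by (intro powr_mono2) auto
      moreover have "0 \<le> a" "0 \<le> b" unfolding a_def b_def by (intro integral_nonneg_AE; simp)+
      ultimately have ab: "a \<le> \<bar>C0\<bar> powr q * b"
        using q by (simp add: powr_powr powr_mult)
      have b_le: "b \<le> 4 * real k * T * (18 * M / (real k * T)) powr q"
      proof -
        have hb: "norm (h x) \<le> 36 * M / N" for x
        proof -
          have "norm (h x) \<le> \<bar>c1 x\<bar> * norm (r1 x) + \<bar>c2 x\<bar> * norm (r2 x)"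
            unfolding h_def by (rule order_trans[OF norm_triangle_ineq]) simp
          also have "\<dots> \<le> (6 / N) * M + (30 / N) * M"
          proof (intro add_mono mult_mono M)
            show "\<bar>c1 x\<bar> \<le> 6 / N" using N bump'_bound[of "x / N"] by (simp add: c1_def divide_right_mono)
            have "\<bar>c2 x\<bar> \<le> 30 / N\<^sup>2" using N bump''_bound[of "x / N"] by (simp add: c2_def divide_right_mono)
            also have "\<dots> \<le> 30 / N" using N by (intro divide_left_mono) (auto simp: power2_eq_square)
            finally show "\<bar>c2 x\<bar> \<le> 30 / N" .
          qed (use N in auto)
          finally show ?thesis by (simp add: field_simps)
        qed
        have "b \<le> (LINT x|lborel. indicator {-N..N} x *\<^sub>R (36 * M / N) powr q)"
          unfolding b_def
        proof (rule integral_mono)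
          show "integrable lborel (\<lambda>x. norm (h x) powr q)" using Lps(4) False by (simp add: Lp_def q_def)
          show "integrable lborel (\<lambda>x. indicator {-N..N} x *\<^sub>R (36 * M / N) powr q)"
            using borel_integrable_atLeastAtMost'[of "-N" N "\<lambda>_. (36 * M / N) powr q"] by (simp add: set_integrable_def)
          show "norm (h x) powr q \<le> indicator {-N..N} x *\<^sub>R (36 * M / N) powr q" for x
          proof (cases "x \<in> {-N..N}")
            case True
            then show ?thesis using hb[of x] q by (simp add: powr_mono2)
          next
            case False
            then have "h x = 0" using c_zero[of x] by (auto simp: h_def)
            then show ?thesis using False q by simp
          qed
        qed
        also have "\<dots> = (2 * N) * (36 * M / N) powr q"
          using integral_FTC_atLeastAtMost[of "-N" N "\<lambda>x. x *\<^sub>R (36 * M / N) powr q" "\<lambda>_. (36 * M / N) powr q"] N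
          by (auto intro!: derivative_eq_intros simp: algebra_simps)
        finally show ?thesis using T_pos k by (simp add: N_def mult.assoc mult.commute[of T])
      qed
      have a_ge: "(27 / 64) powr q * (real k * I) \<le> a"
      proof -
        have Gint: "set_integrable lborel {0..real k * T} G" by (rule borel_integrable_atLeastAtMost'[OF G_cont])
        have "real k * I = integral {0..real k * T} G"
          unfolding I_def by (rule integral_periodic[symmetric, OF G_cont]) (use T_pos in \<open>auto simp: G_def per\<close>)
        also have "\<dots> = (LINT x:{0..real k * T}|lborel. G x)" by (rule set_borel_integral_eq_integral(2)[OF Gint, symmetric])
        finally have "(27 / 64) powr q * (real k * I) = (LINT x|lborel. (27 / 64) powr q * (indicator {0..real k * T} x *\<^sub>R G x))"
          by (simp add: set_lebesgue_integral_def)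
        also have "\<dots> \<le> a"
          unfolding a_def
        proof (rule integral_mono)
          show "integrable lborel (\<lambda>x. (27 / 64) powr q * (indicator {0..real k * T} x *\<^sub>R G x))"
            using Gint unfolding set_integrable_def by (rule integrable_mult_right)
          show "integrable lborel (\<lambda>x. norm (v x) powr q)" using Lps(1) False by (simp add: Lp_def q_def)
          show "(27 / 64) powr q * (indicator {0..real k * T} x *\<^sub>R G x) \<le> norm (v x) powr q" for x
          proof (cases "x \<in> {0..real k * T}")
            case True
            have "\<bar>x / N\<bar> \<le> 1 / 2" using True N by (auto simp: N_def divide_le_eq)
            then have "27 / 64 \<le> c0 x" unfolding c0_def by (rule bump_ge)
            then have "27 / 64 * norm (w x) \<le> \<bar>c0 x\<bar> * norm (w x)" by (intro mult_right_mono) auto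
            then have "27 / 64 * norm (w x) \<le> norm (v x)" by (simp add: v_def)
            then have "(27 / 64 * norm (w x)) powr q \<le> norm (v x) powr q" using q by (intro powr_mono2) auto
            then have "(27 / 64) powr q * norm (w x) powr q \<le> norm (v x) powr q" by (simp only: powr_mult norm_ge_zero)
            then show ?thesis using True by (simp add: G_def)
          qed simp
        qed
        finally show ?thesis .
      qed
      show ?thesis
        by (rule order_trans[OF a_ge order_trans[OF ab mult_left_mono[OF b_le]]]) simp
    qed
    define E where "E = (27 / 64) powr q * I"
    have E: "E > 0" using \<open>0 < I\<close> by (simp add: E_def)
    define F where "F = \<bar>C0\<bar> powr q * (4 * T) * (18 * M / T)"
    \<comment> \<open>The bound F/E yields the contradiction; 18 M/T makes the base of the power at
      most 1, so that the exponent q may be lowered to 1; the last bound gives 1 \<le> N and k >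
      0.\<close>
    obtain k :: nat where k: "real k > max (max (F / E) (18 * M / T)) (1 / T + 1)" using reals_Archimedean2 by blast
    have "0 < 1 / T" using T_pos by simp
    then have kpos: "0 < real k" using k by linarith
    have "1 \<le> 2 * real k * T"
    proof -
      have "1 / T \<le> real k" using k by simp
      then show ?thesis using T_pos by (simp add: divide_le_eq)
    qed
    with kpos have main_k: "(27 / 64) powr q * (real k * I) \<le> \<bar>C0\<bar> powr q * (4 * real k * T * (18 * M / (real k * T)) powr q)"
      by (intro main) auto
    have "real k * E = (27 / 64) powr q * (real k * I)" by (simp add: E_def)
    also note main_k
    also have "(18 * M / (real k * T)) powr q \<le> (18 * M / (real k * T)) powr 1"
    proof (rule powr_mono')
      have "18 * M / T \<le> real k" using k by simp
      then show "18 * M / (real k * T) \<le> 1" using T_pos kpos by (simp add: divide_le_eq mult.commute)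
    qed (use q M T_pos in auto)
    also have "\<bar>C0\<bar> powr q * (4 * real k * T * (18 * M / (real k * T)) powr 1) = F"
      using M(3) T_pos kpos by (simp add: F_def)
    finally have "real k * E \<le> F" using T_pos by (simp add: mult_left_mono)
    moreover have "F / E < real k" using k by simp
    ultimately show False using E by (simp add: divide_less_eq)
  qed
qed

text \<open>A kernel vector of \<open>Phi l T - mat 1\<close> is the initial value of a periodic
  pair (w, y), whose first component is the mode required.\<close>

theorem positive_root_in_spectrum:
  assumes l: "D l = 0" and p: "1 \<le> p"
  shows "l \<in> L_spectrum Bx Ax p"
proof -
  obtain v where v: "v \<noteq> 0" "(Phi l T - mat 1) *v v = 0"
    using l invertible_det_nz[of "Phi l T - mat 1"]
    unfolding D_def invertible_left_inverse matrix_left_invertible_ker by blast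
  define Y where "Y x = Phi l x *v v" for x
  have Y': "(Y has_vector_derivative csys l x *v Y x) (at x)" for x
    unfolding Y_def Phi_def by (rule fund_sol_vec_deriv[OF csys_reg])
  have Y0: "Y 0 = v" by (simp add: Y_def Phi_0)
  have YT: "Y T = Y 0" using v(2) unfolding Y0 by (simp add: Y_def matrix_vector_mult_diff_rdistrib)
  have csys_per: "csys l (x + T) = csys l x" for x by (simp add: csys_def Px_per Qx_per)
  have Y_per: "Y (x + T) = Y x" for x
  proof (rule vector_ode_unique[OF csys_reg, of "\<lambda>x. Y (x + T)" Y l x])
    show "((\<lambda>x. Y (x + T)) has_vector_derivative csys l x *v Y (x + T)) (at x)" for x
    proof -
      have "((\<lambda>y. y + T) has_vector_derivative 1) (at x)" by (auto intro!: derivative_eq_intros)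
      from vector_diff_chain_at[OF this Y'] show ?thesis by (simp add: o_def csys_per)
    qed
  qed (simp_all add: Y' YT)
  define w where "w x = (\<chi> a. Y x $ Inl a)" for x
  define y where "y x = (\<chi> a. Y x $ Inr a)" for x
  define w1 where "w1 x = cmat (Px x) *v w x + cmat (Qx x) *v y x" for x
  have w': "(w has_vector_derivative w1 x) (at x)" for x
  proof (rule has_vector_derivative_vec)
    fix i show "((\<lambda>x. w x $ i) has_vector_derivative w1 x $ i) (at x)"
      using has_vector_derivative_nth[OF Y', of "Inl i" x]
      by (simp add: w1_def w_def y_def csys_def matrix_vector_mult_def sum_UNIV_sum)
  qed
  have y': "(y has_vector_derivative l *s w x) (at x)" for x
  proof (rule has_vector_derivative_vec)
    fix i show "((\<lambda>x. y x $ i) has_vector_derivative (l *s w x) $ i) (at x)"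
      using has_vector_derivative_nth[OF Y', of "Inr i" x]
      by (simp add: w_def y_def csys_def matrix_vector_mult_def sum_UNIV_sum mat_def if_distrib[of "\<lambda>x. x * y" for y] cong: if_cong)
  qed
  have Px_deriv: "(Px has_vector_derivative Qx x ** Ax' x + - (Qx x ** Bx' x ** Qx x) ** Ax x) (at x)" for x
    unfolding Px_def[abs_def] by (rule has_vector_derivative_matrix_mult[OF Qx_deriv Ax_deriv])
  define w2 where "w2 x = (cmat (Px x) *v w1 x + cmat (Qx x ** Ax' x + - (Qx x ** Bx' x ** Qx x) ** Ax x) *v w x)
      + (cmat (Qx x) *v (l *s w x) + cmat (- (Qx x ** Bx' x ** Qx x)) *v y x)" for x
  have w1': "(w1 has_vector_derivative w2 x) (at x)" for x
    unfolding w1_def[abs_def] w2_def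
    by (intro has_vector_derivative_add has_vector_derivative_matrix_vector_mult has_vector_derivative_cmat
        Px_deriv Qx_deriv y' w'[unfolded w1_def[abs_def]] w')
  have bl_s: "bounded_linear (\<lambda>v::complex^'n. l *s v)"
    unfolding linear_conv_bounded_linear[symmetric]
    by (rule linearI) (auto simp: vec_eq_iff algebra_simps)
  have cont: "continuous_on UNIV w" "continuous_on UNIV w1" "continuous_on UNIV y"
    by (rule continuous_on_vector_derivative[OF has_vector_derivative_at_within], rule w' w1' y')+
  have w2_cont: "continuous_on UNIV w2"
    unfolding w2_def[abs_def]
    by (intro continuous_on_add continuous_on_minus continuous_on_matrix_vector_mult continuous_on_cmat continuous_on_matrix_mult
        Px_cont Qx_cont Ax_cont Ax'_cont Bx'_cont cont bounded_linear.continuous_on[OF bl_s])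
  have BQ: "cmat (Bx x) *v (cmat (Qx x) *v u) = u" for x u
    by (simp add: matrix_vector_mul_assoc cmat_mult[symmetric] Bx_Qx cmat_mat)
  have yeq: "y x = cmat (Bx x) *v w1 x - cmat (Ax x) *v w x" for x
    by (simp add: w1_def Px_def cmat_mult matrix_vector_right_distrib matrix_vector_mul_assoc[symmetric] BQ)
  \<comment> \<open>The kernel vector could a priori be carried by y alone. But if w vanished on the
    period, so would w' at 0, and with it y = B w' - A w, making the initial vector zero.\<close>
  have "\<exists>\<xi>\<in>{0..T}. w \<xi> \<noteq> 0"
  proof (rule ccontr)
    assume "\<not> ?thesis"
    then have w0: "w x = 0" if "x \<in> {0..T}" for x using that by blast
    have "(w has_vector_derivative w1 0) (at 0 within {0..T})" using has_vector_derivative_at_within[OF w'] .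
    then have "((\<lambda>_. 0) has_vector_derivative w1 0) (at 0 within {0..T})"
      by (rule has_vector_derivative_transform[rotated 2]) (use w0 T_pos in auto)
    moreover have "((\<lambda>_. 0 :: complex^'n) has_vector_derivative 0) (at 0 within {0..T})" by simp
    ultimately have "w1 0 = 0"
      using vector_derivative_unique_within_closed_interval[of 0 T 0 "\<lambda>_. 0 :: complex^'n"] T_pos by auto
    then have "y 0 = 0" using yeq[of 0] w0[of 0] T_pos by simp
    have "Y 0 $ i = 0" for i
      using w0[of 0] \<open>y 0 = 0\<close> T_pos by (cases i) (auto simp: w_def y_def vec_eq_iff)
    then show False using v Y0 by (simp add: vec_eq_iff)
  qed
  then obtain \<xi> where "\<xi> \<in> {0..T}" "w \<xi> \<noteq> 0" by blast
  then show ?thesis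
    by (intro periodic_mode_in_spectrum[OF p w' w1' w2_cont _ yeq y']) (auto simp: w_def Y_per)
qed

end

section \<open>Implicit equations\<close>

text \<open>Differentiability is required at the base point only, with continuity nearby, because
  the flow is differentiated only at the base orbit. Zeros come from a fixed point theorem, and
  their differentiability at the base point from a direct expansion.\<close>

locale implicit_equation =
  fixes \<Psi> :: "'q::real_normed_vector \<times> 'c::euclidean_space \<Rightarrow> 'c" and \<Psi>' q0 c0 \<rho>
  assumes zero: "\<Psi> (q0, c0) = 0"
    and deriv: "(\<Psi> has_derivative \<Psi>') (at (q0, c0))"
    and \<rho>: "\<rho> > 0" and cont: "continuous_on (ball (q0, c0) \<rho>) \<Psi>"
    and inj: "\<And>k. \<Psi>' (0, k) = 0 \<Longrightarrow> k = 0"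
begin

text \<open>A normal form: g inverts the partial derivative in c, so g composed with \<Psi> is c -
  c0 plus a linear function of q - q0, up to an error of small order. Since g is injective, zeros of
  the composition are zeros of \<Psi>.\<close>

lemma expansion:
  obtains g K where "bounded_linear g" "\<And>v. g v = 0 \<Longrightarrow> v = 0" "\<And>k. g (\<Psi>' (0, k)) = k" "0 < K"
    "\<And>h. norm (g (\<Psi>' (h, 0))) \<le> K * norm h"
    "\<And>e. 0 < e \<Longrightarrow> \<exists>d>0. \<forall>q c. norm (q - q0) + norm (c - c0) < d \<longrightarrow>
       norm (g (\<Psi> (q, c)) - g (\<Psi>' (q - q0, 0)) - (c - c0)) \<le> e * (norm (q - q0) + norm (c - c0))"
proof -
  have bl: "bounded_linear \<Psi>'" using has_derivative_bounded_linear[OF deriv] .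
  have lin: "linear (\<lambda>k. \<Psi>' (0, k))"
    using bounded_linear.linear[OF bl] by (auto intro!: linearI simp: linear_add[symmetric] linear_scale[symmetric])
  have "inj (\<lambda>k. \<Psi>' (0, k))" using linear_injective_0[OF lin] inj by blast
  then obtain g where g: "linear g" "g \<circ> (\<lambda>k. \<Psi>' (0, k)) = id"
    using linear_injective_left_inverse[OF lin] by blast
  have gl: "g (\<Psi>' (0, k)) = k" for k using g(2) by (metis comp_apply id_apply)
  have blg: "bounded_linear g" using g(1) linear_conv_bounded_linear by blast
  obtain K1 where K1: "K1 > 0" "\<And>v. norm (g v) \<le> norm v * K1" using bounded_linear.pos_bounded[OF blg] by blast
  obtain K2 where K2: "K2 > 0" "\<And>v. norm (\<Psi>' v) \<le> norm v * K2" using bounded_linear.pos_bounded[OF bl] by blast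
  have surj: "surj (\<lambda>k. \<Psi>' (0, k))"
    using linear_injective_imp_surjective[OF lin] \<open>inj (\<lambda>k. \<Psi>' (0, k))\<close> by auto
  show ?thesis
  proof (rule that[OF blg _ gl, of "K2 * K1"])
    show "v = 0" if "g v = 0" for v
    proof -
      obtain k where "v = \<Psi>' (0, k)" using surj by (metis surjE)
      then show ?thesis using that gl[of k] linear_0[OF lin] by simp
    qed
    show "0 < K2 * K1" using K1 K2 by simp
    show "norm (g (\<Psi>' (h, 0))) \<le> K2 * K1 * norm h" for h
    proof -
      have "norm (g (\<Psi>' (h, 0))) \<le> norm (\<Psi>' (h, 0)) * K1" by (rule K1)
      also have "\<dots> \<le> (norm (h, 0 :: 'c) * K2) * K1" using K1(1) by (intro mult_right_mono K2) auto
      finally show ?thesis by (simp add: norm_Pair mult_ac)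
    qed
    fix e :: real assume e: "0 < e"
    then have "0 < e / K1" using K1 by simp
    then obtain d where d: "d > 0" "\<And>y. norm (y - (q0, c0)) < d \<Longrightarrow>
        norm (\<Psi> y - \<Psi> (q0, c0) - \<Psi>' (y - (q0, c0))) \<le> e / K1 * norm (y - (q0, c0))"
      using deriv unfolding has_derivative_at_alt by blast
    show "\<exists>d>0. \<forall>q c. norm (q - q0) + norm (c - c0) < d \<longrightarrow>
       norm (g (\<Psi> (q, c)) - g (\<Psi>' (q - q0, 0)) - (c - c0)) \<le> e * (norm (q - q0) + norm (c - c0))"
    proof (intro exI[of _ d] conjI allI impI)
      fix q c assume s: "norm (q - q0) + norm (c - c0) < d"
      have n: "norm ((q, c) - (q0, c0)) \<le> norm (q - q0) + norm (c - c0)" by (simp add: norm_Pair_le)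
      have "\<Psi>' (q - q0, c - c0) = \<Psi>' (q - q0, 0) + \<Psi>' (0, c - c0)"
        using linear_add[OF bounded_linear.linear[OF bl], of "(q - q0, 0)" "(0, c - c0)"] by simp
      then have "g (\<Psi> (q, c)) - g (\<Psi>' (q - q0, 0)) - (c - c0) = g (\<Psi> (q, c) - \<Psi> (q0, c0) - \<Psi>' ((q, c) - (q0, c0)))"
        using gl[of "c - c0"] by (simp add: zero linear_diff[OF g(1)] linear_add[OF g(1)])
      also have "norm \<dots> \<le> norm (\<Psi> (q, c) - \<Psi> (q0, c0) - \<Psi>' ((q, c) - (q0, c0))) * K1" by (rule K1)
      also have "\<dots> \<le> (e / K1 * norm ((q, c) - (q0, c0))) * K1"
        using d(2)[of "(q, c)"] n s K1(1) by (intro mult_right_mono) auto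
      also have "\<dots> \<le> e * (norm (q - q0) + norm (c - c0))"
        using K1(1) e n by simp
      finally show "norm (g (\<Psi> (q, c)) - g (\<Psi>' (q - q0, 0)) - (c - c0)) \<le> e * (norm (q - q0) + norm (c - c0))" .
    qed (use d in auto)
  qed
qed

text \<open>With error factor 1/2, half of \<open>norm (c - c0)\<close> is absorbed. This makes a
  continuous branch of zeros Lipschitz at the base point, as its differentiability requires.\<close>

lemma solution_bound:
  "\<exists>K>0. \<exists>d>0. \<forall>q c. norm (q - q0) + norm (c - c0) < d \<longrightarrow> \<Psi> (q, c) = 0 \<longrightarrow> norm (c - c0) \<le> K * norm (q - q0)"
proof (rule expansion)
  fix g K
  assume g: "bounded_linear g" "\<And>v. g v = 0 \<Longrightarrow> v = 0" "\<And>k. g (\<Psi>' (0, k)) = k" and K: "0 < K"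
    "\<And>h. norm (g (\<Psi>' (h, 0))) \<le> K * norm h"
    and ex: "\<And>e. 0 < e \<Longrightarrow> \<exists>d>0. \<forall>q c. norm (q - q0) + norm (c - c0) < d \<longrightarrow>
       norm (g (\<Psi> (q, c)) - g (\<Psi>' (q - q0, 0)) - (c - c0)) \<le> e * (norm (q - q0) + norm (c - c0))"
  obtain d where d: "d > 0" "\<And>q c. norm (q - q0) + norm (c - c0) < d \<Longrightarrow>
       norm (g (\<Psi> (q, c)) - g (\<Psi>' (q - q0, 0)) - (c - c0)) \<le> 1 / 2 * (norm (q - q0) + norm (c - c0))"
    using ex[of "1/2"] by auto
  show ?thesis
  proof (rule exI[of _ "2 * K + 1"], rule conjI[OF _ exI[of _ d]], use K in simp, intro conjI allI impI)
    fix q c assume s: "norm (q - q0) + norm (c - c0) < d" and z: "\<Psi> (q, c) = 0"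
    have "norm (g (\<Psi>' (q - q0, 0)) + (c - c0)) \<le> 1 / 2 * (norm (q - q0) + norm (c - c0))"
    proof -
      have "g (\<Psi> (q, c)) - g (\<Psi>' (q - q0, 0)) - (c - c0) = - (g (\<Psi>' (q - q0, 0)) + (c - c0))"
        by (simp add: z linear_0[OF bounded_linear.linear[OF g(1)]])
      then show ?thesis using d(2)[OF s] by (simp only: norm_minus_cancel)
    qed
    moreover have "norm (c - c0) \<le> norm (g (\<Psi>' (q - q0, 0)) + (c - c0)) + norm (g (\<Psi>' (q - q0, 0)))"
      using norm_triangle_ineq4[of "g (\<Psi>' (q - q0, 0)) + (c - c0)" "g (\<Psi>' (q - q0, 0))"] by simp
    ultimately show "norm (c - c0) \<le> (2 * K + 1) * norm (q - q0)"
      using K(2)[of "q - q0"] by (simp add: algebra_simps)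
  qed (use d K in auto)
qed

text \<open>Zeros are the fixed points of c - g(\<Psi>(q, c)), a continuous map of a small ball into
  itself. The radius is proportional to \<open>norm (q - q0)\<close>, which yields the bound on
  c.\<close>

lemma solution_exists:
  "\<exists>d>0. \<exists>K. \<forall>q. norm (q - q0) < d \<longrightarrow> (\<exists>c. \<Psi> (q, c) = 0 \<and> norm (c - c0) \<le> K * norm (q - q0))"
proof (rule expansion)
  fix g K
  assume g: "bounded_linear g" "\<And>v. g v = 0 \<Longrightarrow> v = 0" "\<And>k. g (\<Psi>' (0, k)) = k" and K: "0 < K"
    "\<And>h. norm (g (\<Psi>' (h, 0))) \<le> K * norm h"
    and ex: "\<And>e. 0 < e \<Longrightarrow> \<exists>d>0. \<forall>q c. norm (q - q0) + norm (c - c0) < d \<longrightarrow>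
       norm (g (\<Psi> (q, c)) - g (\<Psi>' (q - q0, 0)) - (c - c0)) \<le> e * (norm (q - q0) + norm (c - c0))"
  obtain d where d: "d > 0" "\<And>q c. norm (q - q0) + norm (c - c0) < d \<Longrightarrow>
       norm (g (\<Psi> (q, c)) - g (\<Psi>' (q - q0, 0)) - (c - c0)) \<le> 1 / 2 * (norm (q - q0) + norm (c - c0))"
    using ex[of "1/2"] by auto
  \<comment> \<open>M solves (1 + M)/2 + K = M, the condition for the ball of radius M times
    \<open>norm (q - q0)\<close> to be mapped into itself. The choice of \<delta> keeps this ball
    where the expansion and continuity hold.\<close>
  define M where "M = 2 * K + 1"
  define \<delta> where "\<delta> = min d \<rho> / (2 * (1 + M))"
  have M: "M > 0" using K by (simp add: M_def)
  have \<delta>: "\<delta> > 0" using d \<rho> M by (simp add: \<delta>_def)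
  show ?thesis
  proof (rule exI[of _ \<delta>], rule conjI[OF \<delta>], rule exI[of _ M], intro allI impI)
    fix q assume q: "norm (q - q0) < \<delta>"
    show "\<exists>c. \<Psi> (q, c) = 0 \<and> norm (c - c0) \<le> M * norm (q - q0)"
    proof (cases "q = q0")
      case True
      then show ?thesis using zero by (intro exI[of _ c0]) simp
    next
      case False
      define r where "r = M * norm (q - q0)"
      have r: "r > 0" using False M by (simp add: r_def)
      have small: "norm (q - q0) + norm (c - c0) < min d \<rho>" if "c \<in> cball c0 r" for c
      proof -
        have "norm (q - q0) + norm (c - c0) \<le> (1 + M) * norm (q - q0)"
          using that by (simp add: dist_norm norm_minus_commute r_def algebra_simps)
        also have "\<dots> < (1 + M) * \<delta>" using q M by (intro mult_strict_left_mono) auto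
        also have "\<dots> = min d \<rho> / 2" using M by (simp add: \<delta>_def field_simps)
        also have "\<dots> < min d \<rho>"
        proof -
          have "0 < min d \<rho>" using d \<rho> by simp
          then show ?thesis by linarith
        qed
        finally show ?thesis .
      qed
      have "\<exists>c\<in>cball c0 r. c - g (\<Psi> (q, c)) = c"
      proof (rule brouwer_ball[of r c0 "\<lambda>c. c - g (\<Psi> (q, c))"])
        show "continuous_on (cball c0 r) (\<lambda>c. c - g (\<Psi> (q, c)))"
        proof (intro continuous_intros bounded_linear.continuous_on[OF g(1)] continuous_on_compose2[OF cont])
          show "Pair q ` cball c0 r \<subseteq> ball (q0, c0) \<rho>"
          proof clarify
            fix c assume "c \<in> cball c0 r"
            then show "(q, c) \<in> ball (q0, c0) \<rho>"
              using small[of c] norm_Pair_le[of "q0 - q" "c0 - c"] by (simp add: dist_norm norm_minus_commute)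
          qed
        qed
        show "(\<lambda>c. c - g (\<Psi> (q, c))) \<in> cball c0 r \<rightarrow> cball c0 r"
        proof
          fix c assume c: "c \<in> cball c0 r"
          have "norm (c - g (\<Psi> (q, c)) - c0)
            \<le> norm (g (\<Psi> (q, c)) - g (\<Psi>' (q - q0, 0)) - (c - c0)) + norm (g (\<Psi>' (q - q0, 0)))"
            using norm_triangle_ineq[of "g (\<Psi> (q, c)) - g (\<Psi>' (q - q0, 0)) - (c - c0)" "g (\<Psi>' (q - q0, 0))"]
              norm_minus_commute[of "g (\<Psi> (q, c))" "c - c0"]
            by (simp add: algebra_simps)
          also have "\<dots> \<le> 1 / 2 * (norm (q - q0) + norm (c - c0)) + K * norm (q - q0)"
            using d(2)[of q c] small[OF c] K(2) by (intro add_mono) auto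
          also have "\<dots> \<le> 1 / 2 * (norm (q - q0) + r) + K * norm (q - q0)"
            using c by (simp add: dist_norm norm_minus_commute)
          also have "\<dots> = r" by (simp add: r_def M_def field_simps)
          finally show "c - g (\<Psi> (q, c)) \<in> cball c0 r" by (simp add: dist_norm norm_minus_commute)
        qed
      qed (use r in auto)
      then obtain c where "c \<in> cball c0 r" "g (\<Psi> (q, c)) = 0" by auto
      then show ?thesis using g(2) by (intro exI[of _ c]) (auto simp: r_def dist_norm norm_minus_commute)
    qed
  qed
qed

text \<open>Stated for an arbitrary continuous branch, because the mass map uses a chart picked by a
  choice operator, about which nothing else is known.\<close>

lemma implicit_function_derivative:
  assumes c: "isCont c q0" "c q0 = c0" and sol: "\<forall>\<^sub>F q in nhds q0. \<Psi> (q, c q) = 0"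
  obtains c' where "(c has_derivative c') (at q0)" "\<And>h. \<Psi>' (0, c' h) = - \<Psi>' (h, 0)"
proof (rule expansion)
  fix g K
  assume g: "bounded_linear g" "\<And>v. g v = 0 \<Longrightarrow> v = 0" "\<And>k. g (\<Psi>' (0, k)) = k" and K: "0 < K"
    "\<And>h. norm (g (\<Psi>' (h, 0))) \<le> K * norm h"
    and ex: "\<And>e. 0 < e \<Longrightarrow> \<exists>d>0. \<forall>q c. norm (q - q0) + norm (c - c0) < d \<longrightarrow>
       norm (g (\<Psi> (q, c)) - g (\<Psi>' (q - q0, 0)) - (c - c0)) \<le> e * (norm (q - q0) + norm (c - c0))"
  have bl: "bounded_linear \<Psi>'" using has_derivative_bounded_linear[OF deriv] .
  have lg: "linear g" using bounded_linear.linear[OF g(1)] .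
  obtain K1 d1 where K1: "K1 > 0" "d1 > 0" "\<And>q c. norm (q - q0) + norm (c - c0) < d1 \<Longrightarrow> \<Psi> (q, c) = 0 \<Longrightarrow> norm (c - c0) \<le> K1 * norm (q - q0)"
    using solution_bound by blast
  obtain d2 where d2: "d2 > 0" "\<And>q. dist q q0 < d2 \<Longrightarrow> \<Psi> (q, c q) = 0"
    using sol unfolding eventually_nhds_metric by blast
  have near: "\<exists>d3>0. \<forall>q. norm (q - q0) < d3 \<longrightarrow> norm (q - q0) + norm (c q - c0) < d" if d: "d > 0" for d
  proof -
    obtain d4 where "d4 > 0" "\<And>q. dist q q0 < d4 \<Longrightarrow> dist (c q) (c q0) < d / 2"
      using c(1) d unfolding continuous_at_eps_delta dist_norm by (metis half_gt_zero)
    then show ?thesis using d c(2) by (intro exI[of _ "min d4 (d / 2)"]) (force simp: dist_norm)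
  qed
  have "(c has_derivative (\<lambda>h. - g (\<Psi>' (h, 0)))) (at q0)"
    unfolding has_derivative_at_alt
  proof (intro conjI allI impI)
    show "bounded_linear (\<lambda>h. - g (\<Psi>' (h, 0)))"
      by (intro bounded_linear_minus bounded_linear_compose[OF g(1)] bounded_linear_compose[OF bl]
          bounded_linear_Pair bounded_linear_ident bounded_linear_zero)
    fix e :: real assume e: "0 < e"
    then have "0 < e / (1 + K1)" using K1 by simp
    then obtain d where d: "d > 0" "\<And>q c. norm (q - q0) + norm (c - c0) < d \<Longrightarrow>
       norm (g (\<Psi> (q, c)) - g (\<Psi>' (q - q0, 0)) - (c - c0)) \<le> e / (1 + K1) * (norm (q - q0) + norm (c - c0))"
      using ex by blast
    obtain d3 where d3: "d3 > 0" "\<And>q. norm (q - q0) < d3 \<Longrightarrow> norm (q - q0) + norm (c q - c0) < min d d1"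
      using near[of "min d d1"] d K1 by auto
    show "\<exists>d>0. \<forall>y. norm (y - q0) < d \<longrightarrow> norm (c y - c q0 - - g (\<Psi>' (y - q0, 0))) \<le> e * norm (y - q0)"
    proof (intro exI[of _ "min d2 d3"] conjI allI impI)
      fix q assume q: "norm (q - q0) < min d2 d3"
      have z: "\<Psi> (q, c q) = 0" using d2(2)[of q] q by (simp add: dist_norm)
      have s: "norm (q - q0) + norm (c q - c0) < min d d1" using d3 q by simp
      have "norm (c q - c q0 - - g (\<Psi>' (q - q0, 0))) = norm (g (\<Psi> (q, c q)) - g (\<Psi>' (q - q0, 0)) - (c q - c0))"
      proof -
        have "g (\<Psi> (q, c q)) - g (\<Psi>' (q - q0, 0)) - (c q - c0) = - (c q - c q0 - - g (\<Psi>' (q - q0, 0)))"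
          by (simp add: z linear_0[OF lg] c(2))
        then show ?thesis by (simp only: norm_minus_cancel)
      qed
      also have "\<dots> \<le> e / (1 + K1) * (norm (q - q0) + norm (c q - c0))" using d(2)[of q "c q"] s by simp
      also have "\<dots> \<le> e / (1 + K1) * ((1 + K1) * norm (q - q0))"
        using K1(3)[OF _ z] s e K1(1) by (intro mult_left_mono) (auto simp: algebra_simps)
      also have "\<dots> = e * norm (q - q0)" using K1(1) by simp
      finally show "norm (c q - c q0 - - g (\<Psi>' (q - q0, 0))) \<le> e * norm (q - q0)" .
    qed (use d2 d3 in auto)
  qed
  moreover have "\<Psi>' (0, - g (\<Psi>' (h, 0))) = - \<Psi>' (h, 0)" for h
  proof -
    let ?v = "\<Psi>' (0, - g (\<Psi>' (h, 0))) + \<Psi>' (h, 0)"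
    have "g ?v = 0" using g(3)[of "- g (\<Psi>' (h, 0))"] by (simp add: linear_add[OF lg])
    then show ?thesis using g(2) by (simp add: eq_neg_iff_add_eq_0)
  qed
  ultimately show ?thesis using that by blast
qed

end

lemma affine_ode_exists:
  fixes A :: "real \<Rightarrow> 'b::real_normed_vector" and g :: "real \<Rightarrow> 'e::euclidean_space"
  assumes h: "bounded_bilinear h" and A: "regular_coef A" and g: "regular_coef g"
  shows "\<exists>y. y 0 = y0 \<and> (\<forall>x. (y has_vector_derivative h (A x) (y x) + g x) (at x))"
proof -
  obtain C where C: "0 \<le> C" "\<And>x. norm (A x) \<le> C" using regular_coef_norm_le[OF A] by blast
  obtain D where D: "0 \<le> D" "\<And>x. norm (g x) \<le> D" using regular_coef_norm_le[OF g] by blast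
  obtain K where K: "\<And>a b. norm (h a b) \<le> norm a * norm b * K" "0 \<le> K"
    using bounded_bilinear.nonneg_bounded[OF h] by blast
  have Ac: "continuous_on UNIV A" and gc: "continuous_on UNIV g" using A g by (auto simp: regular_coef_def)
  show ?thesis
  proof (rule global_ode_exists[where K="C * K" and C=D])
    show "continuous_on UNIV (\<lambda>p. h (A (fst p)) (snd p) + g (fst p))"
      by (intro continuous_intros bounded_bilinear.continuous_on[OF h]
          continuous_on_compose2[OF Ac] continuous_on_compose2[OF gc]) auto
    show "norm (h (A x) v + g x - (h (A x) w + g x)) \<le> C * K * norm (v - w)" for x v w
    proof -
      have "norm (h (A x) (v - w)) \<le> C * norm (v - w) * K"
        by (intro order_trans[OF K(1)] mult_right_mono C K) auto
      then show ?thesis by (simp add: bounded_bilinear.diff_right[OF h] mult_ac)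
    qed
    show "norm (h (A x) 0 + g x) \<le> D" for x using D by (simp add: bounded_bilinear.zero_right[OF h])
  qed
qed

section \<open>Variations of the profile\<close>

definition fd :: "('a::real_normed_vector \<Rightarrow> 'b::real_normed_vector) \<Rightarrow> 'a \<Rightarrow> 'a \<Rightarrow> 'b" where
  "fd F u = frechet_derivative F (at u)"

text \<open>Operator-valued derivatives are translated into derivatives along fixed vectors h, the
  form in which A(x) and its x-derivative are written.\<close>

lemma C2_map_facts:
  assumes "C2_map F"
  shows fd: "(F has_derivative fd F u) (at u)"
    and fd_deriv: "((\<lambda>u. fd F u h) has_derivative (\<lambda>k. fd (\<lambda>u. fd F u h) u k)) (at u)"
    and fd_cont: "continuous_on S (\<lambda>u. fd F u h)"
    and fd2_cont: "continuous_on UNIV g \<Longrightarrow> continuous_on UNIV k \<Longrightarrow> continuous_on UNIV (\<lambda>x::'c::topological_space. fd (\<lambda>u. fd F u h) (g x) (k x))"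
    and fd1_cont: "continuous_on UNIV g \<Longrightarrow> continuous_on UNIV k \<Longrightarrow> continuous_on UNIV (\<lambda>x::'c. fd F (g x) (k x))"
proof -
  obtain F' F'' where F: "\<And>x. (F has_derivative blinfun_apply (F' x)) (at x)"
    "\<And>x. (F' has_derivative blinfun_apply (F'' x)) (at x)" "continuous_on UNIV F''"
    using assms unfolding C2_map_def by blast
  have 1: "fd F u = blinfun_apply (F' u)" for u
    unfolding fd_def by (rule frechet_derivative_at[symmetric, OF F(1)])
  show "(F has_derivative fd F u) (at u)" for u using F(1) by (simp add: 1)
  have 2: "((\<lambda>u. fd F u h) has_derivative (\<lambda>k. F'' u k h)) (at u)" for u h
    unfolding 1 using bounded_linear.has_derivative[OF bounded_bilinear.bounded_linear_left[OF bounded_bilinear_blinfun_apply] F(2)] .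
  then have 3: "fd (\<lambda>u. fd F u h) u = (\<lambda>k. F'' u k h)" for u h
    unfolding fd_def[of "\<lambda>u. fd F u h"] by (rule frechet_derivative_at[symmetric])
  show "((\<lambda>u. fd F u h) has_derivative (\<lambda>k. fd (\<lambda>u. fd F u h) u k)) (at u)" for u h
    using 2 by (simp add: 3)
  show "continuous_on S (\<lambda>u. fd F u h)" for S h
    using 2 by (intro continuous_at_imp_continuous_on ballI) (rule has_derivative_continuous)
  have F'c: "continuous_on UNIV F'"
    using F(2) by (intro continuous_at_imp_continuous_on ballI) (rule has_derivative_continuous)
  show "continuous_on UNIV (\<lambda>x::'c. fd (\<lambda>u. fd F u h) (g x) (k x))"
    if "continuous_on UNIV g" "continuous_on UNIV k" for g k h
    unfolding 3 by (intro continuous_intros that continuous_on_compose2[OF F(3)]) auto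
  show "continuous_on UNIV (\<lambda>x::'c. fd F (g x) (k x))"
    if "continuous_on UNIV g" "continuous_on UNIV k" for g k
    unfolding 1 by (intro continuous_intros that continuous_on_compose2[OF F'c]) auto
qed

lemma has_vector_derivative_chain:
  assumes "(F has_derivative F') (at (g x))" "(g has_vector_derivative g') (at x within S)"
  shows "((\<lambda>x. F (g x)) has_vector_derivative F' g') (at x within S)"
proof -
  have "((\<lambda>x. F (g x)) has_derivative (\<lambda>h. F' (h *\<^sub>R g'))) (at x within S)"
    using has_derivative_compose[OF assms(2)[unfolded has_vector_derivative_def] assms(1)] .
  then show ?thesis
    by (simp add: has_vector_derivative_def linear_scale[OF has_derivative_linear[OF assms(1)]])
qed

lemma matrix_vector_mult_matrix:
  fixes h :: "real^'n::finite \<Rightarrow> real^'m::finite"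
  assumes "linear h" shows "matrix h *v v = h v"
  using assms by (simp add: matrix_works linear_def scalar_mult_eq_scaleR[abs_def] linear_matrix_vector_mul_eq)

locale profile_setting =
  fixes f :: "real^'n::finite \<Rightarrow> real^'n" and B :: "real^'n \<Rightarrow> real^'n^'n"
    and ubar :: "real \<Rightarrow> real^'n" and um :: "real^'n" and T :: real
  assumes f_C2: "C2_map f" and B_C2: "C2_map B" and T_gt0: "0 < T"
    and prof: "stationary_profile f B um ubar" and ubar_per: "\<And>x. ubar (x + T) = ubar x"
    and B_spec: "\<And>x \<mu>. \<mu> \<in> mat_spectrum (B (ubar x)) \<Longrightarrow> Re \<mu> > 0"
begin

definition du :: "real \<Rightarrow> real^'n" where "du x = vector_derivative ubar (at x)"

lemma ubar_deriv: "(ubar has_vector_derivative du x) (at x within S)"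
proof -
  have "ubar differentiable (at x)" using prof unfolding stationary_profile_def by blast
  then have "(ubar has_vector_derivative du x) (at x)" unfolding du_def by (rule vector_derivative_works[THEN iffD1])
  then show ?thesis by (rule has_vector_derivative_at_within)
qed

lemma ubar_cont: "continuous_on S ubar"
  by (rule continuous_on_vector_derivative[OF ubar_deriv])

lemma spec_pos_B: "spec_pos (B (ubar x))"
  using B_spec by (auto simp: spec_pos_def)

lemma B_invertible: "invertible (B (ubar x))"
  using invertible_of_mat_spectrum[OF B_spec] .

lemma du_eq: "B (ubar x) *v du x = f (ubar x) - f um"
  using prof unfolding stationary_profile_def du_def by blast

lemma du_explicit: "du x = matrix_inv (B (ubar x)) *v (f (ubar x) - f um)"
  by (simp add: du_eq[symmetric] matrix_vector_mul_assoc matrix_inv_cancel[OF B_invertible])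

definition dBx :: "real \<Rightarrow> real^'n^'n" where "dBx x = fd B (ubar x) (du x)"

lemma Bx_der: "((\<lambda>x. B (ubar x)) has_vector_derivative dBx x) (at x)"
  unfolding dBx_def by (rule has_vector_derivative_chain[OF fd[OF B_C2] ubar_deriv])

lemma inv_der: "((\<lambda>x. matrix_inv (B (ubar x))) has_vector_derivative
    - (matrix_inv (B (ubar x)) ** dBx x ** matrix_inv (B (ubar x)))) (at x)"
  by (rule has_vector_derivative_matrix_inv[OF Bx_der B_invertible])

definition ddu :: "real \<Rightarrow> real^'n" where
  "ddu x = matrix_inv (B (ubar x)) *v (fd f (ubar x) (du x) - dBx x *v du x)"

lemma du_deriv: "(du has_vector_derivative ddu x) (at x)"
proof -
  have "((\<lambda>x. f (ubar x) - f um) has_vector_derivative fd f (ubar x) (du x) - 0) (at x)"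
    by (intro has_vector_derivative_diff has_vector_derivative_const has_vector_derivative_chain[OF fd[OF f_C2] ubar_deriv])
  from has_vector_derivative_matrix_vector_mult[OF inv_der this]
  have "(du has_vector_derivative matrix_inv (B (ubar x)) *v (fd f (ubar x) (du x) - 0)
      + - (matrix_inv (B (ubar x)) ** dBx x ** matrix_inv (B (ubar x))) *v (f (ubar x) - f um)) (at x)"
    unfolding du_explicit[abs_def] .
  also have "matrix_inv (B (ubar x)) *v (fd f (ubar x) (du x) - 0)
      + - (matrix_inv (B (ubar x)) ** dBx x ** matrix_inv (B (ubar x))) *v (f (ubar x) - f um) = ddu x"
    by (simp add: ddu_def du_explicit[of x] matrix_vector_mult_diff_distrib
        bounded_bilinear.minus_left[OF bounded_bilinear_matrix_vector_mult'] matrix_vector_mul_assoc[symmetric])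
  finally show ?thesis .
qed

lemma du_cont: "continuous_on S du"
  by (rule continuous_on_vector_derivative[OF has_vector_derivative_at_within[OF du_deriv]])

lemma dBx_cont: "continuous_on UNIV dBx"
  unfolding dBx_def[abs_def] by (rule fd1_cont[OF B_C2 ubar_cont du_cont])

lemma ddu_cont: "continuous_on UNIV ddu"
  unfolding ddu_def[abs_def]
  by (intro continuous_on_matrix_vector_mult continuous_intros fd1_cont[OF f_C2 ubar_cont du_cont] dBx_cont du_cont
      continuous_on_vector_derivative[OF has_vector_derivative_at_within[OF inv_der]])

definition Afun :: "real \<Rightarrow> real^'n \<Rightarrow> real^'n" where
  "Afun x v = fd f (ubar x) v - fd B (ubar x) v *v du x"

definition dAx :: "real \<Rightarrow> real^'n^'n" where
  "dAx x = matrix (\<lambda>v. fd (\<lambda>u. fd f u v) (ubar x) (du x)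
     - (fd B (ubar x) v *v ddu x + fd (\<lambda>u. fd B u v) (ubar x) (du x) *v du x))"

lemma Acoef_eq: "Acoef f B ubar x = matrix (Afun x)"
  by (simp add: Acoef_def Afun_def[abs_def] fd_def du_def)

lemma Acoef_deriv: "(Acoef f B ubar has_vector_derivative dAx x) (at x)"
proof (intro has_vector_derivative_vec)
  fix i j
  have "((\<lambda>x. Afun x (axis j 1)) has_vector_derivative fd (\<lambda>u. fd f u (axis j 1)) (ubar x) (du x)
     - (fd B (ubar x) (axis j 1) *v ddu x + fd (\<lambda>u. fd B u (axis j 1)) (ubar x) (du x) *v du x)) (at x)"
    unfolding Afun_def
    by (intro has_vector_derivative_diff has_vector_derivative_matrix_vector_mult du_deriv
        has_vector_derivative_chain[OF fd_deriv[OF f_C2] ubar_deriv] has_vector_derivative_chain[OF fd_deriv[OF B_C2] ubar_deriv])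
  from has_vector_derivative_nth[OF this, of i]
  show "((\<lambda>x. Acoef f B ubar x $ i $ j) has_vector_derivative dAx x $ i $ j) (at x)"
    by (simp add: Acoef_eq dAx_def matrix_def)
qed

lemma dAx_cont: "continuous_on UNIV dAx"
proof (intro continuous_on_vec)
  fix i j
  have "continuous_on UNIV (\<lambda>x. fd (\<lambda>u. fd f u (axis j 1)) (ubar x) (du x)
     - (fd B (ubar x) (axis j 1) *v ddu x + fd (\<lambda>u. fd B u (axis j 1)) (ubar x) (du x) *v du x))"
    by (intro continuous_intros continuous_on_matrix_vector_mult fd2_cont[OF f_C2] fd2_cont[OF B_C2] fd1_cont[OF B_C2]
        ubar_cont du_cont ddu_cont)
  from continuous_on_component[OF this, of i] show "continuous_on UNIV (\<lambda>x. dAx x $ i $ j)"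
    by (simp add: dAx_def matrix_def)
qed

lemma du_per: "du (x + T) = du x"
  by (simp add: du_explicit ubar_per)

sublocale periodic_pencil "Bcoef B ubar" "Acoef f B ubar" dBx dAx T
proof
  show "(Bcoef B ubar has_vector_derivative dBx x) (at x)" for x
    unfolding Bcoef_def[abs_def] by (rule Bx_der)
  show "Acoef f B ubar (x + T) = Acoef f B ubar x" for x
    by (simp add: Acoef_eq Afun_def[abs_def] ubar_per du_per)
qed (use T_gt0 Acoef_deriv dBx_cont dAx_cont spec_pos_B in \<open>auto simp: Bcoef_def ubar_per\<close>)

lemma Qx_eq: "Qx x = matrix_inv (B (ubar x))"
  by (simp add: Qx_def Bcoef_def)

lemma linear_Afun: "linear (Afun x)"
proof -
  have 1: "linear (fd f (ubar x))" "linear (fd B (ubar x))"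
    using fd[OF f_C2] fd[OF B_C2] has_derivative_linear by blast+
  show ?thesis
    by (rule linearI) (simp_all add: Afun_def linear_add[OF 1(1)] linear_add[OF 1(2)] linear_scale[OF 1(1)] linear_scale[OF 1(2)]
        matrix_vector_mult_add_rdistrib scaleR_matrix_vector_assoc[symmetric] algebra_simps)
qed

lemma Px_mult: "Px x *v v = Qx x *v Afun x v"
  by (simp add: Px_def matrix_vector_mul_assoc[symmetric] Acoef_eq matrix_vector_mult_matrix[OF linear_Afun])

text \<open>The differentiated profile equation: the translation mode \<open>du\<close> solves w' =
  P w, which is the eigenvalue system for l = 0 with y = 0.\<close>

lemma ddu_eq: "ddu x = Px x *v du x"
  by (simp add: ddu_def Px_mult Qx_eq Afun_def dBx_def)

section \<open>Profiles as trajectories in the space of states and parameters\<close>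

definition rhs :: "real^'n \<Rightarrow> real^'n \<Rightarrow> real \<Rightarrow> real^'n" where
  "rhs u v s = f u - f v - s *\<^sub>R (u - v)"

text \<open>The rest point and the speed are carried along as constant components, so that
  dependence on all parameters becomes dependence on initial data.\<close>

definition X :: "(real^'n) \<times> (real^'n) \<times> real \<Rightarrow> (real^'n) \<times> (real^'n) \<times> real" where
  "X p = (matrix_inv (B (fst p)) *v rhs (fst p) (fst (snd p)) (snd (snd p)), 0, 0)"

definition dX :: "(real^'n) \<times> (real^'n) \<times> real \<Rightarrow> (real^'n) \<times> (real^'n) \<times> real \<Rightarrow> (real^'n) \<times> (real^'n) \<times> real" where
  "dX p q = (matrix_inv (B (fst p)) *v
      (fd f (fst p) (fst q) - fd f (fst (snd p)) (fst (snd q))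
        - (snd (snd p) *\<^sub>R (fst q - fst (snd q)) + snd (snd q) *\<^sub>R (fst p - fst (snd p))))
      + - (matrix_inv (B (fst p)) ** fd B (fst p) (fst q) ** matrix_inv (B (fst p))) *v rhs (fst p) (fst (snd p)) (snd (snd p)), 0, 0)"

definition dom :: "((real^'n) \<times> (real^'n) \<times> real) set" where "dom = {p. det (B (fst p)) \<noteq> 0}"

lemma X_has_derivative:
  assumes "p \<in> dom"
  shows "(X has_derivative dX p) (at p)"
proof -
  have inv: "invertible (B (fst p))" using assms by (simp add: dom_def invertible_det_nz)
  have J: "((\<lambda>p. matrix_inv (B (fst p))) has_derivative
      (\<lambda>q. - (matrix_inv (B (fst p)) ** fd B (fst p) (fst q) ** matrix_inv (B (fst p))))) (at p)"
    by (rule has_derivative_compose[OF has_derivative_fst[OF has_derivative_ident] has_derivative_matrix_inv[OF fd[OF B_C2] inv]])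
  have R: "((\<lambda>p. rhs (fst p) (fst (snd p)) (snd (snd p))) has_derivative
      (\<lambda>q. fd f (fst p) (fst q) - fd f (fst (snd p)) (fst (snd q))
        - (snd (snd p) *\<^sub>R (fst q - fst (snd q)) + snd (snd q) *\<^sub>R (fst p - fst (snd p))))) (at p)"
    unfolding rhs_def
    by (intro has_derivative_diff has_derivative_scaleR has_derivative_fst has_derivative_snd has_derivative_ident
        has_derivative_compose[OF _ fd[OF f_C2]])
  have "((\<lambda>p. (matrix_inv (B (fst p)) *v rhs (fst p) (fst (snd p)) (snd (snd p)), 0::real^'n, 0::real)) has_derivative dX p) (at p)"
    unfolding dX_def[abs_def]
    by (intro has_derivative_Pair has_derivative_const bounded_bilinear.FDERIV[OF bounded_bilinear_matrix_vector_mult' J R])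
  then show ?thesis by (simp add: X_def[abs_def])
qed

lemma dom_open: "open dom"
proof -
  have "continuous_on UNIV (\<lambda>u. det (B u))"
    using has_derivative_continuous[OF fd[OF B_C2]]
    by (intro continuous_at_imp_continuous_on ballI)
      (auto simp: isCont_def intro!: tendsto_det tendsto_vec_nth)
  then have "continuous_on UNIV (\<lambda>p::(real^'n) \<times> (real^'n) \<times> real. det (B (fst p)))"
    by (rule continuous_on_compose2) (auto intro: continuous_intros)
  then show ?thesis unfolding dom_def by (intro open_Collect_neq continuous_on_const)
qed

definition X' where "X' p = Blinfun (dX p)"

lemma X'_apply: "p \<in> dom \<Longrightarrow> blinfun_apply (X' p) = dX p"
  unfolding X'_def using has_derivative_bounded_linear[OF X_has_derivative] by (rule bounded_linear_Blinfun_apply)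

text \<open>In finite dimension the continuity of an operator-valued map may be checked on fixed
  vectors.\<close>

lemma X'_continuous: "continuous_on dom X'"
proof (rule continuous_on_blinfun_componentwise)
  fix q :: "(real^'n) \<times> (real^'n) \<times> real"
  have J: "continuous_on dom (\<lambda>p. matrix_inv (B (fst p)))"
  proof (intro continuous_at_imp_continuous_on ballI)
    fix p assume "p \<in> dom"
    then have "invertible (B (fst p))" by (simp add: dom_def invertible_det_nz)
    then show "isCont (\<lambda>p. matrix_inv (B (fst p))) p"
      using has_derivative_continuous[OF has_derivative_compose[OF has_derivative_fst[OF has_derivative_ident] has_derivative_matrix_inv[OF fd[OF B_C2]]]] by blast
  qed
  have fc: "continuous_on UNIV f"
    using has_derivative_continuous[OF fd[OF f_C2]] by (intro continuous_at_imp_continuous_on ballI)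
  have "continuous_on dom (\<lambda>p. dX p q)"
    unfolding dX_def rhs_def
    by (intro continuous_intros continuous_on_matrix_vector_mult continuous_on_matrix_mult J
        continuous_on_compose2[OF fd_cont[OF f_C2, of UNIV]] continuous_on_compose2[OF fd_cont[OF B_C2, of UNIV]]
        continuous_on_compose2[OF fc]) auto
  then show "continuous_on dom (\<lambda>p. blinfun_apply (X' p) q)"
    by (rule continuous_on_cong[THEN iffD1, rotated 2]) (simp_all add: X'_apply)
qed

definition base :: "real \<Rightarrow> (real^'n) \<times> (real^'n) \<times> real" where "base x = (ubar x, um, 0)"

lemma base_dom: "base x \<in> dom"
  using B_invertible by (simp add: base_def dom_def invertible_det_nz)

lemma base_deriv: "(base has_vector_derivative X (base x)) (at x within S)"
proof -
  have "X (base x) = (du x, 0, 0)" by (simp add: X_def base_def rhs_def du_explicit)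
  then show ?thesis
    unfolding base_def[abs_def] by (auto intro!: has_vector_derivative_Pair ubar_deriv)
qed

lemma base_cont: "continuous_on S base"
  by (rule continuous_on_vector_derivative[OF base_deriv])

lemma tube_radius: "\<exists>r>0. \<forall>x\<in>{0..T}. cball (base x) r \<subseteq> dom"
proof (rule compact_subset_open_imp_cball_epsilon_subset[OF _ dom_open])
  show "compact (base ` {0..T})" by (intro compact_continuous_image base_cont) auto
  show "base ` {0..T} \<subseteq> dom" using base_dom by blast
qed blast

definition rr :: real where "rr = (SOME r. r > 0 \<and> (\<forall>x\<in>{0..T}. cball (base x) r \<subseteq> dom))"

lemma rr: "rr > 0" "x \<in> {0..T} \<Longrightarrow> cball (base x) rr \<subseteq> dom"
  using someI_ex[OF tube_radius] unfolding rr_def by blast+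

sublocale fl: c1_orbit X X' dom T base rr
  by unfold_locales (use X_has_derivative X'_apply X'_continuous T_gt0 base_deriv rr in auto)

text \<open>Near the base point the profile problem on one period has a unique solution. A solution
  determines u' only where B(u) is invertible, which is the conditional form that
  \<open>fl.solution_unique\<close> accepts. Hence the choice in \<open>profile\<close> is
  harmless.\<close>

lemma profile_solves_iff_flow:
  assumes near: "dist (u0, v, s) (base 0) < fl.rad"
  shows "profile_solves f B T v u0 s (\<lambda>x. fst (fl.flow (u0, v, s) x))"
    and "profile_solves f B T v u0 s u \<Longrightarrow> x \<in> {0..T} \<Longrightarrow> fl.flow (u0, v, s) x = (u x, v, s)"
proof -
  let ?F = "fl.flow (u0, v, s)"
  have F': "(?F has_vector_derivative X (?F x)) (at x within {0..T})" if "x \<in> {0..T}" for x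
    by (rule fl.flow_solves[OF near that])
  have const: "snd (?F x) = (v, s)" if x: "x \<in> {0..T}" for x
  proof -
    have "((\<lambda>x. snd (?F x)) has_vector_derivative 0) (at y within {0..T})" if "y \<in> {0..T}" for y
      using bounded_linear.has_vector_derivative[OF bounded_linear_snd F'[OF that]] by (simp add: X_def zero_prod_def)
    then have "snd (?F x) = snd (?F 0)"
      using x T_gt0 by (intro has_derivative_zero_unique[of "{0..T}"]) (auto simp: has_vector_derivative_def)
    then show ?thesis by (simp add: fl.flow_0)
  qed
  show "profile_solves f B T v u0 s (\<lambda>x. fst (?F x))"
    unfolding profile_solves_def
  proof (intro conjI ballI)
    show "fst (?F 0) = u0" by (simp add: fl.flow_0)
    fix x assume x: "x \<in> {0..T}"
    have "invertible (B (fst (?F x)))" using fl.flow_in_dom[OF near x] by (simp add: dom_def invertible_det_nz)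
    then have "B (fst (?F x)) *v fst (X (?F x)) = rhs (fst (?F x)) v s"
      using const[OF x] by (simp add: X_def matrix_vector_mul_assoc matrix_inv_cancel)
    then show "\<exists>u'. ((\<lambda>x. fst (?F x)) has_vector_derivative u') (at x within {0..T}) \<and>
        B (fst (?F x)) *v u' = f (fst (?F x)) - f v - s *\<^sub>R (fst (?F x) - v)"
      using bounded_linear.has_vector_derivative[OF bounded_linear_fst F'[OF x]] by (auto simp: rhs_def)
  qed
  assume u: "profile_solves f B T v u0 s u" and x: "x \<in> {0..T}"
  show "?F x = (u x, v, s)"
  proof (rule fl.solution_unique[OF near _ _ x, symmetric])
    show "(u 0, v, s) = (u0, v, s)" using u by (simp add: profile_solves_def)
    fix y assume "y \<in> {0..T}"
    then obtain u' where u': "(u has_vector_derivative u') (at y within {0..T})"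
      "B (u y) *v u' = f (u y) - f v - s *\<^sub>R (u y - v)"
      using u unfolding profile_solves_def by blast
    have "((\<lambda>x. (u x, v, s)) has_vector_derivative (u', 0, 0)) (at y within {0..T})"
      by (intro has_vector_derivative_Pair u' has_vector_derivative_const)
    moreover have "(u', 0, 0) = X (u y, v, s)" if "(u y, v, s) \<in> dom"
    proof -
      have "invertible (B (u y))" using that by (simp add: dom_def invertible_det_nz)
      then show ?thesis
        using arg_cong[OF u'(2), of "\<lambda>w. matrix_inv (B (u y)) *v w"]
        by (simp add: X_def rhs_def matrix_vector_mul_assoc matrix_inv_cancel)
    qed
    ultimately show "\<exists>d. ((\<lambda>x. (u x, v, s)) has_vector_derivative d) (at y within {0..T}) \<and> ((u y, v, s) \<in> dom \<longrightarrow> d = X (u y, v, s))"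
      by blast
  qed
qed

lemma profile_eq_flow:
  assumes near: "dist (u0, v, s) (base 0) < fl.rad" and x: "x \<in> {0..T}"
  shows "profile f B T v u0 s x = fst (fl.flow (u0, v, s) x)"
proof -
  have "profile_solves f B T v u0 s (profile f B T v u0 s)"
    unfolding profile_def by (rule someI[of "profile_solves f B T v u0 s"], rule profile_solves_iff_flow(1)[OF near])
  from profile_solves_iff_flow(2)[OF near this x] show ?thesis by simp
qed

section \<open>Variations as solutions of inhomogeneous linear systems\<close>

definition W :: "real \<Rightarrow> real^'n^'n" where "W = fund_sol Px"

lemma Px_reg: "regular_coef Px" and Qx_reg: "regular_coef Qx"
  by (rule regular_coef_periodic[OF _ T_gt0], auto simp: Px_per Qx_per Px_cont Qx_cont)+

lemma W_0: "W 0 = mat 1" and W_deriv: "(W has_vector_derivative Px x ** W x) (at x within S)"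
  unfolding W_def by (rule fund_sol_0[OF Px_reg], rule fund_sol_deriv[OF Px_reg])

definition V :: "real \<Rightarrow> real^'n^'n" where
  "V = (SOME V. V 0 = 0 \<and> (\<forall>x. (V has_vector_derivative Px x ** V x + Qx x) (at x)))"

lemma V_0: "V 0 = 0" and V_deriv: "(V has_vector_derivative Px x ** V x + Qx x) (at x within S)"
  using someI_ex[OF affine_ode_exists[OF bounded_bilinear_matrix_matrix_mult Px_reg Qx_reg]] has_vector_derivative_at_within
  unfolding V_def by blast+

text \<open>The source is minus the s-derivative of the profile equation multiplied by Q, in
  accordance with the sign in \<open>var_speed\<close>.\<close>

definition zt :: "real \<Rightarrow> real^'n" where
  "zt = (SOME z. z 0 = 0 \<and> (\<forall>x. (z has_vector_derivative Px x *v z x + Qx x *v (ubar x - um)) (at x)))"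

lemma zt_0: "zt 0 = 0" and zt_deriv: "(zt has_vector_derivative Px x *v zt x + Qx x *v (ubar x - um)) (at x within S)"
proof -
  have "regular_coef (\<lambda>x. Qx x *v (ubar x - um))"
    by (rule regular_coef_periodic[OF _ T_gt0])
      (auto simp: Qx_per ubar_per intro!: continuous_on_matrix_vector_mult Qx_cont continuous_intros ubar_cont)
  from someI_ex[OF affine_ode_exists[OF bounded_bilinear_matrix_vector_mult' Px_reg this]]
  show "zt 0 = 0" "(zt has_vector_derivative Px x *v zt x + Qx x *v (ubar x - um)) (at x within S)"
    using has_vector_derivative_at_within unfolding zt_def by blast+
qed

definition Fm :: "real^'n^'n" where "Fm = jacobian f (at um)"

lemma Fm_mult: "Fm *v k = fd f um k"
  unfolding Fm_def jacobian_def fd_def[symmetric]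
  by (rule matrix_vector_mult_matrix[OF has_derivative_linear[OF fd[OF f_C2]]])

text \<open>The derivative of the inverse of B supplies the dB term of A, so the variation of u
  enters as P w. The variations of the rest point and of the speed only act as sources.\<close>

lemma X'_base:
  "blinfun_apply (X' (base x)) (w, k, t) = (Px x *v w - Qx x *v (Fm *v k) - t *\<^sub>R (Qx x *v (ubar x - um)), 0, 0)"
proof -
  have "Qx x *v rhs (ubar x) um 0 = du x" by (simp add: rhs_def du_explicit Qx_eq)
  then have 1: "- (Qx x ** fd B (ubar x) w ** Qx x) *v rhs (ubar x) um 0 = - (Qx x *v (fd B (ubar x) w *v du x))"
    by (simp add: bounded_bilinear.minus_left[OF bounded_bilinear_matrix_vector_mult'] matrix_vector_mul_assoc[symmetric])
  have "blinfun_apply (X' (base x)) (w, k, t) = dX (base x) (w, k, t)" by (simp only: X'_apply[OF base_dom])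
  also have "\<dots> = (Qx x *v (fd f (ubar x) w - fd f um k - t *\<^sub>R (ubar x - um))
      + - (Qx x ** fd B (ubar x) w ** Qx x) *v rhs (ubar x) um 0, 0, 0)"
    by (simp add: dX_def base_def Qx_eq)
  also have "\<dots> = (Px x *v w - Qx x *v (Fm *v k) - t *\<^sub>R (Qx x *v (ubar x - um)), 0, 0)"
    unfolding 1 by (simp add: Px_mult Afun_def Fm_mult matrix_vector_mult_diff_distrib matrix_vector_mult_scaleR algebra_simps)
  finally show ?thesis .
qed

lemma linflow_eq:
  assumes x: "x \<in> {0..T}"
  shows "fl.linflow (h, k, t) x = (W x *v h - V x *v (Fm *v k) - t *\<^sub>R zt x, k, t)"
proof (rule fl.linflow_unique[OF _ _ x, symmetric])
  show "(W 0 *v h - V 0 *v (Fm *v k) - t *\<^sub>R zt 0, k, t) = (h, k, t)" by (simp add: W_0 V_0 zt_0)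
  fix x :: real
  let ?w = "W x *v h - V x *v (Fm *v k) - t *\<^sub>R zt x"
  have D: "((\<lambda>x. (W x *v h - V x *v (Fm *v k) - t *\<^sub>R zt x, k, t)) has_vector_derivative
      ((W x *v 0 + (Px x ** W x) *v h) - (V x *v 0 + (Px x ** V x + Qx x) *v (Fm *v k)) - t *\<^sub>R (Px x *v zt x + Qx x *v (ubar x - um)), 0, 0)) (at x within {0..T})"
    by (intro has_vector_derivative_Pair has_vector_derivative_diff has_vector_derivative_matrix_vector_mult
        has_vector_derivative_const W_deriv V_deriv bounded_linear.has_vector_derivative[OF bounded_linear_scaleR_right] zt_deriv)
  have "blinfun_apply (X' (base x)) (?w, k, t) = (Px x *v ?w - Qx x *v (Fm *v k) - t *\<^sub>R (Qx x *v (ubar x - um)), 0, 0)"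
    by (rule X'_base)
  also have "\<dots> = ((W x *v 0 + (Px x ** W x) *v h) - (V x *v 0 + (Px x ** V x + Qx x) *v (Fm *v k)) - t *\<^sub>R (Px x *v zt x + Qx x *v (ubar x - um)), 0, 0)"
    by (simp add: matrix_vector_mult_diff_distrib matrix_vector_mult_add_rdistrib matrix_vector_mult_scaleR
        matrix_vector_mul_assoc[symmetric] algebra_simps)
  finally show "((\<lambda>x. (W x *v h - V x *v (Fm *v k) - t *\<^sub>R zt x, k, t)) has_vector_derivative
      blinfun_apply (X' (base x)) (?w, k, t)) (at x within {0..T})"
    using D by simp
qed

lemma flow_fst_derivative:
  assumes "x \<in> {0..T}"
  shows "((\<lambda>a. fst (fl.flow a x)) has_derivative (\<lambda>a. W x *v fst a - V x *v (Fm *v fst (snd a)) - snd (snd a) *\<^sub>R zt x)) (at (base 0))"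
proof -
  have "(\<lambda>h. fst (fl.linflow h x)) = (\<lambda>a. W x *v fst a - V x *v (Fm *v fst (snd a)) - snd (snd a) *\<^sub>R zt x)"
  proof
    fix a show "fst (fl.linflow a x) = W x *v fst a - V x *v (Fm *v fst (snd a)) - snd (snd a) *\<^sub>R zt x"
      using linflow_eq[OF assms, of "fst a" "fst (snd a)" "snd (snd a)"] by simp
  qed
  with has_derivative_fst[OF fl.flow_has_derivative[OF assms]] show ?thesis by simp
qed

lemma eventually_near:
  assumes "isCont g q" "g q = base 0"
  shows "\<forall>\<^sub>F y in nhds q. dist (g y) (base 0) < fl.rad"
proof -
  have "\<forall>\<^sub>F y in at q. dist (g y) (base 0) < fl.rad"
    using assms fl.rad_pos by (auto simp: isCont_def intro: tendstoD)
  then show ?thesis using assms(2) fl.rad_pos by (simp add: eventually_at_filter) (auto elim!: eventually_mono)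
qed

lemma var_u0_eq:
  assumes x: "x \<in> {0..T}"
  shows "var_u0 f B T um (ubar 0) j x = column j (W x)"
proof -
  have g: "((\<lambda>v. (v, um, 0::real)) has_derivative (\<lambda>h. (h, 0, 0))) (at (ubar 0))"
    by (intro has_derivative_Pair has_derivative_ident has_derivative_const)
  have D: "((\<lambda>v. fst (fl.flow (v, um, 0) x)) has_derivative (\<lambda>h. W x *v h)) (at (ubar 0))"
    using has_derivative_compose[OF g] flow_fst_derivative[OF x] by (fastforce simp: base_def)
  have "\<forall>\<^sub>F v in nhds (ubar 0). dist (v, um, 0) (base 0) < fl.rad"
    by (rule eventually_near) (auto simp: base_def intro!: continuous_intros)
  then have ev: "\<forall>\<^sub>F v in nhds (ubar 0). fst (fl.flow (v, um, 0) x) = profile f B T um v 0 x"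
    by (rule eventually_mono) (rule profile_eq_flow[OF _ x, symmetric])
  have "((\<lambda>v. profile f B T um v 0 x) has_derivative (\<lambda>h. W x *v h)) (at (ubar 0))"
    by (rule has_derivative_transform_eventually[OF D filter_leD[OF at_within_le_nhds ev] eventually_nhds_x_imp_x[OF ev]]) simp
  then have "frechet_derivative (\<lambda>v. profile f B T um v 0 x) (at (ubar 0)) = (\<lambda>h. W x *v h)"
    by (rule frechet_derivative_at[symmetric])
  then show ?thesis by (simp add: var_u0_def matrix_vector_mult_basis)
qed

lemma var_speed_eq:
  assumes x: "x \<in> {0..T}"
  shows "var_speed f B T um (ubar 0) x = zt x"
proof -
  have g: "((\<lambda>s. (ubar 0, um, s::real)) has_derivative (\<lambda>h. (0, 0, h))) (at 0)"
    by (intro has_derivative_Pair has_derivative_ident has_derivative_const)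
  have D: "((\<lambda>s. fst (fl.flow (ubar 0, um, s) x)) has_derivative (\<lambda>h. h *\<^sub>R (- zt x))) (at 0)"
    using has_derivative_compose[OF g] flow_fst_derivative[OF x] by (fastforce simp: base_def)
  have "\<forall>\<^sub>F s in nhds 0. dist (ubar 0, um, s) (base 0) < fl.rad"
    by (rule eventually_near) (auto simp: base_def intro!: continuous_intros)
  then have ev: "\<forall>\<^sub>F s in nhds 0. fst (fl.flow (ubar 0, um, s) x) = profile f B T um (ubar 0) s x"
    by (rule eventually_mono) (rule profile_eq_flow[OF _ x, symmetric])
  have "((\<lambda>s. profile f B T um (ubar 0) s x) has_derivative (\<lambda>h. h *\<^sub>R (- zt x))) (at 0)"
    by (rule has_derivative_transform_eventually[OF D filter_leD[OF at_within_le_nhds ev] eventually_nhds_x_imp_x[OF ev]]) simp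
  then have "vector_derivative (\<lambda>s. profile f B T um (ubar 0) s x) (at 0) = - zt x"
    by (intro vector_derivative_at) (simp add: has_vector_derivative_def)
  then show ?thesis by (simp add: var_speed_def)
qed

end

section \<open>The stability index\<close>

locale transversal_profile = profile_setting f B ubar um T
  for f :: "real^'n::finite \<Rightarrow> real^'n" and B ubar um T +
  fixes i1 :: 'n
  assumes du_0: "du 0 = axis i1 1"
    and F_inv: "invertible (jacobian f (at um))"
    and transv: "transversality f B T i1 um (ubar 0) \<noteq> 0"
begin

text \<open>The matrix of the transversality determinant, and also the derivative of the periodicity
  condition in the unknowns (speed, remaining components of u_0). \<open>GI\<close> integrates the
  same columns over the period.\<close>

definition GG :: "real^'n^'n" where "GG = (\<chi> a b. if b = i1 then zt T $ a else (W T - mat 1) $ a $ b)"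

definition GI :: "real^'n^'n" where
  "GI = (\<chi> a b. if b = i1 then integral {0..T} (\<lambda>x. zt x $ a) else integral {0..T} (\<lambda>x. W x $ a $ b))"

definition VI :: "real^'n^'n" where "VI = (\<chi> a b. integral {0..T} (\<lambda>x. V x $ a $ b))"

lemma in_T: "0 \<in> {0..T}" "T \<in> {0..T}" using T_gt0 by auto

lemma transversality_eq: "transversality f B T i1 um (ubar 0) = det GG"
  unfolding transversality_def GG_def
  by (rule arg_cong[where f=det]) (auto simp: vec_eq_iff var_u0_eq[OF in_T(1)] var_u0_eq[OF in_T(2)]
      var_speed_eq[OF in_T(1)] var_speed_eq[OF in_T(2)] zt_0 W_0 column_def)

lemma GG_inv: "invertible GG"
  using transv by (simp add: transversality_eq invertible_det_nz)

text \<open>Both sides solve w' = P w, and the coordinates are chosen such that ubar'(0) is the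
  basis vector of index \<open>i1\<close>.\<close>

lemma W_column: "column i1 (W x) = du x"
proof -
  have "du x = W x *v du 0"
    unfolding W_def by (rule fund_sol_vector[OF Px_reg]) (use du_deriv in \<open>simp add: ddu_eq\<close>)
  then show ?thesis by (simp add: du_0 matrix_vector_mult_basis)
qed

lemma conts: "continuous_on S W" "continuous_on S V" "continuous_on S zt"
  by (rule continuous_on_vector_derivative, rule W_deriv V_deriv zt_deriv)+

lemma ints: "(\<lambda>x. W x $ a $ b) integrable_on {0..T}" "(\<lambda>x. V x $ a $ b) integrable_on {0..T}" "(\<lambda>x. zt x $ a) integrable_on {0..T}"
  by (intro integrable_continuous_real continuous_intros conts)+

text \<open>The \<open>l\<close>-derivative of the first column differs from the speed variation only in the
  constant \<open>ubar 0\<close> replacing the rest point, which is absorbed by column operations.\<close>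

lemma det_Hmat_0:
  "det (Hmat 0) = 0 \<and> ((\<lambda>l. det (Hmat l)) has_field_derivative of_real (det (block_mat GG (V T) GI VI))) (at 0)"
proof -
  define e where "e = um - ubar 0"
  define z where "z x = zt x + V x *v e" for x
  define p where "p x = ubar x - ubar 0" for x
  have z': "(z has_vector_derivative Px x *v z x + Qx x *v p x) (at x)" for x
  proof -
    have "(z has_vector_derivative (Px x *v zt x + Qx x *v (ubar x - um)) + (V x *v 0 + (Px x ** V x + Qx x) *v e)) (at x)"
      unfolding z_def[abs_def]
      by (intro has_vector_derivative_add zt_deriv has_vector_derivative_matrix_vector_mult V_deriv has_vector_derivative_const)
    also have "(Px x *v zt x + Qx x *v (ubar x - um)) + (V x *v 0 + (Px x ** V x + Qx x) *v e) = Px x *v z x + Qx x *v p x"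
      by (simp add: z_def p_def e_def matrix_vector_mult_add_rdistrib matrix_vector_right_distrib
          matrix_vector_mult_diff_distrib matrix_vector_mul_assoc algebra_simps)
    finally show ?thesis .
  qed
  have p': "(p has_vector_derivative column i1 (W x)) (at x)" for x
    unfolding p_def[abs_def] W_column
    using has_vector_derivative_diff[OF ubar_deriv has_vector_derivative_const] by simp
  have "det (Hmat 0) = 0 \<and> ((\<lambda>l. det (Hmat l)) has_field_derivative of_real (det (block_mat
      (\<chi> a b. if b = i1 then z T $ a else (W T - mat 1) $ a $ b) (V T)
      (\<chi> a b. if b = i1 then integral {0..T} (\<lambda>x. z x $ a) else integral {0..T} (\<lambda>x. W x $ a $ b))
      (\<chi> a b. integral {0..T} (\<lambda>x. V x $ a $ b))))) (at 0)"
  proof (rule det_Hmat_deriv_0[where W=W and V=V and z=z and p=p and k=i1])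
    show "column i1 (W T) = axis i1 1" using W_column[of T] du_per[of 0] du_0 by simp
    show "p T = 0" using ubar_per[of 0] by (simp add: p_def)
  qed (use W_0 W_deriv V_0 V_deriv p' z' in \<open>auto simp: z_def p_def zt_0\<close>)
  also have "block_mat (\<chi> a b. if b = i1 then z T $ a else (W T - mat 1) $ a $ b) (V T)
      (\<chi> a b. if b = i1 then integral {0..T} (\<lambda>x. z x $ a) else integral {0..T} (\<lambda>x. W x $ a $ b))
      (\<chi> a b. integral {0..T} (\<lambda>x. V x $ a $ b))
    = block_mat GG (V T) GI VI ** block_mat (mat 1) 0 (\<chi> a b. if b = i1 then e $ a else 0) (mat 1)"
  proof -
    have R: "(M ** (\<chi> a b. if b = i1 then e $ a else 0)) $ a $ b = (if b = i1 then (M *v e) $ a else 0)" for M :: "real^'n^'n" and a b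
      by (simp add: matrix_matrix_mult_def matrix_vector_mult_def)
    have "integral {0..T} (\<lambda>x. z x $ a) = integral {0..T} (\<lambda>x. zt x $ a) + (VI *v e) $ a" for a
    proof -
      have "integral {0..T} (\<lambda>x. z x $ a) = integral {0..T} (\<lambda>x. zt x $ a + (\<Sum>c\<in>UNIV. V x $ a $ c * e $ c))"
        by (simp add: z_def matrix_vector_mult_def)
      also have "\<dots> = integral {0..T} (\<lambda>x. zt x $ a) + (\<Sum>c\<in>UNIV. integral {0..T} (\<lambda>x. V x $ a $ c) * e $ c)"
        by (simp add: Henstock_Kurzweil_Integration.integral_add integral_sum ints integrable_sum integrable_on_mult_left)
      finally show ?thesis by (simp add: VI_def matrix_vector_mult_def)
    qed
    then show ?thesis
      by (intro block_mat_eqI) (simp_all add: block_mat_mult R GG_def GI_def z_def, simp add: VI_def)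
  qed
  finally show ?thesis by (simp add: det_mul det_block_unit_lower)
qed

text \<open>Since component \<open>i1\<close> of u_0 is a parameter, that slot of the unknown c is
  free and stores the speed. It stores -s, so that the derivative in this slot is +\<open>zt\<close>
  and the derivative of the periodicity condition is exactly \<open>GG\<close>.\<close>

definition emb :: "((real^'n) \<times> real) \<times> (real^'n) \<Rightarrow> (real^'n) \<times> (real^'n) \<times> real" where
  "emb p = (\<chi> j. if j = i1 then snd (fst p) else snd p $ j, fst (fst p), - snd p $ i1)"

lemma emb_apply: "emb ((v, a), c) = (\<chi> j. if j = i1 then a else c $ j, v, - c $ i1)"
  unfolding emb_def fst_conv snd_conv ..

lemma emb_bounded_linear: "bounded_linear emb"
  unfolding linear_conv_bounded_linear[symmetric]
  by (rule linearI) (auto simp: emb_def vec_eq_iff)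

lemmas emb_derivative = bounded_linear_imp_has_derivative[OF emb_bounded_linear]

definition q0 :: "(real^'n) \<times> real" where "q0 = (um, ubar 0 $ i1)"
definition c0 :: "real^'n" where "c0 = (\<chi> j. if j = i1 then 0 else ubar 0 $ j)"

lemma emb_base: "emb (q0, c0) = base 0"
  by (simp add: emb_def q0_def c0_def base_def vec_eq_iff)

definition Psi :: "((real^'n) \<times> real) \<times> (real^'n) \<Rightarrow> real^'n" where
  "Psi p = fst (fl.flow (emb p) T) - fst (emb p)"

definition dPsi :: "((real^'n) \<times> real) \<times> (real^'n) \<Rightarrow> real^'n" where
  "dPsi p = W T *v fst (emb p) - V T *v (Fm *v fst (snd (emb p))) - snd (snd (emb p)) *\<^sub>R zt T - fst (emb p)"

lemma dPsi_c: "dPsi (0, k) = GG *v k"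
proof -
  have "W T *v (\<chi> j. if j = i1 then 0 else k $ j) + k $ i1 *\<^sub>R zt T - (\<chi> j. if j = i1 then 0 else k $ j) = GG *v k"
  proof (simp only: vec_eq_iff, intro allI)
    fix a
    have "(GG *v k) $ a = (\<Sum>j\<in>UNIV. (if j = i1 then zt T $ a * k $ j else 0) + (W T - mat 1) $ a $ j * (if j = i1 then 0 else k $ j))"
      unfolding matrix_vector_mult_def GG_def by (auto intro!: sum.cong)
    also have "\<dots> = zt T $ a * k $ i1 + ((W T - mat 1) *v (\<chi> j. if j = i1 then 0 else k $ j)) $ a"
      by (simp add: sum.distrib matrix_vector_mult_def)
    finally show "(W T *v (\<chi> j. if j = i1 then 0 else k $ j) + k $ i1 *\<^sub>R zt T - (\<chi> j. if j = i1 then 0 else k $ j)) $ a = (GG *v k) $ a"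
      by (simp add: matrix_vector_mult_diff_rdistrib mult.commute)
  qed
  then show ?thesis by (simp add: dPsi_def zero_prod_def emb_apply)
qed

lemma dPsi_v: "dPsi ((v, 0), 0) = - (V T *v (Fm *v v))"
proof -
  have "(\<chi> j. if j = i1 then 0 else (0 :: real^'n) $ j) = 0" by (simp add: vec_eq_iff)
  then show ?thesis by (simp add: dPsi_def emb_apply)
qed

sublocale ie: implicit_equation Psi dPsi q0 c0 1
proof
  show "Psi (q0, c0) = 0"
    using fl.flow_base[OF in_T(2)] ubar_per[of 0] by (simp add: Psi_def emb_base) (simp add: base_def)
  have "((\<lambda>p. fst (fl.flow (emb p) T) - fst (emb p)) has_derivative dPsi) (at (q0, c0))"
    unfolding dPsi_def[abs_def]
    by (intro has_derivative_diff has_derivative_fst emb_derivative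
        has_derivative_compose[OF emb_derivative flow_fst_derivative[OF in_T(2), folded emb_base]])
  then show "(Psi has_derivative dPsi) (at (q0, c0))" by (simp add: Psi_def[abs_def])
  \<comment> \<open>The truncated flow is globally Lipschitz in its initial data, which provides
    continuity away from the base point.\<close>
  have flow_cont: "continuous_on UNIV (\<lambda>a. fl.flow a T)"
  proof (rule lipschitz_on_continuous_on[where L=fl.gw], rule lipschitz_onI)
    show "dist (fl.flow a T) (fl.flow b T) \<le> fl.gw * dist a b" for a b
      using fl.flow_lip[OF in_T(2)] by (simp add: dist_norm)
  qed (use fl.gw_ge_1 in simp)
  have emb_cont: "continuous_on (ball (q0, c0) 1) emb"
    by (rule bounded_linear.continuous_on[OF emb_bounded_linear continuous_on_id])
  show "continuous_on (ball (q0, c0) 1) Psi"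
    unfolding Psi_def[abs_def]
    by (rule continuous_on_diff[OF continuous_on_fst[OF continuous_on_compose2[OF flow_cont emb_cont subset_UNIV]]
          continuous_on_fst[OF emb_cont]])
  show "k = 0" if "dPsi (0, k) = 0" for k
  proof -
    have "matrix_inv GG *v (GG *v k) = 0" using that by (simp add: dPsi_c)
    then show ?thesis by (simp add: matrix_vector_mul_assoc matrix_inv_cancel[OF GG_inv])
  qed
qed simp

text \<open>Makes the choice of a chart in \<open>mass_map\<close> meaningful. The zeros are
  selected pointwise; the linear bound on c - c0 gives the continuity at the base point that a chart
  must have.\<close>

lemma chart_exists: "\<exists>G. periodic_chart f B T i1 um (ubar 0) G"
proof -
  obtain d K where d: "d > 0" "\<And>q. norm (q - q0) < d \<Longrightarrow> \<exists>c. Psi (q, c) = 0 \<and> norm (c - c0) \<le> K * norm (q - q0)"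
    using ie.solution_exists by blast
  define c where "c q = (SOME c. Psi (q, c) = 0 \<and> norm (c - c0) \<le> K * norm (q - q0))" for q
  have c: "Psi (q, c q) = 0" "norm (c q - c0) \<le> K * norm (q - q0)" if "norm (q - q0) < d" for q
    using someI_ex[OF d(2)[OF that]] by (auto simp: c_def)
  have ev: "\<forall>\<^sub>F q in nhds q0. norm (q - q0) < d"
    using d(1) unfolding eventually_nhds_metric by (auto simp: dist_norm)
  have cq0: "c q0 = c0" using c(2)[of q0] d(1) by simp
  have "isCont c q0"
  proof -
    have "((\<lambda>q. K * norm (q - q0)) \<longlongrightarrow> K * norm (q0 - q0)) (at q0)" by (intro tendsto_intros)
    moreover have "K * norm (q0 - q0) = 0" by simp
    ultimately have "((\<lambda>q. K * norm (q - q0)) \<longlongrightarrow> 0) (at q0)" by (simp only:)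
    moreover have "\<forall>\<^sub>F q in nhds q0. norm (c q - c0) \<le> K * norm (q - q0)"
      by (rule eventually_mono[OF ev]) (rule c(2))
    then have "\<forall>\<^sub>F q in at q0. norm (c q - c0) \<le> K * norm (q - q0)"
      by (rule filter_leD[OF at_within_le_nhds])
    ultimately have "((\<lambda>q. c q - c0) \<longlongrightarrow> 0) (at q0)"
      by (rule Lim_null_comparison[rotated])
    then show ?thesis unfolding isCont_def cq0 using LIM_zero_iff by blast
  qed
  then have emb_cont: "isCont (\<lambda>q. emb (q, c q)) q0"
    by (intro bounded_linear.isCont[OF emb_bounded_linear] continuous_intros)
  define G where "G q = (fst (emb (q, c q)), snd (snd (emb (q, c q))))" for q
  have embG: "emb (q, c q) = (fst (G q), fst q, snd (G q))" for q by (simp add: G_def emb_def)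
  have near: "\<forall>\<^sub>F q in nhds q0. dist (emb (q, c q)) (base 0) < fl.rad"
    by (rule eventually_near[OF emb_cont]) (simp add: cq0 emb_base)
  have "periodic_chart f B T i1 um (ubar 0) G"
    unfolding periodic_chart_def q0_def[symmetric]
  proof (intro conjI)
    show "G q0 = (ubar 0, 0)" using emb_base by (simp add: G_def cq0 base_def)
    show "isCont G q0" unfolding G_def by (intro continuous_intros emb_cont)
    show "\<forall>\<^sub>F q in nhds q0. fst (G q) $ i1 = snd q \<and> (\<exists>u. profile_solves f B T (fst q) (fst (G q)) (snd (G q)) u) \<and>
        profile f B T (fst q) (fst (G q)) (snd (G q)) T = fst (G q)"
      using near ev
    proof eventually_elim
      case (elim q)
      have n: "dist (fst (G q), fst q, snd (G q)) (base 0) < fl.rad" using elim(1) by (simp add: embG)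
      have "fst (fl.flow (fst (G q), fst q, snd (G q)) T) = fst (G q)"
        using c(1)[OF elim(2)] by (simp add: Psi_def embG)
      then show ?case
        using profile_solves_iff_flow(1)[OF n] profile_eq_flow[OF n in_T(2)] by (auto simp: G_def emb_def)
    qed
  qed
  then show ?thesis by blast
qed

text \<open>The result of solving the linearised periodicity condition for c and inserting it into
  the variation of the mass.\<close>

definition Mm :: "real^'n^'n" where
  "Mm = GI ** matrix_inv GG ** V T ** Fm - VI ** Fm"

lemma integral_vec_nth: "g integrable_on S \<Longrightarrow> integral S g $ a = integral S (\<lambda>x. g x $ a)"
  for g :: "real \<Rightarrow> real^'n"
  using integral_linear[OF _ bounded_linear_vec_nth, of g S a] by (simp add: o_def)

lemma integral_linflow:
  "fst (integral {0..T} (fl.linflow (emb ((k, 0), c)))) = GI *v c - VI *v (Fm *v k)"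
proof -
  have "fst (integral {0..T} (fl.linflow (emb ((k, 0), c)))) = integral {0..T} (\<lambda>x. fst (fl.linflow (emb ((k, 0), c)) x))"
    using integral_linear[OF fl.linflow_integrable bounded_linear_fst] by (simp add: o_def)
  also have "\<dots> = GI *v c - VI *v (Fm *v k)"
  proof (simp only: vec_eq_iff, intro allI)
    fix a
    let ?E = "\<chi> j. if j = i1 then 0 else c $ j"
    have int: "(\<lambda>x. fst (fl.linflow (emb ((k, 0), c)) x)) integrable_on {0..T}"
      using integrable_linear[OF fl.linflow_integrable bounded_linear_fst] by (simp add: o_def)
    have "integral {0..T} (\<lambda>x. fst (fl.linflow (emb ((k, 0), c)) x)) $ a
        = integral {0..T} (\<lambda>x. fst (fl.linflow (emb ((k, 0), c)) x) $ a)"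
      by (rule integral_vec_nth[OF int])
    also have "\<dots> = integral {0..T} (\<lambda>x. (\<Sum>j\<in>UNIV. W x $ a $ j * ?E $ j) - (\<Sum>j\<in>UNIV. V x $ a $ j * (Fm *v k) $ j) + c $ i1 * zt x $ a)"
      by (rule integral_cong) (simp add: emb_apply linflow_eq matrix_vector_mult_def del: atLeastAtMost_iff)
    also have "\<dots> = (\<Sum>j\<in>UNIV. integral {0..T} (\<lambda>x. W x $ a $ j) * ?E $ j)
        - (\<Sum>j\<in>UNIV. integral {0..T} (\<lambda>x. V x $ a $ j) * (Fm *v k) $ j) + c $ i1 * integral {0..T} (\<lambda>x. zt x $ a)"
      by (simp only: Henstock_Kurzweil_Integration.integral_add Henstock_Kurzweil_Integration.integral_diff integral_sum
          integral_mult_left integral_mult_right ints integrable_sum integrable_on_mult_left integrable_on_mult_right integrable_diff finite)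
    also have "\<dots> = (\<Sum>j\<in>UNIV. GI $ a $ j * c $ j) - (VI *v (Fm *v k)) $ a"
    proof -
      have "(\<Sum>j\<in>UNIV. GI $ a $ j * c $ j)
          = (\<Sum>j\<in>UNIV. integral {0..T} (\<lambda>x. W x $ a $ j) * ?E $ j + (if j = i1 then c $ i1 * integral {0..T} (\<lambda>x. zt x $ a) else 0))"
        by (rule sum.cong) (auto simp: GI_def)
      then show ?thesis by (simp add: sum.distrib VI_def matrix_vector_mult_def)
    qed
    finally show "integral {0..T} (\<lambda>x. fst (fl.linflow (emb ((k, 0), c)) x)) $ a = (GI *v c - VI *v (Fm *v k)) $ a"
      by (simp add: matrix_vector_mult_def)
  qed
  finally show ?thesis .
qed

text \<open>The chart is an arbitrary one, so only the defining properties of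
  \<open>periodic_chart\<close> enter: it gives a continuous branch of zeros of \<open>Psi\<close>,
  whose derivative the implicit equation determines.\<close>

lemma mass_derivative_eq: "mass_derivative f B T i1 um (ubar 0) = Mm"
proof -
  define G where "G = (SOME G. periodic_chart f B T i1 um (ubar 0) G)"
  have "periodic_chart f B T i1 um (ubar 0) G" unfolding G_def by (rule someI_ex[OF chart_exists])
  then have G0: "G q0 = (ubar 0, 0)" and Gc: "isCont G q0"
    and Gev: "\<forall>\<^sub>F q in nhds q0. fst (G q) $ i1 = snd q \<and> (\<exists>u. profile_solves f B T (fst q) (fst (G q)) (snd (G q)) u) \<and>
       profile f B T (fst q) (fst (G q)) (snd (G q)) T = fst (G q)"
    by (auto simp: periodic_chart_def q0_def)
  \<comment> \<open>Repacks the chart into the slots expected by \<open>emb\<close>, with -s at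
    index \<open>i1\<close>.\<close>
  define c where "c q = (\<chi> j. if j = i1 then - snd (G q) else fst (G q) $ j)" for q
  have cc: "isCont c q0"
    unfolding isCont_def
  proof (rule vec_tendstoI)
    fix j
    have "isCont (\<lambda>q. c q $ j) q0"
      by (cases "j = i1") (auto simp: c_def intro!: continuous_intros Gc)
    then show "((\<lambda>q. c q $ j) \<longlongrightarrow> c q0 $ j) (at q0)" by (simp add: isCont_def)
  qed
  have c0: "c q0 = c0" by (simp add: c_def c0_def G0 vec_eq_iff)
  have embc: "emb (q, c q) = (fst (G q), fst q, snd (G q))" if "fst (G q) $ i1 = snd q" for q
    using that by (simp add: emb_def c_def vec_eq_iff)
  have emb_cont: "isCont (\<lambda>q. emb (q, c q)) q0"
    by (intro bounded_linear.isCont[OF emb_bounded_linear] continuous_intros cc)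
  have near: "\<forall>\<^sub>F q in nhds q0. dist (emb (q, c q)) (base 0) < fl.rad"
    by (rule eventually_near[OF emb_cont]) (simp add: c0 emb_base)
  have sol: "\<forall>\<^sub>F q in nhds q0. Psi (q, c q) = 0"
    using near Gev
  proof eventually_elim
    case (elim q)
    then have e: "emb (q, c q) = (fst (G q), fst q, snd (G q))" using embc by blast
    then show ?case
      using elim profile_eq_flow[of "fst (G q)" "fst q" "snd (G q)" T] in_T by (simp add: Psi_def)
  qed
  obtain c' where c': "(c has_derivative c') (at q0)" "\<And>h. dPsi (0, c' h) = - dPsi (h, 0)"
    using ie.implicit_function_derivative[OF cc c0 sol] by blast
  have c'_eq: "c' (k, 0) = matrix_inv GG *v (V T *v (Fm *v k))" for k
  proof -
    have "matrix_inv GG *v (GG *v c' (k, 0)) = matrix_inv GG *v (V T *v (Fm *v k))"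
      using c'(2)[of "(k, 0)"] by (simp add: dPsi_c dPsi_v)
    then show ?thesis by (simp add: matrix_vector_mul_assoc matrix_inv_cancel[OF GG_inv])
  qed
  let ?q = "\<lambda>v. (v, ubar 0 $ i1)"
  have q': "(?q has_derivative (\<lambda>k. (k, 0))) (at um)"
    by (intro has_derivative_Pair has_derivative_ident has_derivative_const)
  have q0: "?q um = q0" by (simp add: q0_def)
  have arg': "((\<lambda>v. emb (?q v, c (?q v))) has_derivative (\<lambda>k. emb ((k, 0), c' (k, 0)))) (at um)"
    by (intro bounded_linear.has_derivative[OF emb_bounded_linear] has_derivative_Pair q'
        has_derivative_compose[OF q'] c'(1)[folded q0])
  have argb: "emb (?q um, c (?q um)) = base 0" by (simp only: q0 c0 emb_base)
  have "((\<lambda>v. fst (integral {0..T} (fl.flow (emb (?q v, c (?q v)))))) has_derivative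
      (\<lambda>k. fst (integral {0..T} (fl.linflow (emb ((k, 0), c' (k, 0))))))) (at um)"
    by (rule has_derivative_fst, rule has_derivative_compose[OF arg'], unfold argb, rule fl.integral_flow_has_derivative)
  then have D: "((\<lambda>v. fst (integral {0..T} (fl.flow (emb (?q v, c (?q v)))))) has_derivative (\<lambda>k. Mm *v k)) (at um)"
    by (rule has_derivative_eq_rhs)
      (simp add: fun_eq_iff integral_linflow c'_eq Mm_def matrix_vector_mult_diff_rdistrib matrix_vector_mul_assoc matrix_mul_assoc)
  have "(?q \<longlongrightarrow> ?q um) (at um)" by (intro tendsto_intros)
  then have "(?q \<longlongrightarrow> ?q um) (nhds um)"
    using tendsto_at_iff_tendsto_nhds[of ?q um] by blast
  then have "filterlim ?q (nhds q0) (nhds um)" by (simp only: q0)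
  from filterlim_iff[THEN iffD1, OF this, rule_format, OF eventually_conj[OF near Gev]]
  have ev: "\<forall>\<^sub>F v in nhds um. fst (integral {0..T} (fl.flow (emb (?q v, c (?q v))))) = mass_map f B T i1 um (ubar 0) (?q v)"
  proof eventually_elim
    case (elim v)
    let ?G = "G (?q v)"
    have e: "emb (?q v, c (?q v)) = (fst ?G, v, snd ?G)" using elim embc[of "?q v"] by simp
    have n: "dist (fst ?G, v, snd ?G) (base 0) < fl.rad" using elim e by simp
    have "mass_map f B T i1 um (ubar 0) (?q v) = integral {0..T} (profile f B T v (fst ?G) (snd ?G))"
      by (simp add: mass_map_def Let_def G_def)
    also have "\<dots> = integral {0..T} (\<lambda>x. fst (fl.flow (fst ?G, v, snd ?G) x))"
      by (rule integral_cong) (rule profile_eq_flow[OF n])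
    also have "\<dots> = fst (integral {0..T} (fl.flow (fst ?G, v, snd ?G)))"
      using integral_linear[OF fl.flow_integrable bounded_linear_fst] by (simp add: o_def)
    finally show ?case by (simp only: e)
  qed
  have "((\<lambda>v. mass_map f B T i1 um (ubar 0) (?q v)) has_derivative (\<lambda>k. Mm *v k)) (at um)"
    by (rule has_derivative_transform_eventually[OF D filter_leD[OF at_within_le_nhds ev] eventually_nhds_x_imp_x[OF ev]]) simp
  then have "frechet_derivative (\<lambda>v. mass_map f B T i1 um (ubar 0) (?q v)) (at um) = (\<lambda>k. Mm *v k)"
    by (rule frechet_derivative_at[symmetric])
  then show ?thesis by (simp add: mass_derivative_def jacobian_def)
qed

text \<open>\<open>Mm\<close> is the Schur complement of \<open>GG\<close> in the block matrix whose
  right column is -V(T) F over -VI F; pulling the factor -F out of this column gives (-1)^n det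
  F.\<close>

lemma index_identity:
  "det GG * det Mm = det (block_mat GG (V T) GI VI) * ((-1) ^ CARD('n) * det Fm)"
proof -
  have "det GG * det Mm = det (block_mat GG (- (V T ** Fm)) GI (- (VI ** Fm)))"
    unfolding det_block_schur[OF GG_inv]
    by (simp add: Mm_def bounded_bilinear.minus_right[OF bounded_bilinear_matrix_matrix_mult] matrix_mul_assoc)
  also have "block_mat GG (- (V T ** Fm)) GI (- (VI ** Fm)) = block_mat GG (V T) GI VI ** block_mat (mat 1) 0 0 (- Fm)"
    by (simp add: block_mat_mult bounded_bilinear.minus_right[OF bounded_bilinear_matrix_matrix_mult])
  also have "- Fm = mat (-1) ** Fm" by (simp add: vec_eq_iff mat_mult_nth)
  finally show ?thesis by (simp add: det_mul det_block_Inr det_mat)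
qed

section \<open>Comparison of the signs near zero and at infinity\<close>

lemma evans_eq: "evans f B ubar T 0 = D"
  by (simp add: fun_eq_iff evans_def evans_det_eq)

lemma sgn_D_limit: "((\<lambda>t. sgn (D (of_real t))) \<longlongrightarrow> of_real ((-1) ^ CARD('n))) at_top"
proof -
  obtain \<Lambda> where \<Lambda>: "\<And>l. \<Lambda> \<le> l \<Longrightarrow> sgn (Dr l) = (-1) ^ CARD('n)" using sgn_Dr_large by blast
  have "\<forall>\<^sub>F t in at_top. sgn (D (of_real t)) = of_real ((-1) ^ CARD('n))"
    using eventually_ge_at_top[of \<Lambda>]
  proof eventually_elim
    case (elim t)
    have "sgn (complex_of_real (Dr t)) = of_real (sgn (Dr t))" by (simp add: sgn_of_real)
    then show ?case using \<Lambda>[OF elim] by (simp add: D_of_real)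
  qed
  then show ?thesis by (rule tendsto_eventually)
qed

abbreviation index :: real where
  "index \<equiv> transversality f B T i1 um (ubar 0) * det (mass_derivative f B T i1 um (ubar 0)) * det (jacobian f (at um))"

text \<open>Together with the identity above, det F enters squared. Being nonzero, it leaves the
  sign unchanged.\<close>

lemma sgn_index: "sgn index = sgn (det (block_mat GG (V T) GI VI) * (-1) ^ CARD('n))"
proof -
  have "index = det (block_mat GG (V T) GI VI) * (-1) ^ CARD('n) * (det Fm * det Fm)"
    using index_identity by (simp add: transversality_eq mass_derivative_eq Fm_def)
  then have "sgn index = sgn (det (block_mat GG (V T) GI VI) * (-1) ^ CARD('n)) * sgn (det Fm * det Fm)"
    by (simp only: sgn_mult)
  moreover have "det Fm \<noteq> 0"
    using F_inv by (simp add: Fm_def[symmetric] invertible_det_nz)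
  then have "sgn (det Fm * det Fm) = 1" by (intro sgn_pos) (simp add: zero_less_mult_iff linorder_neq_iff disj_commute)
  ultimately show ?thesis by simp
qed

theorem stability_index_eq: "stability_index f B ubar T = complex_of_real (sgn index)"
proof -
  let ?h = "det (block_mat GG (V T) GI VI)"
  have "Lim at_top (\<lambda>t. sgn (D (of_real t))) = of_real ((-1) ^ CARD('n))"
    by (rule tendsto_Lim[OF trivial_limit_at_top_linorder sgn_D_limit])
  then have "stability_index f B ubar T = sgn (fact (CARD('n) + 1) * of_real ?h * of_real ((-1) ^ CARD('n)))"
    by (simp only: stability_index_def evans_eq higher_deriv_D[OF conjunct1[OF det_Hmat_0] conjunct2[OF det_Hmat_0]])
  also have "fact (CARD('n) + 1) * of_real ?h * of_real ((-1) ^ CARD('n)) = complex_of_real (fact (CARD('n) + 1) * (?h * (-1) ^ CARD('n)))"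
    by simp
  also have "sgn \<dots> = of_real (sgn (fact (CARD('n) + 1) * (?h * (-1) ^ CARD('n))))" by (simp only: sgn_of_real)
  also have "sgn (fact (CARD('n) + 1) * (?h * (-1) ^ CARD('n))) = sgn (?h * (-1) ^ CARD('n))"
    by (simp add: sgn_mult del: fact_Suc)
  finally show ?thesis by (simp only: sgn_index)
qed

lemma Dr_cont: "continuous_on S Dr"
proof -
  have "continuous_on UNIV (\<lambda>l. det (Hmat l))"
    using det_Hmat_holomorphic holomorphic_on_imp_continuous_on by blast
  then have "continuous_on UNIV D" unfolding D_factor[abs_def] by (intro continuous_intros)
  then have "continuous_on S (\<lambda>t. D (of_real t))"
    by (rule continuous_on_compose2[OF _ continuous_on_of_real[OF continuous_on_id] subset_UNIV])
  from continuous_on_Re[OF this] have "continuous_on S (\<lambda>t. Re (D (of_real t)))" .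
  then show ?thesis by (simp add: D_of_real)
qed

text \<open>For small t > 0 the value \<open>Dr t\<close> behaves like t^(n+1) times H'(0), while
  for large t its sign is (-1)^n. A negative index means opposite signs; multiplication by
  \<open>?s\<close> normalises the sign at infinity to be positive.\<close>

theorem instability:
  assumes "sgn index < 0"
  obtains l where "0 < l" "D (of_real l) = 0"
proof -
  let ?h = "det (block_mat GG (V T) GI VI)" and ?s = "(-1) ^ CARD('n) :: real"
  have s: "?s * ?s = 1" by (simp flip: power_add mult_2)
  have hs: "?h * ?s < 0" using assms by (simp add: sgn_index sgn_less)
  have "((\<lambda>l. det (Hmat l) / l) \<longlongrightarrow> of_real ?h) (at 0)"
    using conjunct2[OF det_Hmat_0] by (simp add: DERIV_def conjunct1[OF det_Hmat_0])
  then have "((\<lambda>t. det (Hmat (of_real t)) / of_real t) \<longlongrightarrow> of_real ?h) (at_right 0)"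
    by (rule filterlim_compose) (auto simp: filterlim_at eventually_at_filter intro!: tendsto_eq_intros)
  from tendsto_Re[OF this]
  have "((\<lambda>t. Re (det (Hmat (of_real t)) / of_real t) * ?s) \<longlongrightarrow> ?h * ?s) (at_right 0)"
    by (intro tendsto_intros) simp
  then have "\<forall>\<^sub>F t in at_right 0. Re (det (Hmat (of_real t)) / of_real t) * ?s < 0"
    using hs by (rule order_tendstoD)
  then obtain b where b: "b > 0" "\<And>t. 0 < t \<Longrightarrow> t < b \<Longrightarrow> Re (det (Hmat (of_real t)) / of_real t) * ?s < 0"
    unfolding eventually_at_right_field by auto
  obtain \<Lambda> where \<Lambda>: "\<Lambda> > 0" "\<And>l. \<Lambda> \<le> l \<Longrightarrow> sgn (Dr l) = ?s" using sgn_Dr_large by blast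
  \<comment> \<open>Halving puts a below both thresholds, so the sign near 0 is known at a, and a
    lies to the left of \<Lambda>.\<close>
  define a where "a = min (b / 2) (\<Lambda> / 2)"
  have a: "0 < a" "a < b" "a < \<Lambda>" using b \<Lambda> by (auto simp: a_def)
  have "Dr a = a ^ (CARD('n) + 1) * Re (det (Hmat (of_real a)) / of_real a)"
  proof -
    have "complex_of_real (Dr a) = of_real (a ^ (CARD('n) + 1)) * (det (Hmat (of_real a)) / of_real a)"
      using a by (simp add: D_of_real[symmetric] D_factor)
    moreover have "Re (of_real r * u) = r * Re u" for r u by simp
    ultimately show ?thesis by (metis Re_complex_of_real)
  qed
  then have "Dr a * ?s = a ^ (CARD('n) + 1) * (Re (det (Hmat (of_real a)) / of_real a) * ?s)" by (simp only: mult.assoc)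
  also have "\<dots> < 0" using a(1) by (intro mult_pos_neg[OF _ b(2)[OF a(1,2)]]) simp
  finally have neg: "Dr a * ?s < 0" .
  have "Dr \<Lambda> * ?s = \<bar>Dr \<Lambda>\<bar>" using \<Lambda>(2)[of \<Lambda>] mult_sgn_abs[of "Dr \<Lambda>"] s by (metis abs_sgn order_refl)
  then have pos: "0 \<le> Dr \<Lambda> * ?s" by simp
  have "\<exists>x\<ge>a. x \<le> \<Lambda> \<and> Dr x * ?s = 0"
    by (rule IVT') (use neg pos a in \<open>auto intro!: continuous_intros Dr_cont\<close>)
  then obtain x where "a \<le> x" "Dr x = 0" by auto
  then show ?thesis using a by (intro that[of x]) (auto simp: D_of_real)
qed

end

theorem theorem5p9:
  fixes f :: "real^'n::finite \<Rightarrow> real^'n"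
    and B :: "real^'n \<Rightarrow> real^'n^'n"
    and ubar :: "real \<Rightarrow> real^'n"
    and um :: "real^'n"
    and T :: real
    and i1 :: 'n
  assumes "C2_map f" and "C2_map B"
    and "T > 0"
    and "stationary_profile f B um ubar"
    and "\<And>x. ubar (x + T) = ubar x"
    and "\<not> ubar constant_on UNIV"
    and "vector_derivative ubar (at 0) = axis i1 1"
    and "\<And>x \<mu>. \<mu> \<in> mat_spectrum (B (ubar x)) \<Longrightarrow> Re \<mu> > 0"
    and "invertible (jacobian f (at um))"
    and "transversality f B T i1 um (ubar 0) \<noteq> 0"
  shows "stability_index f B ubar T =
           complex_of_real (sgn (transversality f B T i1 um (ubar 0)
             * det (mass_derivative f B T i1 um (ubar 0)) * det (jacobian f (at um)))) \<and>
         (\<forall>p\<ge>1. weakly_spectrally_stable f B ubar p \<longrightarrow>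
           sgn (transversality f B T i1 um (ubar 0)
             * det (mass_derivative f B T i1 um (ubar 0)) * det (jacobian f (at um))) \<ge> 0)"
proof -
  interpret profile_setting f B ubar um T
    by unfold_locales (use assms in auto)
  interpret transversal_profile f B ubar um T i1
    by unfold_locales (use assms in \<open>auto simp: du_def\<close>)
  show ?thesis
  proof (intro conjI allI impI stability_index_eq)
    fix p :: ennreal assume p: "1 \<le> p" and stable: "weakly_spectrally_stable f B ubar p"
    show "0 \<le> sgn index"
    proof (rule ccontr)
      assume "\<not> 0 \<le> sgn index"
      then have "sgn index < 0" by (simp only: not_le)
      then obtain l where l: "0 < l" "D (of_real l) = 0" by (rule instability)
      have "of_real l \<in> L_spectrum (Bcoef B ubar) (Acoef f B ubar) p"
        by (rule positive_root_in_spectrum[OF l(2) p])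
      then have "Re (complex_of_real l) \<le> 0" using stable unfolding weakly_spectrally_stable_def by blast
      then show False using l by simp
    qed
  qed
qed

end
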